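(* Let $L$ be a Lie algebra over a field $k$ and $H$ an ideal of $L$ such that $L=H\rtimes L_0$, where $L_0$ is abelian and $\dim(L_0)=n<\infty$. Let $\theta:H\to L$ be a Lie algebra homomorphism such that there is a positive integer $m$ with $\theta(b^m\circ h)=0$ for all $b\in L_0$ and $h\in H$. If $\mathrm{char}(k)=p>0$, assume that $m=p$. Then there is a homomorphism of Lie algebras $$\psi: L\to L\wr\mathrm{Der}\,X=(X\otimes L)\rtimes\mathrm{Der}\,X$$ given on $H$ by $$\psi(h)=\sum_{0\le i_1,\ldots,i_n\le m-1}(i_1!\cdots i_n!)^{-1}\,x_1^{i_1}\cdots x_n^{i_n}\otimes\theta(y_1^{i_1}\cdots y_n^{i_n}\circ h)\qquad(h\in H),$$ where 1. $X=k[x_1,\ldots,x_n]/I$, with $I=(x_1^p,\ldots,x_n^p)$ if $\mathrm{char}(k)=p>0$ and $I=0$ if $\mathrm{char}(k)=0$; 2. $L_0$ has a basis $y_1,\ldots,y_n$ over $k$ such that $\psi(y_i)=\partial/\partial x_i$ for every $1\le i\le n$; 3. $\theta$ is the virtual endomorphism associated to $\psi$ with respect to the $k$-algebra map $\epsilon:X\to k$ defined by $\epsilon(x_i)=0$ for every $1\le i\le n$.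
   Context: All tensor products are over $k$. For a commutative $k$-algebra $X$ with $1$, $\mathrm{Der}\,X$ is the Lie algebra of $k$-derivations of $X$, and $(X\otimes L)\rtimes\mathrm{Der}\,X$ is the Lie algebra with brackets $[x_1\otimes a_1,x_2\otimes a_2]=(x_1x_2)\otimes[a_1,a_2]$, $[\delta,x\otimes a]=\delta(x)\otimes a$, and the usual bracket on $\mathrm{Der}\,X$; $\pi$ denotes its canonical projection onto $\mathrm{Der}\,X$. $L=H\rtimes L_0$ means that $H$ is an ideal, $L_0$ is a Lie subalgebra, and $L=H\oplus L_0$ as vector spaces. For $b,h\in L$, $b\circ h=[b,h]$; for $\lambda$ in the universal enveloping algebra $U(L)$, $\lambda\circ h$ is the result of the adjoint left action of $\lambda$ on $h$; in particular $b^m\circ h=\mathrm{ad}(b)^m(h)$, $b^0\circ h=h$. That $\theta:H\to L$ is the virtual endomorphism associated to $\psi$ with respect to $\epsilon$ means: $H=\mathrm{Ker}(\pi\psi)$ and $\theta=(\epsilon\otimes\mathrm{id}_L)\circ\psi|_H$, i.e. $\theta(h)=\sum_i\epsilon(z_i)a_i$ when $\psi(h)=\sum_i z_i\otimes a_i$. *)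

theory Defs
  imports
    "HOL-Library.Poly_Mapping"
    "HOL-Algebra.QuotRing"
    "Jordan_Normal_Form.VS_Connect"
begin

text \<open>
  The ground field is a type \<open>'k\<close> of class \<^class>\<open>field\<close>, regarded as the ring record
  \<^term>\<open>class_ring :: 'k::field ring\<close>; all other structures are records with carriers. The ring fields
  \<^const>\<open>mult\<close> and \<^const>\<open>one\<close> that a Lie algebra inherits from \<^typ>\<open>('k, 'l) module\<close> are
  meaningless and never used.
\<close>

record ('k, 'l) lie = "('k, 'l) module" +
  lie_bracket :: "'l \<Rightarrow> 'l \<Rightarrow> 'l"

locale lie_algebra = vectorspace class_ring L
  for L :: "('k::field, 'l, 'c) lie_scheme" (structure) +
  assumes bracket_closed:
      "\<lbrakk>x \<in> carrier L; y \<in> carrier L\<rbrakk> \<Longrightarrow> lie_bracket L x y \<in> carrier L"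
    and bracket_add_left:
      "\<lbrakk>x \<in> carrier L; y \<in> carrier L; z \<in> carrier L\<rbrakk> \<Longrightarrow>
        lie_bracket L (x \<oplus> y) z = lie_bracket L x z \<oplus> lie_bracket L y z"
    and bracket_add_right:
      "\<lbrakk>x \<in> carrier L; y \<in> carrier L; z \<in> carrier L\<rbrakk> \<Longrightarrow>
        lie_bracket L x (y \<oplus> z) = lie_bracket L x y \<oplus> lie_bracket L x z"
    and bracket_smult_left:
      "\<lbrakk>x \<in> carrier L; y \<in> carrier L\<rbrakk> \<Longrightarrow> lie_bracket L (c \<odot>\<^bsub>L\<^esub> x) y = c \<odot>\<^bsub>L\<^esub> lie_bracket L x y"
    and bracket_smult_right:
      "\<lbrakk>x \<in> carrier L; y \<in> carrier L\<rbrakk> \<Longrightarrow> lie_bracket L x (c \<odot>\<^bsub>L\<^esub> y) = c \<odot>\<^bsub>L\<^esub> lie_bracket L x y"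
    and bracket_self: "x \<in> carrier L \<Longrightarrow> lie_bracket L x x = \<zero>"
    and jacobi:
      "\<lbrakk>x \<in> carrier L; y \<in> carrier L; z \<in> carrier L\<rbrakk> \<Longrightarrow>
        lie_bracket L x (lie_bracket L y z) \<oplus> lie_bracket L y (lie_bracket L z x)
          \<oplus> lie_bracket L z (lie_bracket L x y) = \<zero>"

definition lie_subalgebra :: "'l set \<Rightarrow> ('k::field, 'l, 'c) lie_scheme \<Rightarrow> bool" where
  "lie_subalgebra S L \<longleftrightarrow> VectorSpace.subspace class_ring S L \<and>
     (\<forall>x\<in>S. \<forall>y\<in>S. lie_bracket L x y \<in> S)"

definition lie_ideal :: "'l set \<Rightarrow> ('k::field, 'l, 'c) lie_scheme \<Rightarrow> bool" where
  "lie_ideal H L \<longleftrightarrow> VectorSpace.subspace class_ring H L \<and>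
     (\<forall>x\<in>carrier L. \<forall>h\<in>H. lie_bracket L x h \<in> H)"

definition semidirect_decomposition ::
  "('k::field, 'l, 'c) lie_scheme \<Rightarrow> 'l set \<Rightarrow> 'l set \<Rightarrow> bool" where
  "semidirect_decomposition L H S \<longleftrightarrow> lie_ideal H L \<and> lie_subalgebra S L \<and>
     H <+>\<^bsub>L\<^esub> S = carrier L \<and> H \<inter> S = {\<zero>\<^bsub>L\<^esub>}"

definition lie_hom ::
  "('k::field, 'l, 'c) lie_scheme \<Rightarrow> ('k, 'm, 'd) lie_scheme \<Rightarrow> ('l \<Rightarrow> 'm) set" where
  "lie_hom L M = {f \<in> LinearCombinations.module_hom class_ring L M.
     \<forall>x\<in>carrier L. \<forall>y\<in>carrier L. f (lie_bracket L x y) = lie_bracket M (f x) (f y)}"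

text \<open>
  The adjoint action of the element \<open>y\<^sub>0\<^bsup>i 0\<^esup> \<cdots> y\<^sub>n\<^sub>-\<^sub>1\<^bsup>i (n - 1)\<^esup>\<close> of the universal enveloping
  algebra: as for any left module, the leftmost factor acts last.
\<close>

definition monomial_action ::
  "('k, 'l, 'c) lie_scheme \<Rightarrow> nat \<Rightarrow> (nat \<Rightarrow> 'l) \<Rightarrow> (nat \<Rightarrow> nat) \<Rightarrow> 'l \<Rightarrow> 'l" where
  "monomial_action L n y i h = foldr (\<lambda>j. lie_bracket L (y j) ^^ i j) [0..<n] h"

definition module_quotient :: "('k, 'v, 'c) module_scheme \<Rightarrow> 'v set \<Rightarrow> ('k, 'v set) module" where
  "module_quotient M N =
     \<lparr>carrier = a_rcosets\<^bsub>M\<^esub> N, mult = undefined, one = undefined, zero = N, add = set_add M,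
      smult = (\<lambda>c A. the_elem ((\<lambda>v. N +>\<^bsub>M\<^esub> (c \<odot>\<^bsub>M\<^esub> v)) ` A))\<rparr>"

definition free_space :: "('k::field, 'v, 'c) module_scheme \<Rightarrow> ('k, 'w, 'd) module_scheme \<Rightarrow>
    ('k, ('v \<times> 'w) \<Rightarrow>\<^sub>0 'k) module" where
  "free_space V W =
     \<lparr>carrier = {f. Poly_Mapping.keys f \<subseteq> carrier V \<times> carrier W},
      mult = undefined, one = undefined, zero = 0, add = (+),
      smult = (\<lambda>c. Poly_Mapping.map ((*) c))\<rparr>"

definition bilinear_relations :: "('k::field, 'v, 'c) module_scheme \<Rightarrow> ('k, 'w, 'd) module_scheme \<Rightarrow>
    (('v \<times> 'w) \<Rightarrow>\<^sub>0 'k) set" where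
  "bilinear_relations V W = LinearCombinations.module.span class_ring (free_space V W)
     ({Poly_Mapping.single (v \<oplus>\<^bsub>V\<^esub> v', w) 1 - Poly_Mapping.single (v, w) 1
         - Poly_Mapping.single (v', w) 1 |
         v v' w. v \<in> carrier V \<and> v' \<in> carrier V \<and> w \<in> carrier W} \<union>
      {Poly_Mapping.single (v, w \<oplus>\<^bsub>W\<^esub> w') 1 - Poly_Mapping.single (v, w) 1
         - Poly_Mapping.single (v, w') 1 |
         v w w'. v \<in> carrier V \<and> w \<in> carrier W \<and> w' \<in> carrier W} \<union>
      {Poly_Mapping.single (c \<odot>\<^bsub>V\<^esub> v, w) 1 - Poly_Mapping.single (v, w) c |
         c v w. v \<in> carrier V \<and> w \<in> carrier W} \<union>
      {Poly_Mapping.single (v, c \<odot>\<^bsub>W\<^esub> w) 1 - Poly_Mapping.single (v, w) c |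
         c v w. v \<in> carrier V \<and> w \<in> carrier W})"

definition tensor :: "('k::field, 'v, 'c) module_scheme \<Rightarrow> ('k, 'w, 'd) module_scheme \<Rightarrow>
    ('k, (('v \<times> 'w) \<Rightarrow>\<^sub>0 'k) set) module" where
  "tensor V W = module_quotient (free_space V W) (bilinear_relations V W)"

definition pure_tensor :: "('k::field, 'v, 'c) module_scheme \<Rightarrow> ('k, 'w, 'd) module_scheme \<Rightarrow>
    'v \<Rightarrow> 'w \<Rightarrow> (('v \<times> 'w) \<Rightarrow>\<^sub>0 'k) set" where
  "pure_tensor V W v w =
     bilinear_relations V W +>\<^bsub>free_space V W\<^esub> Poly_Mapping.single (v, w) 1"

text \<open>
  The linear map \<open>V \<otimes> W \<rightarrow> U\<close>, \<open>v \<otimes> w \<mapsto> \<beta> v w\<close>, induced by a bilinear map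
  \<open>\<beta> : V \<times> W \<rightarrow> U\<close>. The image below is a singleton exactly because bilinearity makes the value
  independent of the representative of a coset.
\<close>

definition tensor_lift :: "('k::field, 'u, 'c) module_scheme \<Rightarrow> ('v \<Rightarrow> 'w \<Rightarrow> 'u) \<Rightarrow>
    (('v \<times> 'w) \<Rightarrow>\<^sub>0 'k) set \<Rightarrow> 'u" where
  "tensor_lift U \<beta> t = the_elem
     ((\<lambda>f. \<Oplus>\<^bsub>U\<^esub>q\<in>Poly_Mapping.keys f. Poly_Mapping.lookup f q \<odot>\<^bsub>U\<^esub> \<beta> (fst q) (snd q)) ` t)"

definition derivations :: "('k::field, 'x, 'c) module_scheme \<Rightarrow> ('x \<Rightarrow> 'x) set" where
  "derivations X = {\<delta> \<in> extensional (carrier X). \<delta> \<in> LinearCombinations.module_hom class_ring X X \<and>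
     (\<forall>x\<in>carrier X. \<forall>y\<in>carrier X. \<delta> (x \<otimes>\<^bsub>X\<^esub> y) = (\<delta> x \<otimes>\<^bsub>X\<^esub> y) \<oplus>\<^bsub>X\<^esub> (x \<otimes>\<^bsub>X\<^esub> \<delta> y))}"

definition Der :: "('k::field, 'x, 'c) module_scheme \<Rightarrow> ('k, 'x \<Rightarrow> 'x) lie" where
  "Der X =
     \<lparr>carrier = derivations X, mult = undefined, one = undefined,
      zero = (\<lambda>x\<in>carrier X. \<zero>\<^bsub>X\<^esub>),
      add = (\<lambda>\<delta> \<epsilon>. \<lambda>x\<in>carrier X. \<delta> x \<oplus>\<^bsub>X\<^esub> \<epsilon> x),
      smult = (\<lambda>c \<delta>. \<lambda>x\<in>carrier X. c \<odot>\<^bsub>X\<^esub> \<delta> x),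
      lie_bracket = (\<lambda>\<delta> \<epsilon>. \<lambda>x\<in>carrier X. \<delta> (\<epsilon> x) \<ominus>\<^bsub>X\<^esub> \<epsilon> (\<delta> x))\<rparr>"

definition tensor_bracket :: "('k::field, 'x, 'c) module_scheme \<Rightarrow> ('k, 'l, 'd) lie_scheme \<Rightarrow>
    (('x \<times> 'l) \<Rightarrow>\<^sub>0 'k) set \<Rightarrow> (('x \<times> 'l) \<Rightarrow>\<^sub>0 'k) set \<Rightarrow> (('x \<times> 'l) \<Rightarrow>\<^sub>0 'k) set" where
  "tensor_bracket X L s t =
     tensor_lift (tensor X L)
       (\<lambda>x\<^sub>1 a\<^sub>1. tensor_lift (tensor X L)
          (\<lambda>x\<^sub>2 a\<^sub>2. pure_tensor X L (x\<^sub>1 \<otimes>\<^bsub>X\<^esub> x\<^sub>2) (lie_bracket L a\<^sub>1 a\<^sub>2)) t) s"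

definition derivation_action :: "('k::field, 'x, 'c) module_scheme \<Rightarrow> ('k, 'l, 'd) lie_scheme \<Rightarrow>
    ('x \<Rightarrow> 'x) \<Rightarrow> (('x \<times> 'l) \<Rightarrow>\<^sub>0 'k) set \<Rightarrow> (('x \<times> 'l) \<Rightarrow>\<^sub>0 'k) set" where
  "derivation_action X L \<delta> t = tensor_lift (tensor X L) (\<lambda>x a. pure_tensor X L (\<delta> x) a) t"

text \<open>
  An element \<open>t + \<delta>\<close> of \<open>(X \<otimes> L) \<rtimes> Der X\<close> is the pair \<open>(t, \<delta>)\<close>; thus \<open>X \<otimes> L\<close> consists
  of the pairs \<open>(t, 0)\<close>, \<open>Der X\<close> of the pairs \<open>(0, \<delta>)\<close>, and the projection onto \<open>Der X\<close> is
  \<^const>\<open>snd\<close>.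
\<close>

definition wreath :: "('k::field, 'l, 'd) lie_scheme \<Rightarrow> ('k, 'x, 'c) module_scheme \<Rightarrow>
    ('k, (('x \<times> 'l) \<Rightarrow>\<^sub>0 'k) set \<times> ('x \<Rightarrow> 'x)) lie" where
  "wreath L X =
     \<lparr>carrier = carrier (tensor X L) \<times> carrier (Der X), mult = undefined, one = undefined,
      zero = (\<zero>\<^bsub>tensor X L\<^esub>, \<zero>\<^bsub>Der X\<^esub>),
      add = (\<lambda>(s, \<delta>) (t, \<epsilon>). (s \<oplus>\<^bsub>tensor X L\<^esub> t, \<delta> \<oplus>\<^bsub>Der X\<^esub> \<epsilon>)),
      smult = (\<lambda>c (s, \<delta>). (c \<odot>\<^bsub>tensor X L\<^esub> s, c \<odot>\<^bsub>Der X\<^esub> \<delta>)),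
      lie_bracket = (\<lambda>(s, \<delta>) (t, \<epsilon>).
        ((tensor_bracket X L s t \<oplus>\<^bsub>tensor X L\<^esub> derivation_action X L \<delta> t)
            \<ominus>\<^bsub>tensor X L\<^esub> derivation_action X L \<epsilon> s,
         lie_bracket (Der X) \<delta> \<epsilon>))\<rparr>"

definition algebra_characters :: "('k::field, 'x, 'c) module_scheme \<Rightarrow> ('x \<Rightarrow> 'k) set" where
  "algebra_characters X = {\<epsilon> \<in> Ring.ring_hom X class_ring. \<forall>c. \<forall>x\<in>carrier X. \<epsilon> (c \<odot>\<^bsub>X\<^esub> x) = c * \<epsilon> x}"

definition virtual_endomorphism :: "('k::field, 'l, 'd) lie_scheme \<Rightarrow> ('k, 'x, 'c) module_scheme \<Rightarrow>
    ('l \<Rightarrow> (('x \<times> 'l) \<Rightarrow>\<^sub>0 'k) set \<times> ('x \<Rightarrow> 'x)) \<Rightarrow> ('x \<Rightarrow> 'k) \<Rightarrow> 'l set \<Rightarrow> ('l \<Rightarrow> 'l) \<Rightarrow> bool" where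
  "virtual_endomorphism L X \<psi> \<epsilon> H \<theta> \<longleftrightarrow>
     H = {a \<in> carrier L. snd (\<psi> a) = \<zero>\<^bsub>Der X\<^esub>} \<and>
     (\<forall>h\<in>H. \<theta> h = tensor_lift L (\<lambda>x a. \<epsilon> x \<odot>\<^bsub>L\<^esub> a) (fst (\<psi> h)))"

text \<open>
  Exponent vectors are finitely supported functions on the variable indices; the ring
  \<open>k[x\<^sub>0, \<dots>, x\<^sub>n\<^sub>-\<^sub>1]\<close> is the subring of the polynomials that involve no other variables.
\<close>

type_synonym 'k mpoly = "(nat \<Rightarrow>\<^sub>0 nat) \<Rightarrow>\<^sub>0 'k"

definition poly_ring :: "nat \<Rightarrow> 'k::field mpoly ring" where
  "poly_ring n =
     class_ring\<lparr>carrier := {P. \<forall>e\<in>Poly_Mapping.keys P. Poly_Mapping.keys e \<subseteq> {..<n}}\<rparr>"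

definition poly_const :: "'k::field \<Rightarrow> 'k mpoly" where
  "poly_const c = Poly_Mapping.single 0 c"

definition poly_var :: "nat \<Rightarrow> 'k::field mpoly" where
  "poly_var i = Poly_Mapping.single (Poly_Mapping.single i 1) 1"

definition poly_partial :: "nat \<Rightarrow> 'k::field mpoly \<Rightarrow> 'k mpoly" where
  "poly_partial i P = (\<Sum>e\<in>Poly_Mapping.keys P.
     Poly_Mapping.single (e - Poly_Mapping.single i 1)
       (of_nat (Poly_Mapping.lookup e i) * Poly_Mapping.lookup P e))"

definition trunc_ideal :: "nat \<Rightarrow> 'k::field mpoly set" where
  "trunc_ideal n = (if CHAR('k) = 0 then {0}
     else Idl\<^bsub>poly_ring n\<^esub> ((\<lambda>i. poly_var i ^ CHAR('k)) ` {..<n}))"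

definition trunc_algebra :: "nat \<Rightarrow> ('k::field, 'k mpoly set) module" where
  "trunc_algebra n = (let Q = poly_ring n Quot trunc_ideal n in
     \<lparr>carrier = carrier Q, mult = mult Q, one = one Q, zero = zero Q, add = add Q,
      smult = (\<lambda>c z. (trunc_ideal n +>\<^bsub>poly_ring n\<^esub> poly_const c) \<otimes>\<^bsub>Q\<^esub> z)\<rparr>)"

definition trunc_var :: "nat \<Rightarrow> nat \<Rightarrow> 'k::field mpoly set" where
  "trunc_var n i = trunc_ideal n +>\<^bsub>poly_ring n\<^esub> poly_var i"

text \<open>
  Formal partial differentiation maps \<^const>\<open>trunc_ideal\<close> into itself, hence descends to the
  quotient.
\<close>

definition trunc_partial :: "nat \<Rightarrow> nat \<Rightarrow> 'k::field mpoly set \<Rightarrow> 'k mpoly set" where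
  "trunc_partial n i = (\<lambda>z\<in>carrier (trunc_algebra n).
     the_elem ((\<lambda>P. trunc_ideal n +>\<^bsub>poly_ring n\<^esub> poly_partial i P) ` z))"

end

theory Submission
  imports Defs
begin

text \<open>
  For \<open>h \<in> H\<close> let \<open>F h = \<Sum> x\<^sup>e / e! \<otimes> \<theta> (y\<^sup>e \<circ> h)\<close>, the sum over all exponents \<open>e\<close> with entries below \<open>m\<close>.
  The Leibniz rule for divided powers, \<open>y\<^sup>c/c! \<circ> [h, h'] = \<Sum> [y\<^sup>a/a! \<circ> h, y\<^sup>b/b! \<circ> h']\<close> over \<open>a + b = c\<close>,
  shows that \<open>F\<close> preserves brackets: the terms for which \<open>a + b\<close> has an entry \<open>\<ge> m\<close> contribute \<open>0\<close>, in
  characteristic \<open>p\<close> because \<open>x\<^sub>j\<^sup>p = 0\<close> and in characteristic \<open>0\<close> because they add up to values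
  \<open>\<theta> (y\<^sup>c \<circ> [h, h']) = 0\<close>. Moreover \<open>\<partial>/\<partial>x\<^sub>j (F h) = F (y\<^sub>j \<circ> h)\<close>, where \<open>\<theta> (y\<^sub>j\<^sup>m \<circ> h) = 0\<close> disposes of the terms
  with \<open>e\<^sub>j = m - 1\<close> on the right. Hence \<open>h + \<Sum> c\<^sub>j y\<^sub>j \<mapsto> F h + \<Sum> c\<^sub>j \<partial>/\<partial>x\<^sub>j\<close> is a homomorphism.
\<close>

section \<open>Tensor products\<close>

text \<open>The obstacle is that the Leibniz rule for \<open>c\<close> needs \<open>c!\<close> to be
  invertible, while two exponents with entries below \<open>m\<close> can add up to entries as large
  as \<open>2m - 2\<close>. In characteristic 0 every \<open>c\<close> is admissible, so the range
  of \<open>c\<close> is enlarged to entries below \<open>2m\<close>; in characteristic p it has to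
  stay below p, and the truncation of \<open>X\<close> removes the excess. In characteristic 0 the
  enlarged range also admits pairs in which \<open>a\<close> or \<open>b\<close> has an entry of at
  least \<open>m\<close>. They vanish because \<theta> respects brackets: \<theta> of
  [y^a h, y^b h'] is a bracket with a zero factor. No basis of the tensor product is ever chosen.
  Tensors are cosets in a free space, and identities between them are tested against all bilinear
  forms B. The Leibniz rule is therefore proved for additive maps \<phi> from H to k, where dividing
  by \<open>c_j + 1\<close> is field arithmetic, and then applied to \<phi> u = B(x^c, \<theta> u).
  The partial derivatives are linearly independent and commute. The first fact makes the kernel of
  the projection exactly H, the second matches the abelian complement.\<close>

lemma keys_scale_subset: "Poly_Mapping.keys (Poly_Mapping.map ((*) c) f) \<subseteq> Poly_Mapping.keys f"
  for f :: "'a \<Rightarrow>\<^sub>0 'k::field"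
  by transfer (auto simp: when_def)

lemma lookup_scale: "Poly_Mapping.lookup (Poly_Mapping.map ((*) c) f) q = c * Poly_Mapping.lookup f q"
  for f :: "'a \<Rightarrow>\<^sub>0 'k::field"
  by transfer (auto simp: when_def)

lemma poly_mapping_sum_single: "(\<Sum>q\<in>Poly_Mapping.keys f. Poly_Mapping.single q (Poly_Mapping.lookup f q)) = f"
  by (rule poly_mapping_eqI)
    (auto simp: lookup_sum lookup_single when_def in_keys_iff)

text \<open>The ground field as a record, so that bilinear forms become the instance
  \<open>U = scalars\<close> of bilinear maps and need no theory of their own.\<close>

definition scalars :: "('k::field, 'k) module" where
  "scalars = \<lparr>carrier = UNIV, mult = (*), one = 1, zero = 0, add = (+), smult = (*)\<rparr>"

lemma scalars_simps [simp]:
  "carrier scalars = UNIV" "\<zero>\<^bsub>scalars\<^esub> = 0" "a \<oplus>\<^bsub>scalars\<^esub> b = a + b" "c \<odot>\<^bsub>scalars\<^esub> a = c * a"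
  by (simp_all add: scalars_def)

lemma scalars_vectorspace: "vectorspace class_ring (scalars :: ('k::field, 'k) module)"
proof -
  have "module class_ring (scalars :: ('k, 'k) module)"
    by (rule module_criteria) (auto simp: algebra_simps class_cring.is_cring intro: exI[of _ "- v" for v])
  then show ?thesis
    by (simp add: vectorspace_def class_field)
qed

lemma finsum_scalars [simp]: "finsum scalars f A = sum f A"
proof -
  interpret vectorspace class_ring scalars
    by (rule scalars_vectorspace)
  show ?thesis
    by (induct A rule: infinite_finite_induct) auto
qed

section \<open>Bilinear maps and their linear extension to the free space\<close>

definition bilinear_map :: "('k::field, 'v, 'c) module_scheme \<Rightarrow> ('k, 'w, 'd) module_scheme \<Rightarrow>
    ('k, 'u, 'e) module_scheme \<Rightarrow> ('v \<Rightarrow> 'w \<Rightarrow> 'u) \<Rightarrow> bool" where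
  "bilinear_map V W U \<beta> \<longleftrightarrow>
    (\<forall>v\<in>carrier V. \<forall>w\<in>carrier W. \<beta> v w \<in> carrier U) \<and>
    (\<forall>v\<in>carrier V. \<forall>v'\<in>carrier V. \<forall>w\<in>carrier W. \<beta> (v \<oplus>\<^bsub>V\<^esub> v') w = \<beta> v w \<oplus>\<^bsub>U\<^esub> \<beta> v' w) \<and>
    (\<forall>v\<in>carrier V. \<forall>w\<in>carrier W. \<forall>w'\<in>carrier W. \<beta> v (w \<oplus>\<^bsub>W\<^esub> w') = \<beta> v w \<oplus>\<^bsub>U\<^esub> \<beta> v w') \<and>
    (\<forall>c. \<forall>v\<in>carrier V. \<forall>w\<in>carrier W. \<beta> (c \<odot>\<^bsub>V\<^esub> v) w = c \<odot>\<^bsub>U\<^esub> \<beta> v w) \<and>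
    (\<forall>c. \<forall>v\<in>carrier V. \<forall>w\<in>carrier W. \<beta> v (c \<odot>\<^bsub>W\<^esub> w) = c \<odot>\<^bsub>U\<^esub> \<beta> v w)"

abbreviation bilinear_form where "bilinear_form V W \<equiv> bilinear_map V W scalars"

text \<open>The function that \<open>tensor_lift\<close> applies to each representative of a coset,
  made a notion of its own so that its independence of the representative can be proved.\<close>

definition linear_ext :: "('k::field, 'u, 'e) module_scheme \<Rightarrow> ('v \<Rightarrow> 'w \<Rightarrow> 'u) \<Rightarrow>
    (('v \<times> 'w) \<Rightarrow>\<^sub>0 'k) \<Rightarrow> 'u" where
  "linear_ext U \<beta> f =
     (\<Oplus>\<^bsub>U\<^esub>q\<in>Poly_Mapping.keys f. Poly_Mapping.lookup f q \<odot>\<^bsub>U\<^esub> \<beta> (fst q) (snd q))"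

lemma free_space_carrier: "carrier (free_space V W) = {f. Poly_Mapping.keys f \<subseteq> carrier V \<times> carrier W}"
  by (simp add: free_space_def)

lemma free_space_simps [simp]:
  "\<zero>\<^bsub>free_space V W\<^esub> = 0" "f \<oplus>\<^bsub>free_space V W\<^esub> g = f + g"
  "c \<odot>\<^bsub>free_space V W\<^esub> f = Poly_Mapping.map ((*) c) f"
  by (simp_all add: free_space_def)

locale two_vectorspaces = V: vectorspace class_ring V + W: vectorspace class_ring W
  for V :: "('k::field, 'v, 'c) module_scheme" and W :: "('k, 'w, 'd) module_scheme"
begin

abbreviation "Fr \<equiv> carrier (free_space V W)"
abbreviation "tcoset f \<equiv> bilinear_relations V W +>\<^bsub>free_space V W\<^esub> f"

lemma free_space_vectorspace: "vectorspace class_ring (free_space V W)"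
proof -
  have "f + g \<in> Fr" if "f \<in> Fr" "g \<in> Fr" for f g
    using that keys_add[of f g] by (auto simp: free_space_carrier)
  moreover have "Poly_Mapping.map ((*) c) f \<in> Fr" if "f \<in> Fr" for c f
    using that keys_scale_subset[of c f] by (auto simp: free_space_carrier)
  ultimately have "module class_ring (free_space V W)"
    by (intro module_criteria)
      (auto simp: class_cring.is_cring algebra_simps lookup_scale lookup_add keys_minus free_space_carrier
        intro!: poly_mapping_eqI exI[of _ "- v" for v])
  then show ?thesis
    by (simp add: vectorspace_def class_field)
qed

sublocale F: vectorspace class_ring "free_space V W"
  by (rule free_space_vectorspace)

lemma single_closed [simp]: "v \<in> carrier V \<Longrightarrow> w \<in> carrier W \<Longrightarrow> Poly_Mapping.single (v, w) c \<in> Fr"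
  by (simp add: free_space_carrier)

lemma zero_closed [simp]: "0 \<in> Fr"
  using F.zero_closed by simp

lemma sum_closed [simp]: "(\<And>i. i \<in> A \<Longrightarrow> f i \<in> Fr) \<Longrightarrow> sum f A \<in> Fr"
  using keys_sum[of f A] by (fastforce simp: free_space_carrier)

lemma a_inv_free_space: "f \<in> Fr \<Longrightarrow> \<ominus>\<^bsub>free_space V W\<^esub> f = - f"
  by (rule F.minus_equality) (auto simp: keys_minus free_space_carrier)

lemma a_minus_free_space: "f \<in> Fr \<Longrightarrow> g \<in> Fr \<Longrightarrow> f \<ominus>\<^bsub>free_space V W\<^esub> g = f - g"
  by (simp add: a_minus_def a_inv_free_space)

lemma minus_closed [simp]: "f \<in> Fr \<Longrightarrow> g \<in> Fr \<Longrightarrow> f - g \<in> Fr"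
  using F.minus_closed a_minus_free_space by metis

lemma add_closed [simp]: "f \<in> Fr \<Longrightarrow> g \<in> Fr \<Longrightarrow> f + g \<in> Fr"
  using F.add.m_closed by simp

lemma scale_closed [simp]: "f \<in> Fr \<Longrightarrow> Poly_Mapping.map ((*) c) f \<in> Fr"
  using F.smult_closed by simp

context
  fixes U :: "('k, 'u, 'e) module_scheme" and \<beta> :: "'v \<Rightarrow> 'w \<Rightarrow> 'u"
  assumes U: "vectorspace class_ring U" and \<beta>: "bilinear_map V W U \<beta>"
begin

interpretation U: vectorspace class_ring U
  by (rule U)

lemma bilinear_closed: "v \<in> carrier V \<Longrightarrow> w \<in> carrier W \<Longrightarrow> \<beta> v w \<in> carrier U"
  using \<beta> by (simp add: bilinear_map_def)

lemma linear_ext_closed: "f \<in> Fr \<Longrightarrow> linear_ext U \<beta> f \<in> carrier U"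
  unfolding linear_ext_def by (rule U.finsum_closed) (auto simp: free_space_carrier intro!: U.smult_closed bilinear_closed)

text \<open>Cancellation can shrink the support of a sum. Summing over any finite superset instead
  puts \<open>f\<close>, \<open>g\<close> and \<open>f + g\<close> on one index set.\<close>

lemma linear_ext_superset:
  assumes "finite A" "Poly_Mapping.keys f \<subseteq> A" "A \<subseteq> carrier V \<times> carrier W"
  shows "linear_ext U \<beta> f = (\<Oplus>\<^bsub>U\<^esub>q\<in>A. Poly_Mapping.lookup f q \<odot>\<^bsub>U\<^esub> \<beta> (fst q) (snd q))"
  unfolding linear_ext_def using assms
  by (intro U.add.finprod_mono_neutral_cong_left)
    (auto simp: in_keys_iff intro!: U.smult_closed bilinear_closed U.lmult_0[simplified])

lemma linear_ext_single:
  assumes "v \<in> carrier V" "w \<in> carrier W"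
  shows "linear_ext U \<beta> (Poly_Mapping.single (v, w) c) = c \<odot>\<^bsub>U\<^esub> \<beta> v w"
  using assms bilinear_closed[OF assms]
  by (subst linear_ext_superset[of "{(v, w)}"]) auto

lemma linear_ext_hom: "linear_ext U \<beta> \<in> LinearCombinations.module_hom class_ring (free_space V W) U"
proof -
  have "linear_ext U \<beta> (f + g) = linear_ext U \<beta> f \<oplus>\<^bsub>U\<^esub> linear_ext U \<beta> g"
    if fg: "f \<in> Fr" "g \<in> Fr" for f g
  proof -
    let ?A = "Poly_Mapping.keys f \<union> Poly_Mapping.keys g"
    have A: "?A \<subseteq> carrier V \<times> carrier W"
      using fg by (auto simp: free_space_carrier)
    then have cl: "\<beta> (fst q) (snd q) \<in> carrier U" if "q \<in> ?A" for q
      using that by (intro bilinear_closed) auto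
    have "(\<Oplus>\<^bsub>U\<^esub>q\<in>?A. Poly_Mapping.lookup (f + g) q \<odot>\<^bsub>U\<^esub> \<beta> (fst q) (snd q)) =
      (\<Oplus>\<^bsub>U\<^esub>q\<in>?A. Poly_Mapping.lookup f q \<odot>\<^bsub>U\<^esub> \<beta> (fst q) (snd q) \<oplus>\<^bsub>U\<^esub> Poly_Mapping.lookup g q \<odot>\<^bsub>U\<^esub> \<beta> (fst q) (snd q))"
      using cl by (intro U.finsum_cong') (auto simp: lookup_add U.smult_l_distr[simplified])
    also have "\<dots> = (\<Oplus>\<^bsub>U\<^esub>q\<in>?A. Poly_Mapping.lookup f q \<odot>\<^bsub>U\<^esub> \<beta> (fst q) (snd q)) \<oplus>\<^bsub>U\<^esub>
      (\<Oplus>\<^bsub>U\<^esub>q\<in>?A. Poly_Mapping.lookup g q \<odot>\<^bsub>U\<^esub> \<beta> (fst q) (snd q))"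
      using cl by (intro U.finsum_addf) auto
    finally show ?thesis
      using keys_add[of f g] by (simp add: linear_ext_superset[of ?A, OF _ _ A])
  qed
  moreover have "linear_ext U \<beta> (Poly_Mapping.map ((*) c) f) = c \<odot>\<^bsub>U\<^esub> linear_ext U \<beta> f"
    if f: "f \<in> Fr" for c f
  proof -
    have A: "Poly_Mapping.keys f \<subseteq> carrier V \<times> carrier W"
      using f by (auto simp: free_space_carrier)
    then have cl: "\<beta> (fst q) (snd q) \<in> carrier U" if "q \<in> Poly_Mapping.keys f" for q
      using that by (intro bilinear_closed) auto
    have "(\<Oplus>\<^bsub>U\<^esub>q\<in>Poly_Mapping.keys f. Poly_Mapping.lookup (Poly_Mapping.map ((*) c) f) q \<odot>\<^bsub>U\<^esub> \<beta> (fst q) (snd q)) =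
      (\<Oplus>\<^bsub>U\<^esub>q\<in>Poly_Mapping.keys f. c \<odot>\<^bsub>U\<^esub> (Poly_Mapping.lookup f q \<odot>\<^bsub>U\<^esub> \<beta> (fst q) (snd q)))"
      using cl by (intro U.finsum_cong') (auto simp: lookup_scale U.smult_assoc1[simplified])
    also have "\<dots> = c \<odot>\<^bsub>U\<^esub> (\<Oplus>\<^bsub>U\<^esub>q\<in>Poly_Mapping.keys f. Poly_Mapping.lookup f q \<odot>\<^bsub>U\<^esub> \<beta> (fst q) (snd q))"
      using cl by (intro U.finsum_smult[symmetric]) auto
    finally show ?thesis
      by (simp add: linear_ext_superset[of "Poly_Mapping.keys f", OF _ _ A] keys_scale_subset)
  qed
  ultimately show ?thesis
    by (auto simp: LinearCombinations.module_hom_def linear_ext_closed)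
qed

interpretation E: mod_hom class_ring "free_space V W" U "linear_ext U \<beta>"
  by unfold_locales (rule linear_ext_hom)

lemma linear_ext_add: "f \<in> Fr \<Longrightarrow> g \<in> Fr \<Longrightarrow> linear_ext U \<beta> (f + g) = linear_ext U \<beta> f \<oplus>\<^bsub>U\<^esub> linear_ext U \<beta> g"
  using E.f_add by simp

lemma linear_ext_zero: "linear_ext U \<beta> 0 = \<zero>\<^bsub>U\<^esub>"
  using E.f0_is_0 by simp

lemma linear_ext_scale: "f \<in> Fr \<Longrightarrow> linear_ext U \<beta> (Poly_Mapping.map ((*) c) f) = c \<odot>\<^bsub>U\<^esub> linear_ext U \<beta> f"
  using E.f_smult by simp

lemma linear_ext_minus:
  "f \<in> Fr \<Longrightarrow> g \<in> Fr \<Longrightarrow> linear_ext U \<beta> (f - g) = linear_ext U \<beta> f \<ominus>\<^bsub>U\<^esub> linear_ext U \<beta> g"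
  using E.f_minus[of f g] by (simp add: a_minus_free_space)

lemma linear_ext_sum:
  assumes "\<And>i. i \<in> A \<Longrightarrow> f i \<in> Fr"
  shows "linear_ext U \<beta> (sum f A) = (\<Oplus>\<^bsub>U\<^esub>i\<in>A. linear_ext U \<beta> (f i))"
  using assms
proof (induct A rule: infinite_finite_induct)
  case (insert x A)
  then show ?case
    by (subst sum.insert, simp, simp, subst linear_ext_add)
      (auto simp: U.finsum_insert Pi_def linear_ext_closed)
qed (simp_all add: linear_ext_zero)

text \<open>The kernel of the linear extension is a submodule, so it contains the span of the
  relations as soon as it contains the four families of generators; these match the four identities
  of a bilinear map.\<close>

lemma linear_ext_relations:
  assumes "f \<in> bilinear_relations V W"
  shows "linear_ext U \<beta> f = \<zero>\<^bsub>U\<^esub>"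
proof -
  have [simp]: "b \<oplus>\<^bsub>U\<^esub> c \<oplus>\<^bsub>U\<^esub> \<ominus>\<^bsub>U\<^esub> b \<oplus>\<^bsub>U\<^esub> \<ominus>\<^bsub>U\<^esub> c = \<zero>\<^bsub>U\<^esub>" if "b \<in> carrier U" "c \<in> carrier U" for b c
    using that by (simp add: U.a_comm[of b c] U.a_assoc U.r_neg)
  have [simp]: "1 \<odot>\<^bsub>U\<^esub> u = u" if "u \<in> carrier U" for u
    using U.smult_one[OF that] by simp
  have *: "bilinear_relations V W \<subseteq> E.ker"
    unfolding bilinear_relations_def
    by (rule F.span_is_subset[OF _ E.ker_is_submodule])
      (use \<beta> in \<open>auto simp: bilinear_map_def E.ker_def linear_ext_minus linear_ext_single U.r_neg a_minus_def\<close>)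
  then show ?thesis
    using assms by (auto simp: E.ker_def)
qed

end

end

text \<open>Evaluates \<open>the_elem\<close> on cosets: a function that is constant on a nonempty
  set has a singleton image.\<close>

lemma image_eq_singletonI: "(\<And>g. g \<in> A \<Longrightarrow> h g = c) \<Longrightarrow> f \<in> A \<Longrightarrow> h ` A = {c}"
  by (auto simp: image_iff)

section \<open>The subspace of relations and the quotient by it\<close>

context two_vectorspaces
begin

abbreviation "Rel \<equiv> bilinear_relations V W"

lemma relations_submodule: "submodule class_ring Rel (free_space V W)"
  unfolding bilinear_relations_def by (rule F.span_is_submodule) auto

lemma relations_subset: "Rel \<subseteq> Fr"
  using relations_submodule by (simp add: submodule_def)

lemma relations_zero: "0 \<in> Rel"
  using relations_submodule by (simp add: submodule_def)

lemma relations_add: "r \<in> Rel \<Longrightarrow> s \<in> Rel \<Longrightarrow> r + s \<in> Rel"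
  using relations_submodule by (simp add: submodule_def)

lemma relations_scale: "r \<in> Rel \<Longrightarrow> Poly_Mapping.map ((*) c) r \<in> Rel"
  using relations_submodule by (simp add: submodule_def)

lemma relations_uminus: "r \<in> Rel \<Longrightarrow> - r \<in> Rel"
proof -
  assume r: "r \<in> Rel"
  have "- r = Poly_Mapping.map ((*) (-1)) r"
    by (rule poly_mapping_eqI) (simp add: lookup_scale)
  then show ?thesis
    using relations_scale[OF r] by simp
qed

lemma relations_minus: "r \<in> Rel \<Longrightarrow> s \<in> Rel \<Longrightarrow> r - s \<in> Rel"
  using relations_add[of r "- s"] relations_uminus[of s] by simp

lemma relations_generators:
  assumes "v \<in> carrier V" "w \<in> carrier W"
  shows "v' \<in> carrier V \<Longrightarrow> Poly_Mapping.single (v \<oplus>\<^bsub>V\<^esub> v', w) 1 - Poly_Mapping.single (v, w) 1 - Poly_Mapping.single (v', w) 1 \<in> Rel"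
    and "w' \<in> carrier W \<Longrightarrow> Poly_Mapping.single (v, w \<oplus>\<^bsub>W\<^esub> w') 1 - Poly_Mapping.single (v, w) 1 - Poly_Mapping.single (v, w') 1 \<in> Rel"
    and "Poly_Mapping.single (c \<odot>\<^bsub>V\<^esub> v, w) 1 - Poly_Mapping.single (v, w) c \<in> Rel"
    and "Poly_Mapping.single (v, c \<odot>\<^bsub>W\<^esub> w) 1 - Poly_Mapping.single (v, w) c \<in> Rel"
  unfolding bilinear_relations_def
  by (rule subsetD[OF F.in_own_span], (auto)[1], insert assms, (rule UnI1)+, rule CollectI, (rule exI)+, rule conjI[OF refl], simp,
      rule subsetD[OF F.in_own_span], (auto)[1], insert assms, (rule UnI1)?, (rule UnI1)?, rule UnI2, rule CollectI, (rule exI)+, rule conjI[OF refl], simp,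
      rule subsetD[OF F.in_own_span], (auto)[1], insert assms, rule UnI1, rule UnI2, rule CollectI, (rule exI)+, rule conjI[OF refl], simp,
      rule subsetD[OF F.in_own_span], (auto)[1], insert assms, rule UnI2, rule CollectI, (rule exI)+, rule conjI[OF refl], simp)

text \<open>A linear form that is 0 on a basis of the relations and 1 on \<open>f\<close> exists
  because \<open>f\<close> lies outside their span. Restricted to the symbols \<open>(v, w)\<close>
  it is bilinear, precisely because it kills the generators of \<open>Rel\<close>.\<close>

lemma bilinear_forms_separate:
  assumes f: "f \<in> Fr" and nf: "f \<notin> Rel"
  obtains B where "bilinear_form V W B" "linear_ext scalars B f \<noteq> 0"
proof -
  \<comment> \<open>The linear form is built on the whole type of finitely supported functions,
    where a linear map can be prescribed on an independent set; \<open>Fr\<close> and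
    \<open>Rel\<close> are subsets of it.\<close>
  interpret P: vector_space_pair "\<lambda>c (f :: ('v \<times> 'w) \<Rightarrow>\<^sub>0 'k). Poly_Mapping.map ((*) c) f" "(*) :: 'k \<Rightarrow> 'k \<Rightarrow> 'k"
    by unfold_locales (auto intro!: poly_mapping_eqI simp: lookup_scale lookup_add algebra_simps)
  have "P.vs1.subspace Rel"
    by (simp add: P.vs1.subspace_def relations_zero relations_add relations_scale)
  obtain S where S: "S \<subseteq> Rel" "P.vs1.independent S" "Rel \<subseteq> P.vs1.span S"
    "card S = P.vs1.dim Rel"
    by (rule P.vs1.basis_exists[of Rel])
  have "P.vs1.span S \<subseteq> Rel"
    by (rule P.vs1.span_minimal) (fact S, fact)
  then have "P.vs1.independent (insert f S)"
    using nf S by (intro P.vs1.independent_insertI) auto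
  from P.linear_independent_extend[OF this, of "\<lambda>x. if x = f then 1 else 0"]
  obtain g where g: "Vector_Spaces.linear (\<lambda>c f. Poly_Mapping.map ((*) c) f) (*) g"
    and gS: "\<And>x. x \<in> insert f S \<Longrightarrow> g x = (if x = f then 1 else 0)"
    by blast
  have gR: "g r = 0" if "r \<in> Rel" for r
  proof (rule P.linear_eq_0_on_span[OF g, of S])
    show "g x = 0" if "x \<in> S" for x
      using that S(1) nf gS[of x] by auto
  qed (use that S in auto)
  note g_simps = P.linear_add[OF g] P.linear_diff[OF g] P.linear_scale[OF g] P.linear_sum[OF g]
  define B where "B v w = g (Poly_Mapping.single (v, w) 1)" for v w
  have g_single: "g (Poly_Mapping.single q c) = c * B (fst q) (snd q)" for q c
    using g_simps(3)[of c "Poly_Mapping.single q 1"] by (simp add: B_def)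
  have "bilinear_form V W B"
    unfolding bilinear_map_def
    using gR[OF relations_generators(1)] gR[OF relations_generators(2)]
      gR[OF relations_generators(3)] gR[OF relations_generators(4)]
    by (simp add: g_simps g_single algebra_simps)
  moreover have "linear_ext scalars B f = g f"
  proof -
    have "g f = g (\<Sum>q\<in>Poly_Mapping.keys f. Poly_Mapping.single q (Poly_Mapping.lookup f q))"
      by (simp add: poly_mapping_sum_single)
    also have "\<dots> = (\<Sum>q\<in>Poly_Mapping.keys f. Poly_Mapping.lookup f q * B (fst q) (snd q))"
      by (simp only: g_simps(4) g_single)
    finally show ?thesis
      by (simp add: linear_ext_def)
  qed
  ultimately show ?thesis
    using that gS[of f] by auto
qed

lemma tcoset_image: "tcoset f = (\<lambda>r. r + f) ` Rel"
  by (auto simp: a_r_coset_def')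

lemma tcoset_eq_iff_diff: "tcoset f = tcoset g \<longleftrightarrow> f - g \<in> Rel"
proof
  assume "tcoset f = tcoset g"
  then have "f \<in> tcoset g"
    using relations_zero by (force simp: tcoset_image)
  then show "f - g \<in> Rel"
    by (auto simp: tcoset_image)
next
  assume fg: "f - g \<in> Rel"
  then have "r + (f - g) \<in> Rel" "r - (f - g) \<in> Rel" if "r \<in> Rel" for r
    using that by (simp_all add: relations_add relations_minus)
  then have "r + f \<in> tcoset g" "r + g \<in> tcoset f" if "r \<in> Rel" for r
    using that unfolding tcoset_image
    by (auto intro: image_eqI[of _ _ "r + (f - g)"] image_eqI[of _ _ "r - (f - g)"])
  then show "tcoset f = tcoset g"
    unfolding tcoset_image by auto
qed

text \<open>Bilinear forms separate tensors; so identities between tensors become identities between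
  elements of the ground field.\<close>

lemma tcoset_eq_iff:
  assumes f: "f \<in> Fr" and g: "g \<in> Fr"
  shows "tcoset f = tcoset g \<longleftrightarrow>
    (\<forall>B. bilinear_form V W B \<longrightarrow> linear_ext scalars B f = linear_ext scalars B g)"
proof -
  have diff: "linear_ext scalars B (f - g) = linear_ext scalars B f - linear_ext scalars B g"
    if "bilinear_form V W B" for B
    using linear_ext_add[OF scalars_vectorspace that minus_closed[OF f g] g] by simp
  have "(\<forall>B. bilinear_form V W B \<longrightarrow> linear_ext scalars B f = linear_ext scalars B g) \<longleftrightarrow>
    (\<forall>B. bilinear_form V W B \<longrightarrow> linear_ext scalars B (f - g) = 0)"
    by (simp add: diff)
  also have "\<dots> \<longleftrightarrow> f - g \<in> Rel"
    using bilinear_forms_separate[OF minus_closed[OF f g]] linear_ext_relations[OF scalars_vectorspace]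
    by (metis scalars_simps(2))
  finally show ?thesis
    by (simp add: tcoset_eq_iff_diff)
qed

lemma tensor_carrier: "carrier (tensor V W) = tcoset ` Fr"
  by (auto simp: tensor_def module_quotient_def A_RCOSETS_def')

lemma tcoset_closed [simp]: "f \<in> Fr \<Longrightarrow> tcoset f \<in> carrier (tensor V W)"
  by (simp add: tensor_carrier)

lemma tensor_zero: "\<zero>\<^bsub>tensor V W\<^esub> = tcoset 0"
  by (simp add: tensor_def module_quotient_def tcoset_image)

lemma tensor_add: "tcoset f \<oplus>\<^bsub>tensor V W\<^esub> tcoset g = tcoset (f + g)"
proof -
  have "tcoset f <+>\<^bsub>free_space V W\<^esub> tcoset g = tcoset (f + g)"
  proof (intro equalityI subsetI)
    fix x assume "x \<in> tcoset f <+>\<^bsub>free_space V W\<^esub> tcoset g"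
    then obtain r s where "r \<in> Rel" "s \<in> Rel" "x = (r + f) + (s + g)"
      by (auto simp: set_add_def' tcoset_image)
    then show "x \<in> tcoset (f + g)"
      by (auto simp: tcoset_image algebra_simps intro!: image_eqI[of _ _ "r + s"] relations_add)
  next
    fix x assume "x \<in> tcoset (f + g)"
    then obtain r where "r \<in> Rel" "x = (r + f) + (0 + g)"
      by (auto simp: tcoset_image algebra_simps)
    then show "x \<in> tcoset f <+>\<^bsub>free_space V W\<^esub> tcoset g"
      using relations_zero unfolding set_add_def' tcoset_image by force
  qed
  then show ?thesis
    by (simp add: tensor_def module_quotient_def)
qed

lemma scale_diff: "Poly_Mapping.map ((*) c) (f - g) = Poly_Mapping.map ((*) c) f - Poly_Mapping.map ((*) c) g"
  for f :: "('v \<times> 'w) \<Rightarrow>\<^sub>0 'k"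
  by (rule poly_mapping_eqI) (simp add: lookup_scale lookup_minus algebra_simps)

lemma tensor_smult: "c \<odot>\<^bsub>tensor V W\<^esub> tcoset f = tcoset (Poly_Mapping.map ((*) c) f)"
proof -
  \<comment> \<open>Scaling sends a coset into a single coset because \<open>Rel\<close> is closed
    under scaling; this makes \<open>the_elem\<close> in the quotient meaningful.\<close>
  have "tcoset (Poly_Mapping.map ((*) c) g) = tcoset (Poly_Mapping.map ((*) c) f)" if "g \<in> tcoset f" for g
    unfolding tcoset_eq_iff_diff scale_diff[symmetric]
    using that by (intro relations_scale) (auto simp: tcoset_image)
  moreover have "f \<in> tcoset f"
    using relations_zero by (force simp: tcoset_image)
  ultimately have "(\<lambda>g. tcoset (Poly_Mapping.map ((*) c) g)) ` tcoset f = {tcoset (Poly_Mapping.map ((*) c) f)}"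
    by (rule image_eq_singletonI)
  then show ?thesis
    by (simp add: tensor_def module_quotient_def)
qed

lemma tensor_vectorspace: "vectorspace class_ring (tensor V W)"
proof -
  have "module class_ring (tensor V W)"
  proof (rule module_criteria, goal_cases)
    case 4
    have "tcoset f \<oplus>\<^bsub>tensor V W\<^esub> tcoset (- f) = tcoset 0" for f
      by (simp add: tensor_add)
    moreover have "tcoset (- f) \<in> carrier (tensor V W)" if "f \<in> Fr" for f
      using minus_closed[OF zero_closed that] by simp
    ultimately show ?case
      unfolding tensor_zero tensor_carrier by blast
  qed (auto simp: class_cring.is_cring tensor_carrier tensor_zero tensor_add tensor_smult
        ac_simps F.smult_l_distr[simplified] F.smult_r_distr[simplified] F.smult_assoc1[simplified]
        F.smult_one[simplified])
  then show ?thesis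
    by (simp add: vectorspace_def class_field)
qed

sublocale T: vectorspace class_ring "tensor V W"
  by (rule tensor_vectorspace)

lemma tensor_finsum:
  assumes "\<And>i. i \<in> A \<Longrightarrow> f i \<in> Fr"
  shows "(\<Oplus>\<^bsub>tensor V W\<^esub>i\<in>A. tcoset (f i)) = tcoset (sum f A)"
  using assms
  by (induct A rule: infinite_finite_induct) (simp_all add: tensor_zero tensor_add Pi_def)

lemma pure_tensor_coset: "pure_tensor V W v w = tcoset (Poly_Mapping.single (v, w) 1)"
  by (simp add: pure_tensor_def)

text \<open>Two representatives differ by a relation, and the linear extension vanishes there. From
  here on lifts are computed on any convenient representative.\<close>

lemma tensor_lift_coset:
  assumes U: "vectorspace class_ring U" and \<beta>: "bilinear_map V W U \<beta>" and f: "f \<in> Fr"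
  shows "tensor_lift U \<beta> (tcoset f) = linear_ext U \<beta> f"
proof -
  interpret U: vectorspace class_ring U
    by (rule U)
  have "linear_ext U \<beta> g = linear_ext U \<beta> f" if g: "g \<in> tcoset f" for g
  proof -
    obtain r where r: "r \<in> Rel" "g = r + f"
      using g by (auto simp: tcoset_image)
    then show ?thesis
      using f relations_subset
      by (simp add: linear_ext_add[OF U \<beta>] subset_iff linear_ext_relations[OF U \<beta>] linear_ext_closed[OF U \<beta>])
  qed
  moreover have "f \<in> tcoset f"
    using relations_zero by (force simp: tcoset_image)
  ultimately have "linear_ext U \<beta> ` tcoset f = {linear_ext U \<beta> f}"
    by (rule image_eq_singletonI)
  then show ?thesis
    by (simp add: tensor_lift_def linear_ext_def)
qed

end

section \<open>Truncated polynomial algebras\<close>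

abbreviation unit_exp :: "nat \<Rightarrow> nat \<Rightarrow>\<^sub>0 nat" where
  "unit_exp i \<equiv> Poly_Mapping.single i 1"

text \<open>Subtraction of exponents is truncated at 0, so it undoes the addition of a unit only
  where the entry is nonzero. Elsewhere a vanishing factor \<open>of_nat (lookup e i)\<close> always
  comes to the rescue.\<close>

lemma exp_minus_plus_unit: "Poly_Mapping.lookup e i \<noteq> 0 \<Longrightarrow> e - unit_exp i + unit_exp i = e"
  by (rule poly_mapping_eqI) (auto simp: lookup_add lookup_minus lookup_single when_def)

lemma exp_add_eq_zero_iff: "a + b = 0 \<longleftrightarrow> a = 0 \<and> b = (0 :: nat \<Rightarrow>\<^sub>0 nat)"
  by (auto simp: poly_mapping_eq_iff fun_eq_iff lookup_add)

lemma keys_exp_add: "Poly_Mapping.keys (a + b) = Poly_Mapping.keys a \<union> Poly_Mapping.keys (b :: nat \<Rightarrow>\<^sub>0 nat)"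
  by (auto simp: in_keys_iff lookup_add)

lemma keys_exp_minus: "Poly_Mapping.keys (a - b) \<subseteq> Poly_Mapping.keys (a :: nat \<Rightarrow>\<^sub>0 nat)"
  by (auto simp: in_keys_iff lookup_minus)

text \<open>A description by coefficients, uniform in \<open>e\<close>. Linearity and the
  commutation of partial derivatives can be read off from it, which is not so for the sum over the
  support.\<close>

lemma lookup_poly_partial:
  "Poly_Mapping.lookup (poly_partial i P) e = of_nat (Poly_Mapping.lookup e i + 1) * Poly_Mapping.lookup P (e + unit_exp i)"
proof -
  have "Poly_Mapping.lookup (poly_partial i P) e =
      (\<Sum>a\<in>Poly_Mapping.keys P. (of_nat (Poly_Mapping.lookup a i) * Poly_Mapping.lookup P a) when a - unit_exp i = e)"
    by (simp add: poly_partial_def lookup_sum lookup_single)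
  also have "\<dots> = (\<Sum>a\<in>Poly_Mapping.keys P. (of_nat (Poly_Mapping.lookup e i + 1) * Poly_Mapping.lookup P a) when a = e + unit_exp i)"
  proof (rule sum.cong[OF refl])
    fix a
    show "((of_nat (Poly_Mapping.lookup a i) * Poly_Mapping.lookup P a) when a - unit_exp i = e) =
      ((of_nat (Poly_Mapping.lookup e i + 1) * Poly_Mapping.lookup P a) when a = e + unit_exp i)"
    \<comment> \<open>If the entry is 0, truncation may give \<open>a - unit_exp i = e\<close>
      although \<open>a\<close> is not \<open>e + unit_exp i\<close>; the coefficient is then 0, so
      the two sides still agree.\<close>
    proof (cases "Poly_Mapping.lookup a i = 0")
      case True
      then have "a \<noteq> e + unit_exp i"
        by (auto simp: lookup_add)
      then show ?thesis
        using True by simp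
    next
      case False
      then have "a - unit_exp i = e \<longleftrightarrow> a = e + unit_exp i"
        using exp_minus_plus_unit[OF False] by auto
      then show ?thesis
        by (auto simp: when_def lookup_add)
    qed
  qed
  also have "\<dots> = of_nat (Poly_Mapping.lookup e i + 1) * Poly_Mapping.lookup P (e + unit_exp i)"
    by (simp add: when_def in_keys_iff)
  finally show ?thesis .
qed

lemma poly_partial_add: "poly_partial i (P + Q) = poly_partial i P + poly_partial i Q"
  by (rule poly_mapping_eqI) (simp add: lookup_poly_partial lookup_add algebra_simps)

lemma poly_partial_zero: "poly_partial i 0 = 0"
  by (rule poly_mapping_eqI) (simp add: lookup_poly_partial)

lemma poly_partial_sum: "poly_partial i (sum f A) = (\<Sum>a\<in>A. poly_partial i (f a))"
  by (induct A rule: infinite_finite_induct) (simp_all add: poly_partial_zero poly_partial_add)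

lemma poly_partial_single:
  "poly_partial i (Poly_Mapping.single e c) = Poly_Mapping.single (e - unit_exp i) (of_nat (Poly_Mapping.lookup e i) * c)"
  by (simp add: poly_partial_def)

lemma poly_partial_commute: "poly_partial i (poly_partial j P) = poly_partial j (poly_partial i P)"
  by (rule poly_mapping_eqI) (cases "i = j"; simp add: lookup_poly_partial lookup_add lookup_single ac_simps)

text \<open>Both sides are biadditive, so monomials suffice.\<close>

lemma poly_partial_mult: "poly_partial i (P * Q) = poly_partial i P * Q + P * poly_partial i Q"
proof -
  have mono: "poly_partial i (Poly_Mapping.single a c * Poly_Mapping.single b d) =
      poly_partial i (Poly_Mapping.single a c) * Poly_Mapping.single b d + Poly_Mapping.single a c * poly_partial i (Poly_Mapping.single b d)"
    for a b and c d :: 'a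
  proof -
    have "Poly_Mapping.single (a + b - unit_exp i) (of_nat (Poly_Mapping.lookup a i) * (c * d)) =
        Poly_Mapping.single (a - unit_exp i + b) (of_nat (Poly_Mapping.lookup a i) * (c * d))"
    \<comment> \<open>The exponents agree only if the entry is nonzero; otherwise both coefficients
      are 0.\<close>
    proof (cases "Poly_Mapping.lookup a i = 0")
      case False
      have "a + b - unit_exp i = a - unit_exp i + b"
        using False by (auto intro!: poly_mapping_eqI simp: lookup_add lookup_minus lookup_single when_def)
      then show ?thesis
        by simp
    qed simp
    moreover have "Poly_Mapping.single (a + b - unit_exp i) (of_nat (Poly_Mapping.lookup b i) * (c * d)) =
        Poly_Mapping.single (a + (b - unit_exp i)) (of_nat (Poly_Mapping.lookup b i) * (c * d))"
    proof (cases "Poly_Mapping.lookup b i = 0")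
      case False
      have "a + b - unit_exp i = a + (b - unit_exp i)"
        using False by (auto intro!: poly_mapping_eqI simp: lookup_add lookup_minus lookup_single when_def)
      then show ?thesis
        by simp
    qed simp
    ultimately show ?thesis
      by (simp add: poly_partial_single mult_single lookup_add algebra_simps single_add)
  qed
  have "poly_partial i ((\<Sum>a\<in>A. Poly_Mapping.single a (f a)) * (\<Sum>b\<in>B. Poly_Mapping.single b (g b))) =
      poly_partial i (\<Sum>a\<in>A. Poly_Mapping.single a (f a)) * (\<Sum>b\<in>B. Poly_Mapping.single b (g b)) +
      (\<Sum>a\<in>A. Poly_Mapping.single a (f a)) * poly_partial i (\<Sum>b\<in>B. Poly_Mapping.single b (g b))"
    for A B and f g :: "(nat \<Rightarrow>\<^sub>0 nat) \<Rightarrow> 'a"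
    by (simp add: sum_product poly_partial_sum mono sum.distrib)
  from this[where A = "Poly_Mapping.keys P" and f = "Poly_Mapping.lookup P" and B = "Poly_Mapping.keys Q" and g = "Poly_Mapping.lookup Q"] show ?thesis
    by (simp only: poly_mapping_sum_single)
qed

lemma poly_const_mult_single: "poly_const c * Poly_Mapping.single e d = Poly_Mapping.single e (c * d)"
  by (simp add: poly_const_def mult_single)

lemma lookup_poly_const_mult: "Poly_Mapping.lookup (poly_const c * P) e = c * Poly_Mapping.lookup P e"
  unfolding poly_const_def mult_map_scale_conv_mult[symmetric] by (rule lookup_scale)

lemma poly_partial_const_mult: "poly_partial i (poly_const c * P) = poly_const c * poly_partial i P"
  by (rule poly_mapping_eqI) (simp add: lookup_poly_partial lookup_poly_const_mult mult.left_commute)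

text \<open>Exponents are nonnegative, so only the two constant terms contribute to the constant
  term of a product. This is why evaluation at the origin is multiplicative.\<close>

lemma lookup_mult_zero: "Poly_Mapping.lookup (P * Q) 0 = Poly_Mapping.lookup P 0 * Poly_Mapping.lookup Q (0 :: nat \<Rightarrow>\<^sub>0 nat)"
  for P Q :: "'a::field mpoly"
proof -
  have "Poly_Mapping.lookup ((\<Sum>a\<in>A. Poly_Mapping.single a (f a)) * (\<Sum>b\<in>B. Poly_Mapping.single b (g b))) 0 =
      Poly_Mapping.lookup (\<Sum>a\<in>A. Poly_Mapping.single a (f a)) 0 * Poly_Mapping.lookup (\<Sum>b\<in>B. Poly_Mapping.single b (g b)) 0"
    for A B and f g :: "(nat \<Rightarrow>\<^sub>0 nat) \<Rightarrow> 'a"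
    by (simp add: sum_product lookup_sum mult_single lookup_single exp_add_eq_zero_iff when_def)
      (auto intro!: sum.cong)
  from this[where A = "Poly_Mapping.keys P" and f = "Poly_Mapping.lookup P" and B = "Poly_Mapping.keys Q" and g = "Poly_Mapping.lookup Q"] show ?thesis
    by (simp only: poly_mapping_sum_single)
qed

section \<open>The polynomial ring and its truncation\<close>

lemma poly_ring_simps [simp]:
  "x \<oplus>\<^bsub>poly_ring n\<^esub> y = x + y" "x \<otimes>\<^bsub>poly_ring n\<^esub> y = x * y"
  "\<zero>\<^bsub>poly_ring n\<^esub> = 0" "\<one>\<^bsub>poly_ring n\<^esub> = 1"
  by (simp_all add: poly_ring_def)

lemma poly_ring_carrier:
  "carrier (poly_ring n) = {P. \<forall>e\<in>Poly_Mapping.keys P. Poly_Mapping.keys e \<subseteq> {..<n}}"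
  by (simp add: poly_ring_def)

lemma single_in_poly_ring [simp]: "Poly_Mapping.keys e \<subseteq> {..<n} \<Longrightarrow> Poly_Mapping.single e c \<in> carrier (poly_ring n)"
  by (simp add: poly_ring_carrier)

lemma const_in_poly_ring [simp]: "poly_const c \<in> carrier (poly_ring n)"
  by (simp add: poly_const_def)

lemma var_in_poly_ring [simp]: "i < n \<Longrightarrow> poly_var i \<in> carrier (poly_ring n)"
  by (simp add: poly_var_def)

lemma add_in_poly_ring [simp]:
  "P \<in> carrier (poly_ring n) \<Longrightarrow> Q \<in> carrier (poly_ring n) \<Longrightarrow> P + Q \<in> carrier (poly_ring n)"
  using keys_add[of P Q] by (auto simp: poly_ring_carrier)

lemma mult_in_poly_ring [simp]:
  "P \<in> carrier (poly_ring n) \<Longrightarrow> Q \<in> carrier (poly_ring n) \<Longrightarrow> P * Q \<in> carrier (poly_ring n)"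
  using keys_mult[of P Q] unfolding poly_ring_carrier by (fastforce simp: keys_exp_add)

lemma uminus_in_poly_ring [simp]:
  "P \<in> carrier (poly_ring n) \<Longrightarrow> - P \<in> carrier (poly_ring n)"
  by (auto simp: poly_ring_carrier keys_minus)

lemma zero_in_poly_ring [simp]: "0 \<in> carrier (poly_ring n)"
  by (simp add: poly_ring_carrier)

lemma one_in_poly_ring [simp]: "1 \<in> carrier (poly_ring n)"
  by (simp add: poly_ring_carrier)

lemma sum_in_poly_ring [simp]:
  "(\<And>a. a \<in> A \<Longrightarrow> f a \<in> carrier (poly_ring n)) \<Longrightarrow> sum f A \<in> carrier (poly_ring n)"
  by (induct A rule: infinite_finite_induct) auto

lemma partial_in_poly_ring [simp]:
  assumes "P \<in> carrier (poly_ring n)"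
  shows "poly_partial i P \<in> carrier (poly_ring n)"
proof -
  have "Poly_Mapping.keys (e - unit_exp i) \<subseteq> {..<n}" if "e \<in> Poly_Mapping.keys P" for e
    using that assms keys_exp_minus[of e "unit_exp i"] by (auto simp: poly_ring_carrier)
  then show ?thesis
    unfolding poly_partial_def by (intro sum_in_poly_ring single_in_poly_ring) auto
qed

lemma poly_ring_cring: "cring (poly_ring n)"
  by (rule cringI[OF abelian_groupI comm_monoidI])
    (auto simp: algebra_simps intro: bexI[of _ "- x" for x])

lemma trunc_ideal_ideal: "ideal (trunc_ideal n) (poly_ring n)"
proof -
  interpret cring "poly_ring n"
    by (rule poly_ring_cring)
  have "poly_var i ^ k \<in> carrier (poly_ring n)" if "i < n" for i k
    using that by (induct k) auto
  then show ?thesis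
    unfolding trunc_ideal_def using zeroideal by (auto intro: genideal_ideal)
qed

lemma poly_var_power: "poly_var i ^ k = Poly_Mapping.single (Poly_Mapping.single i k) 1"
proof (induct k)
  case (Suc k)
  then show ?case
    using single_add[of i 1 k] by (simp add: poly_var_def mult_single)
qed simp

definition trunc_class :: "nat \<Rightarrow> 'k::field mpoly \<Rightarrow> 'k mpoly set" where
  "trunc_class n P = trunc_ideal n +>\<^bsub>poly_ring n\<^esub> P"

context
  fixes n :: nat
begin

interpretation P: cring "poly_ring n"
  by (rule poly_ring_cring)

interpretation I: ideal "trunc_ideal n" "poly_ring n"
  by (rule trunc_ideal_ideal)

lemma a_minus_poly_ring:
  assumes "P \<in> carrier (poly_ring n)" "Q \<in> carrier (poly_ring n)"
  shows "P \<ominus>\<^bsub>poly_ring n\<^esub> Q = P - Q"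
proof -
  have "\<ominus>\<^bsub>poly_ring n\<^esub> Q = - Q"
    using assms by (intro P.minus_equality) auto
  then show ?thesis
    by (simp add: a_minus_def)
qed

lemma trunc_class_eq_iff:
  assumes "P \<in> carrier (poly_ring n)" "Q \<in> carrier (poly_ring n)"
  shows "trunc_class n P = trunc_class n Q \<longleftrightarrow> P - Q \<in> trunc_ideal n"
  unfolding trunc_class_def
  using P.quotient_eq_iff_same_a_r_cos[OF trunc_ideal_ideal assms] a_minus_poly_ring[OF assms] by simp

lemma trunc_class_self:
  "P \<in> carrier (poly_ring n) \<Longrightarrow> P \<in> trunc_class n P"
  unfolding trunc_class_def by (rule I.a_rcos_self)

lemma trunc_classD:
  assumes "P \<in> carrier (poly_ring n)" "Q \<in> trunc_class n P"
  shows "Q \<in> carrier (poly_ring n)" "Q - P \<in> trunc_ideal n"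
proof -
  obtain r where r: "r \<in> trunc_ideal n" "Q = r + P"
    using assms(2) by (auto simp: trunc_class_def a_r_coset_def')
  then show "Q \<in> carrier (poly_ring n)" "Q - P \<in> trunc_ideal n"
    using assms(1) I.a_subset by auto
qed

lemma trunc_algebra_carrier:
  "carrier (trunc_algebra n) = trunc_class n ` carrier (poly_ring n)"
  by (auto simp: trunc_algebra_def Let_def FactRing_def A_RCOSETS_def' trunc_class_def)

lemma trunc_class_closed [simp]:
  "P \<in> carrier (poly_ring n) \<Longrightarrow> trunc_class n P \<in> carrier (trunc_algebra n)"
  by (simp add: trunc_algebra_carrier)

lemma trunc_algebra_zero: "\<zero>\<^bsub>trunc_algebra n\<^esub> = trunc_class n 0"
  by (simp add: trunc_algebra_def Let_def FactRing_def trunc_class_def I.a_rcos_const[OF I.zero_closed, simplified])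

lemma trunc_algebra_one: "\<one>\<^bsub>trunc_algebra n\<^esub> = trunc_class n 1"
  by (simp add: trunc_algebra_def Let_def FactRing_def trunc_class_def)

lemma trunc_algebra_add:
  "P \<in> carrier (poly_ring n) \<Longrightarrow> Q \<in> carrier (poly_ring n) \<Longrightarrow>
    trunc_class n P \<oplus>\<^bsub>trunc_algebra n\<^esub> trunc_class n Q = trunc_class n (P + Q)"
  using I.a_rcos_sum[of P Q] by (simp add: trunc_algebra_def Let_def FactRing_def trunc_class_def)

lemma trunc_algebra_mult:
  "P \<in> carrier (poly_ring n) \<Longrightarrow> Q \<in> carrier (poly_ring n) \<Longrightarrow>
    trunc_class n P \<otimes>\<^bsub>trunc_algebra n\<^esub> trunc_class n Q = trunc_class n (P * Q)"
  using I.rcoset_mult_add[of P Q] by (simp add: trunc_algebra_def Let_def FactRing_def trunc_class_def)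

lemma trunc_algebra_smult:
  "P \<in> carrier (poly_ring n) \<Longrightarrow>
    c \<odot>\<^bsub>trunc_algebra n\<^esub> trunc_class n P = trunc_class n (poly_const c * P)"
  using I.rcoset_mult_add[of "poly_const c" P] by (simp add: trunc_algebra_def Let_def FactRing_def trunc_class_def)

lemmas trunc_algebra_simps = trunc_algebra_zero trunc_algebra_one trunc_algebra_add
  trunc_algebra_mult trunc_algebra_smult

end

lemma poly_const_add: "poly_const (c + d) = poly_const c + poly_const d"
  by (simp add: poly_const_def single_add)

lemma poly_const_mult: "poly_const (c * d) = poly_const c * poly_const d"
  by (simp add: poly_const_def mult_single)

lemma poly_const_1 [simp]: "poly_const 1 = 1"
  by (simp add: poly_const_def)

lemma trunc_algebra_algebra: "algebra class_ring (trunc_algebra n)"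
proof (rule algebraI)
  show "cring (trunc_algebra n)"
  proof (rule cringI[OF abelian_groupI comm_monoidI], goal_cases)
    case (6 x)
    then obtain P where "P \<in> carrier (poly_ring n)" "x = trunc_class n P"
      by (auto simp: trunc_algebra_carrier)
    then show ?case
      by (intro bexI[of _ "trunc_class n (- P)"]) (auto simp: trunc_algebra_simps)
  qed (auto simp: trunc_algebra_carrier trunc_algebra_simps algebra_simps)
qed (auto simp: trunc_algebra_carrier trunc_algebra_simps poly_const_add poly_const_mult
    class_cring.is_cring algebra_simps)

text \<open>Closure under negation comes from multiplication by the constant -1.\<close>

lemma poly_ring_idealI:
  assumes "J \<subseteq> carrier (poly_ring n)" "0 \<in> J"
    and add: "\<And>P Q. P \<in> J \<Longrightarrow> Q \<in> J \<Longrightarrow> P + Q \<in> J"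
    and mult: "\<And>P Q. P \<in> J \<Longrightarrow> Q \<in> carrier (poly_ring n) \<Longrightarrow> Q * P \<in> J"
  shows "ideal J (poly_ring n)"
proof -
  interpret P: cring "poly_ring n"
    by (rule poly_ring_cring)
  have neg: "- P \<in> J" if "P \<in> J" for P
    using mult[OF that, of "- 1"] by simp
  have a_inv: "\<ominus>\<^bsub>poly_ring n\<^esub> P = - P" if "P \<in> J" for P
    using that assms(1) neg[OF that] by (intro P.minus_equality) auto
  show ?thesis
  proof (rule idealI)
    show "subgroup J (add_monoid (poly_ring n))"
      by (rule P.add.subgroupI) (use assms neg a_inv in auto)
  qed (use mult in \<open>auto simp: P.ring_axioms mult.commute\<close>)
qed

text \<open>Induction over the truncation ideal in both characteristics: take for \<open>J\<close>
  the polynomials with the wanted property. In characteristic 0 the ideal is zero and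
  \<open>pow\<close> is vacuous.\<close>

lemma trunc_ideal_subset:
  fixes J :: "'k::field mpoly set"
  assumes J: "ideal J (poly_ring n)"
    and pow: "\<And>i. CHAR('k) > 0 \<Longrightarrow> i < n \<Longrightarrow> poly_var i ^ CHAR('k) \<in> J"
  shows "trunc_ideal n \<subseteq> J"
proof -
  interpret P: cring "poly_ring n"
    by (rule poly_ring_cring)
  interpret J: ideal J "poly_ring n"
    by (rule J)
  show ?thesis
  proof (cases "CHAR('k) = 0")
    case True
    then show ?thesis
      using J.zero_closed by (simp add: trunc_ideal_def)
  next
    case False
    then show ?thesis
      unfolding trunc_ideal_def
      using pow P.genideal_minimal[OF J, of "(\<lambda>i. poly_var i ^ CHAR('k)) ` {..<n}"] by auto
  qed
qed

context
  fixes n :: nat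
begin

interpretation P: cring "poly_ring n"
  by (rule poly_ring_cring)

interpretation I: ideal "trunc_ideal n" "poly_ring n"
  by (rule trunc_ideal_ideal)

lemma poly_var_power_in_trunc_ideal:
  assumes "CHAR('k) > 0" "i < n"
  shows "(poly_var i :: 'k::field mpoly) ^ CHAR('k) \<in> trunc_ideal n"
  using assms by (auto simp: trunc_ideal_def poly_var_power intro!: subsetD[OF P.genideal_self])

lemma trunc_ideal_add: "P \<in> trunc_ideal n \<Longrightarrow> Q \<in> trunc_ideal n \<Longrightarrow> P + Q \<in> trunc_ideal n"
  using I.a_closed by simp

lemma trunc_ideal_mult:
  "P \<in> trunc_ideal n \<Longrightarrow> Q \<in> carrier (poly_ring n) \<Longrightarrow> Q * P \<in> trunc_ideal n"
  using I.I_l_closed by simp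

lemma trunc_ideal_zero: "0 \<in> trunc_ideal n"
  using I.zero_closed by simp

lemma trunc_ideal_sum: "(\<And>i. i \<in> A \<Longrightarrow> f i \<in> trunc_ideal n) \<Longrightarrow> sum f A \<in> trunc_ideal n"
  by (induct A rule: infinite_finite_induct) (auto simp: trunc_ideal_zero trunc_ideal_add)

text \<open>By the product rule, the elements of the ideal whose derivative is again in the ideal
  form an ideal. It contains the generators, since differentiating x^p gives the coefficient p =
  0.\<close>

lemma poly_partial_trunc_ideal:
  assumes "P \<in> trunc_ideal n"
  shows "poly_partial i P \<in> trunc_ideal n"
proof -
  let ?J = "{P \<in> trunc_ideal n. poly_partial i P \<in> trunc_ideal n}"
  have "ideal ?J (poly_ring n)"
    by (rule poly_ring_idealI) (use I.a_subset in \<open>auto simp: trunc_ideal_zero poly_partial_zero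
      trunc_ideal_add poly_partial_add trunc_ideal_mult poly_partial_mult\<close>)
  then have "trunc_ideal n \<subseteq> ?J"
    by (rule trunc_ideal_subset)
      (simp add: poly_var_power_in_trunc_ideal, simp add: poly_var_power poly_partial_single lookup_single
        trunc_ideal_zero when_def)
  then show ?thesis
    using assms by auto
qed

text \<open>Polynomials without constant term form an ideal, and it contains every x^p because p >
  0.\<close>

lemma lookup_zero_trunc_ideal:
  assumes "P \<in> trunc_ideal n"
  shows "Poly_Mapping.lookup P 0 = 0"
proof -
  let ?J = "{P \<in> carrier (poly_ring n). Poly_Mapping.lookup P 0 = 0}"
  have "ideal ?J (poly_ring n)"
    by (rule poly_ring_idealI) (auto simp: lookup_add lookup_mult_zero)
  then have "trunc_ideal n \<subseteq> ?J"
    by (rule trunc_ideal_subset)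
      (auto simp: poly_var_power lookup_single when_def poly_mapping_eq_iff fun_eq_iff)
  then show ?thesis
    using assms by auto
qed

end

section \<open>Derivations with constant coefficients\<close>

definition poly_deriv :: "nat \<Rightarrow> (nat \<Rightarrow> 'k) \<Rightarrow> 'k::field mpoly \<Rightarrow> 'k mpoly" where
  "poly_deriv n c P = (\<Sum>i<n. poly_const (c i) * poly_partial i P)"

lemma poly_deriv_closed [simp]:
  "P \<in> carrier (poly_ring n) \<Longrightarrow> poly_deriv n c P \<in> carrier (poly_ring n)"
  by (simp add: poly_deriv_def)

lemma poly_deriv_add: "poly_deriv n c (P + Q) = poly_deriv n c P + poly_deriv n c Q"
  by (simp add: poly_deriv_def poly_partial_add distrib_left sum.distrib)

lemma poly_deriv_mult: "poly_deriv n c (P * Q) = poly_deriv n c P * Q + P * poly_deriv n c Q"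
  by (simp add: poly_deriv_def poly_partial_mult sum_distrib_left sum_distrib_right sum.distrib algebra_simps)

lemma poly_deriv_const: "poly_deriv n c (poly_const a) = 0"
  by (simp add: poly_deriv_def poly_const_def poly_partial_single)

lemma poly_deriv_add_coeff: "poly_deriv n (\<lambda>i. c i + d i) P = poly_deriv n c P + poly_deriv n d P"
  by (simp add: poly_deriv_def poly_const_add distrib_right sum.distrib)

lemma poly_deriv_scale_coeff: "poly_deriv n (\<lambda>i. a * c i) P = poly_const a * poly_deriv n c P"
  by (simp add: poly_deriv_def poly_const_mult sum_distrib_left mult.assoc)

lemma poly_deriv_zero_coeff: "poly_deriv n (\<lambda>i. 0) P = 0"
  by (simp add: poly_deriv_def poly_const_def)

lemma poly_deriv_commute: "poly_deriv n c (poly_deriv n d P) = poly_deriv n d (poly_deriv n c P)"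
  unfolding poly_deriv_def
  by (simp add: poly_partial_sum poly_partial_const_mult sum_distrib_left poly_partial_commute[of _ i for i])
    (subst sum.swap, simp add: mult.left_commute poly_partial_commute)

lemma poly_deriv_trunc_ideal: "P \<in> trunc_ideal n \<Longrightarrow> poly_deriv n c P \<in> trunc_ideal n"
  unfolding poly_deriv_def
  by (intro trunc_ideal_sum trunc_ideal_mult poly_partial_trunc_ideal) auto

lemma poly_deriv_minus: "poly_deriv n c (P - Q) = poly_deriv n c P - poly_deriv n c Q"
  using poly_deriv_add[of n c "P - Q" Q] by simp

text \<open>Indexed by the whole coefficient vector, so that the derivation attached to
  \<open>h + \<Sum> c_j y_j\<close> is a single function of its coordinates.\<close>

definition trunc_deriv :: "nat \<Rightarrow> (nat \<Rightarrow> 'k) \<Rightarrow> 'k::field mpoly set \<Rightarrow> 'k mpoly set" where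
  "trunc_deriv n c = (\<lambda>z\<in>carrier (trunc_algebra n).
     the_elem ((\<lambda>P. trunc_class n (poly_deriv n c P)) ` z))"

lemma trunc_deriv_class:
  assumes P: "P \<in> carrier (poly_ring n)"
  shows "trunc_deriv n c (trunc_class n P) = trunc_class n (poly_deriv n c P)"
proof -
  have "trunc_class n (poly_deriv n c Q) = trunc_class n (poly_deriv n c P)" if "Q \<in> trunc_class n P" for Q
    using trunc_classD[OF P that] P
    by (simp add: trunc_class_eq_iff poly_deriv_minus[symmetric] poly_deriv_trunc_ideal)
  from image_eq_singletonI[of "trunc_class n P", OF this trunc_class_self[OF P]] show ?thesis
    using P by (simp add: trunc_deriv_def)
qed

lemma trunc_deriv_extensional: "trunc_deriv n c \<in> extensional (carrier (trunc_algebra n))"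
  by (simp add: trunc_deriv_def)

lemma trunc_partial_eq:
  assumes "i < n"
  shows "trunc_partial n i = trunc_deriv n (\<lambda>j. if j = i then 1 else 0)"
proof -
  have "poly_deriv n (\<lambda>j. if j = i then 1 else 0) P = poly_partial i P" for P :: "'a mpoly"
  proof -
    have "poly_deriv n (\<lambda>j. if j = i then 1 else 0) P = (\<Sum>j<n. if j = i then poly_partial j P else 0)"
      unfolding poly_deriv_def by (rule sum.cong) (auto simp: poly_const_def)
    then show ?thesis
      using assms by simp
  qed
  then show ?thesis
    by (simp add: trunc_partial_def trunc_deriv_def trunc_class_def)
qed

lemma trunc_deriv_closed: "z \<in> carrier (trunc_algebra n) \<Longrightarrow> trunc_deriv n c z \<in> carrier (trunc_algebra n)"
  by (auto simp: trunc_algebra_carrier trunc_deriv_class)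

text \<open>Scalars act on the quotient through classes of constants, so k-linearity follows from
  the product rule and the vanishing on constants.\<close>

lemma trunc_deriv_derivation: "trunc_deriv n c \<in> derivations (trunc_algebra n)"
  unfolding derivations_def LinearCombinations.module_hom_def
  by (auto simp: trunc_deriv_extensional trunc_deriv_closed)
    (auto simp: trunc_algebra_carrier trunc_algebra_simps trunc_deriv_class poly_deriv_add
      poly_deriv_mult poly_deriv_const)

lemma Der_simps:
  "carrier (Der X) = derivations X" "\<zero>\<^bsub>Der X\<^esub> = (\<lambda>x\<in>carrier X. \<zero>\<^bsub>X\<^esub>)"
  "\<delta> \<oplus>\<^bsub>Der X\<^esub> \<epsilon> = (\<lambda>x\<in>carrier X. \<delta> x \<oplus>\<^bsub>X\<^esub> \<epsilon> x)"
  "c \<odot>\<^bsub>Der X\<^esub> \<delta> = (\<lambda>x\<in>carrier X. c \<odot>\<^bsub>X\<^esub> \<delta> x)"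
  "lie_bracket (Der X) \<delta> \<epsilon> = (\<lambda>x\<in>carrier X. \<delta> (\<epsilon> x) \<ominus>\<^bsub>X\<^esub> \<epsilon> (\<delta> x))"
  by (simp_all add: Der_def)

text \<open>Elements of \<open>Der\<close> are extensional functions; equality has to be checked on
  classes of polynomials only.\<close>

lemma trunc_deriv_eqI:
  assumes "f \<in> extensional (carrier (trunc_algebra n))"
    and "\<And>P. P \<in> carrier (poly_ring n) \<Longrightarrow> f (trunc_class n P) = trunc_class n (poly_deriv n c P)"
  shows "f = trunc_deriv n c"
  by (rule extensionalityI[OF assms(1) trunc_deriv_extensional])
    (auto simp: trunc_algebra_carrier assms(2) trunc_deriv_class)

lemma trunc_deriv_add:
  "trunc_deriv n c \<oplus>\<^bsub>Der (trunc_algebra n)\<^esub> trunc_deriv n d = trunc_deriv n (\<lambda>i. c i + d i)"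
  by (rule trunc_deriv_eqI) (simp_all add: Der_simps trunc_deriv_class trunc_algebra_simps poly_deriv_add_coeff)

lemma trunc_deriv_smult:
  "a \<odot>\<^bsub>Der (trunc_algebra n)\<^esub> trunc_deriv n c = trunc_deriv n (\<lambda>i. a * c i)"
  by (rule trunc_deriv_eqI) (simp_all add: Der_simps trunc_deriv_class trunc_algebra_simps poly_deriv_scale_coeff)

lemma trunc_deriv_zero: "\<zero>\<^bsub>Der (trunc_algebra n)\<^esub> = trunc_deriv n (\<lambda>i. 0)"
  by (rule trunc_deriv_eqI) (simp_all add: Der_simps trunc_algebra_simps poly_deriv_zero_coeff)

lemma trunc_deriv_cong: "(\<And>i. i < n \<Longrightarrow> c i = d i) \<Longrightarrow> trunc_deriv n c = trunc_deriv n d"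
  by (rule trunc_deriv_eqI) (simp_all add: trunc_deriv_extensional trunc_deriv_class poly_deriv_def)

lemma trunc_deriv_bracket:
  "lie_bracket (Der (trunc_algebra n)) (trunc_deriv n c) (trunc_deriv n d) = \<zero>\<^bsub>Der (trunc_algebra n)\<^esub>"
proof -
  interpret X: algebra class_ring "trunc_algebra n"
    by (rule trunc_algebra_algebra)
  show ?thesis
    unfolding trunc_deriv_zero
    by (rule trunc_deriv_eqI)
      (simp_all add: Der_simps trunc_deriv_class poly_deriv_commute[of n c d] poly_deriv_zero_coeff
        trunc_algebra_zero[symmetric] X.minus_eq X.r_neg)
qed

section \<open>Evaluation at the origin, and monomials\<close>

definition trunc_eval :: "nat \<Rightarrow> 'k::field mpoly set \<Rightarrow> 'k" where
  "trunc_eval n z = the_elem ((\<lambda>P. Poly_Mapping.lookup P 0) ` z)"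

lemma trunc_eval_class:
  assumes P: "P \<in> carrier (poly_ring n)"
  shows "trunc_eval n (trunc_class n P) = Poly_Mapping.lookup P 0"
proof -
  have "Poly_Mapping.lookup Q 0 = Poly_Mapping.lookup P 0" if "Q \<in> trunc_class n P" for Q
    using lookup_zero_trunc_ideal[OF trunc_classD(2)[OF P that]] by (simp add: lookup_minus)
  from image_eq_singletonI[of "trunc_class n P", OF this trunc_class_self[OF P]] show ?thesis
    by (simp add: trunc_eval_def)
qed

lemma lookup_poly_const: "Poly_Mapping.lookup (poly_const c) 0 = c"
  by (simp add: poly_const_def)

lemma trunc_eval_character: "trunc_eval n \<in> algebra_characters (trunc_algebra n)"
  unfolding algebra_characters_def
  by (auto simp: trunc_algebra_carrier trunc_algebra_simps trunc_eval_class lookup_add lookup_mult_zero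
      lookup_poly_const intro!: ring_hom_memI)

text \<open>Linear independence of the partial derivatives: applied to x_i and evaluated at the
  origin, the derivation gives back c_i. In positive characteristic this survives because x_i itself
  is not truncated.\<close>

lemma trunc_deriv_eq_zeroD:
  assumes "trunc_deriv n c = \<zero>\<^bsub>Der (trunc_algebra n)\<^esub>" "i < n"
  shows "c i = 0"
proof -
  have "trunc_deriv n c (trunc_class n (poly_var i)) = trunc_deriv n (\<lambda>i. 0) (trunc_class n (poly_var i))"
    by (simp add: assms trunc_deriv_zero)
  then have "trunc_eval n (trunc_class n (poly_deriv n c (poly_var i))) = 0"
    using assms(2) by (simp add: trunc_deriv_class trunc_eval_class poly_deriv_zero_coeff)
  then have "Poly_Mapping.lookup (poly_deriv n c (poly_var i)) 0 = 0"
    using assms(2) by (simp add: trunc_eval_class)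
  moreover have "Poly_Mapping.lookup (poly_deriv n c (poly_var i)) 0 = (\<Sum>j<n. if j = i then c j else 0)"
    unfolding poly_deriv_def lookup_sum
    by (rule sum.cong) (auto simp: lookup_poly_const_mult poly_var_def lookup_poly_partial lookup_single when_def
        poly_mapping_eq_iff fun_eq_iff)
  ultimately show ?thesis
    using assms(2) by simp
qed

definition trunc_mono :: "nat \<Rightarrow> (nat \<Rightarrow>\<^sub>0 nat) \<Rightarrow> 'k::field mpoly set" where
  "trunc_mono n e = trunc_class n (Poly_Mapping.single e 1)"

lemma trunc_mono_closed [simp]: "Poly_Mapping.keys e \<subseteq> {..<n} \<Longrightarrow> trunc_mono n e \<in> carrier (trunc_algebra n)"
  by (simp add: trunc_mono_def)

lemma trunc_mono_mult:
  "Poly_Mapping.keys a \<subseteq> {..<n} \<Longrightarrow> Poly_Mapping.keys b \<subseteq> {..<n} \<Longrightarrow>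
    trunc_mono n a \<otimes>\<^bsub>trunc_algebra n\<^esub> trunc_mono n b = trunc_mono n (a + b)"
  by (simp add: trunc_mono_def trunc_algebra_simps mult_single)

text \<open>The monomial has x_j^p as a factor.\<close>

lemma trunc_mono_vanish:
  assumes "CHAR('k) > 0" "Poly_Mapping.keys e \<subseteq> {..<n}" "Poly_Mapping.lookup e j \<ge> CHAR('k)"
  shows "(trunc_mono n e :: 'k::field mpoly set) = \<zero>\<^bsub>trunc_algebra n\<^esub>"
proof -
  have "j \<in> Poly_Mapping.keys e"
    using assms(1,3) by (simp add: in_keys_iff)
  then have "j < n"
    using assms(2) by auto
  have "e = (e - Poly_Mapping.single j CHAR('k)) + Poly_Mapping.single j CHAR('k)"
    using assms(3) by (auto intro!: poly_mapping_eqI simp: lookup_add lookup_minus lookup_single when_def)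
  then have "Poly_Mapping.single e 1 = Poly_Mapping.single (e - Poly_Mapping.single j CHAR('k)) 1 * (poly_var j :: 'k mpoly) ^ CHAR('k)"
    by (simp add: poly_var_power mult_single)
  also have "\<dots> \<in> trunc_ideal n"
    using assms(2) keys_exp_minus[of e "Poly_Mapping.single j CHAR('k)"]
    by (intro trunc_ideal_mult poly_var_power_in_trunc_ideal assms \<open>j < n\<close>) auto
  finally show ?thesis
    using assms(2) by (simp add: trunc_mono_def trunc_algebra_zero trunc_class_eq_iff)
qed

lemma trunc_eval_mono: "Poly_Mapping.keys e \<subseteq> {..<n} \<Longrightarrow> trunc_eval n (trunc_mono n e) = (if e = 0 then 1 else 0)"
  by (simp add: trunc_mono_def trunc_eval_class lookup_single when_def)

lemma trunc_var_mono: "trunc_var n i = trunc_mono n (unit_exp i)"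
  by (simp add: trunc_var_def trunc_mono_def trunc_class_def poly_var_def)

text \<open>Stated under a linear form \<phi> because it is used with \<phi> x = B x a for a
  bilinear form B and a fixed a. Where the entry \<open>j\<close> of \<open>e\<close> is 0, the
  truncated exponent is harmless: its factor is 0.\<close>

lemma trunc_deriv_mono:
  fixes \<phi> :: "'k::field mpoly set \<Rightarrow> 'k"
  assumes "Poly_Mapping.keys e \<subseteq> {..<n}"
    and add: "\<And>x y. x \<in> carrier (trunc_algebra n) \<Longrightarrow> y \<in> carrier (trunc_algebra n) \<Longrightarrow>
      \<phi> (x \<oplus>\<^bsub>trunc_algebra n\<^esub> y) = \<phi> x + \<phi> y"
    and smult: "\<And>a x. x \<in> carrier (trunc_algebra n) \<Longrightarrow> \<phi> (a \<odot>\<^bsub>trunc_algebra n\<^esub> x) = a * \<phi> x"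
  shows "\<phi> (trunc_deriv n c (trunc_mono n e)) =
    (\<Sum>j<n. c j * (of_nat (Poly_Mapping.lookup e j) * \<phi> (trunc_mono n (e - unit_exp j))))"
proof -
  have scale: "\<phi> (trunc_class n (poly_const a * P)) = a * \<phi> (trunc_class n P)"
    if "P \<in> carrier (poly_ring n)" for a P
    using smult[of "trunc_class n P" a] that by (simp add: trunc_algebra_simps)
  have zero: "\<phi> (trunc_class n 0) = 0"
    using scale[of 0 0] by (simp add: poly_const_def)
  have sum: "\<phi> (trunc_class n (sum f A)) = (\<Sum>a\<in>A. \<phi> (trunc_class n (f a)))"
    if "\<And>a. a \<in> A \<Longrightarrow> f a \<in> carrier (poly_ring n)" for f and A :: "nat set"
    using that
  proof (induct A rule: infinite_finite_induct)
    case (insert a A)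
    then show ?case
      using add[of "trunc_class n (f a)" "trunc_class n (sum f A)"] by (simp add: trunc_algebra_simps)
  qed (simp_all add: zero)
  have kj: "Poly_Mapping.keys (e - unit_exp j) \<subseteq> {..<n}" for j
    using assms(1) keys_exp_minus[of e "unit_exp j"] by auto
  have "poly_partial j (Poly_Mapping.single e 1 :: 'k mpoly) = poly_const (of_nat (Poly_Mapping.lookup e j)) * Poly_Mapping.single (e - unit_exp j) 1" for j
    by (simp add: poly_partial_single poly_const_mult_single)
  then show ?thesis
    using assms(1) kj
    by (simp add: trunc_mono_def trunc_deriv_class poly_deriv_def sum scale)
qed

definition exp_vec :: "nat \<Rightarrow> (nat \<Rightarrow> nat) \<Rightarrow> nat \<Rightarrow>\<^sub>0 nat" where
  "exp_vec n i = (\<Sum>j<n. Poly_Mapping.single j (i j))"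

lemma lookup_exp_vec: "Poly_Mapping.lookup (exp_vec n i) j = (if j < n then i j else 0)"
  by (auto simp: exp_vec_def lookup_sum lookup_single when_def)

lemma keys_exp_vec: "Poly_Mapping.keys (exp_vec n i) \<subseteq> {..<n}"
  by (auto simp: in_keys_iff lookup_exp_vec split: if_splits)

lemma trunc_var_monomial:
  "(\<Otimes>\<^bsub>trunc_algebra n\<^esub>j\<in>{..<n}. trunc_var n j [^]\<^bsub>trunc_algebra n\<^esub> i j) = trunc_mono n (exp_vec n i)"
proof -
  interpret X: algebra class_ring "trunc_algebra n"
    by (rule trunc_algebra_algebra)
  have pow: "trunc_var n j [^]\<^bsub>trunc_algebra n\<^esub> r = trunc_mono n (Poly_Mapping.single j r)" if "j < n" for j r
  proof (induct r)
    case 0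
    then show ?case
      by (simp add: trunc_mono_def trunc_algebra_one)
  next
    case (Suc r)
    have "Poly_Mapping.single j r + unit_exp j = Poly_Mapping.single j (Suc r)"
      using single_add[of j r 1] by simp
    then show ?case
      using Suc that by (simp add: trunc_var_mono trunc_mono_mult)
  qed
  have "(\<Otimes>\<^bsub>trunc_algebra n\<^esub>j\<in>{..<k}. trunc_var n j [^]\<^bsub>trunc_algebra n\<^esub> i j) = trunc_mono n (exp_vec k i)"
    if "k \<le> n" for k
    using that
  proof (induct k)
    case 0
    then show ?case
      by (simp add: trunc_mono_def trunc_algebra_one exp_vec_def)
  next
    case (Suc k)
    then have "Poly_Mapping.keys (exp_vec k i) \<subseteq> {..<n}" "Poly_Mapping.keys (Poly_Mapping.single k (i k)) \<subseteq> {..<n}"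
      using keys_exp_vec[of k i] by (auto intro: order.strict_trans2)
    then show ?case
      using Suc by (simp add: lessThan_Suc X.finprod_insert pow trunc_mono_mult Pi_def exp_vec_def)
  qed
  from this[of n] show ?thesis
    by simp
qed

section \<open>Commuting inner derivations\<close>

context lie_algebra
begin

lemma bracket_zero_right [simp]: "x \<in> carrier L \<Longrightarrow> lie_bracket L x \<zero> = \<zero>"
  using bracket_smult_right[of x "\<zero>" 0] by (simp add: bracket_closed lmult_0[simplified])

lemma bracket_zero_left [simp]: "x \<in> carrier L \<Longrightarrow> lie_bracket L \<zero> x = \<zero>"
  using bracket_smult_left[of "\<zero>" x 0] by (simp add: bracket_closed lmult_0[simplified])

lemma bracket_antisym:
  assumes "x \<in> carrier L" "y \<in> carrier L"
  shows "lie_bracket L x y = \<ominus> lie_bracket L y x"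
proof -
  have "\<zero> = lie_bracket L (x \<oplus> y) (x \<oplus> y)"
    using assms by (simp add: bracket_self)
  also have "\<dots> = lie_bracket L (x \<oplus> y) x \<oplus> lie_bracket L (x \<oplus> y) y"
    using assms by (simp add: bracket_add_right)
  also have "\<dots> = lie_bracket L y x \<oplus> lie_bracket L x y"
    using assms by (simp add: bracket_add_left bracket_self bracket_closed)
  finally have "lie_bracket L x y \<oplus> lie_bracket L y x = \<zero>"
    using assms by (simp add: M.a_comm bracket_closed)
  then show ?thesis
    using assms M.minus_equality[of "lie_bracket L x y" "lie_bracket L y x"] by (simp add: bracket_closed)
qed

lemma bracket_uminus_right:
  assumes "x \<in> carrier L" "y \<in> carrier L"
  shows "lie_bracket L x (\<ominus> y) = \<ominus> lie_bracket L x y"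
  using bracket_smult_right[OF assms, of "- 1"] assms
  by (simp add: smult_minus_1[simplified class_ring_simps, simplified] bracket_closed)

text \<open>The Jacobi identity, read as: ad x is a derivation of the bracket. This is the degree
  one case of the Leibniz rule and the source of the general one.\<close>

lemma jacobi_derivation:
  assumes "x \<in> carrier L" "y \<in> carrier L" "z \<in> carrier L"
  shows "lie_bracket L x (lie_bracket L y z) =
    lie_bracket L (lie_bracket L x y) z \<oplus> lie_bracket L y (lie_bracket L x z)"
proof -
  let ?a = "lie_bracket L x (lie_bracket L y z)"
    and ?b = "lie_bracket L y (lie_bracket L x z)"
    and ?c = "lie_bracket L (lie_bracket L x y) z"
  have "lie_bracket L y (lie_bracket L z x) = \<ominus> ?b"
    using assms by (simp add: bracket_antisym[of z x] bracket_uminus_right bracket_closed)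
  moreover have "lie_bracket L z (lie_bracket L x y) = \<ominus> ?c"
    using assms by (simp add: bracket_antisym[of z] bracket_closed)
  ultimately have "?a \<oplus> \<ominus> ?b \<oplus> \<ominus> ?c = \<zero>"
    using jacobi[OF assms] by simp
  then have "?a \<ominus> (?c \<oplus> ?b) = \<zero>"
    using assms by (simp add: M.minus_eq M.minus_add bracket_closed M.a_assoc M.a_comm[of "\<ominus> ?b"])
  then show ?thesis
    using assms by (simp add: bracket_closed)
qed

end

text \<open>Here \<open>y\<close> is a commuting family; that it provides coordinates on a
  complement of \<open>H\<close> is added in \<open>split_action\<close>.\<close>

locale abelian_action = lie_algebra L for L :: "('k::field, 'l, 'c) lie_scheme" (structure) +
  fixes H :: "'l set" and n :: nat and y :: "nat \<Rightarrow> 'l"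
  assumes ideal: "lie_ideal H L"
    and y_closed: "j < n \<Longrightarrow> y j \<in> carrier L"
    and y_commute: "i < n \<Longrightarrow> j < n \<Longrightarrow> lie_bracket L (y i) (y j) = \<zero>"
begin

abbreviation ad :: "nat \<Rightarrow> 'l \<Rightarrow> 'l" where
  "ad j \<equiv> lie_bracket L (y j)"

abbreviation act :: "(nat \<Rightarrow>\<^sub>0 nat) \<Rightarrow> 'l \<Rightarrow> 'l" where
  "act e \<equiv> monomial_action L n y (Poly_Mapping.lookup e)"

lemma H_submodule: "submodule class_ring H L"
  using ideal by (simp add: lie_ideal_def VectorSpace.subspace_def)

lemma H_subset: "h \<in> H \<Longrightarrow> h \<in> carrier L"
  using H_submodule by (auto simp: submodule_def)

lemma H_add: "h \<in> H \<Longrightarrow> h' \<in> H \<Longrightarrow> h \<oplus> h' \<in> H"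
  using H_submodule by (simp add: submodule_def)

lemma H_zero: "\<zero> \<in> H"
  using H_submodule by (simp add: submodule_def)

lemma H_smult: "h \<in> H \<Longrightarrow> c \<odot>\<^bsub>L\<^esub> h \<in> H"
  using H_submodule by (simp add: submodule_def)

lemma H_bracket: "x \<in> carrier L \<Longrightarrow> h \<in> H \<Longrightarrow> lie_bracket L x h \<in> H"
  using ideal by (simp add: lie_ideal_def)

lemma ad_closed: "j < n \<Longrightarrow> h \<in> H \<Longrightarrow> ad j h \<in> H"
  by (simp add: H_bracket y_closed)

lemma ad_pow_closed: "j < n \<Longrightarrow> h \<in> H \<Longrightarrow> (ad j ^^ r) h \<in> H"
  by (induct r) (auto simp: ad_closed)

lemma ad_commute:
  assumes "i < n" "j < n" "h \<in> H"
  shows "ad i (ad j h) = ad j (ad i h)"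
  using jacobi_derivation[of "y i" "y j" h] assms
  by (simp add: y_closed y_commute H_subset bracket_closed)

lemma ad_pow_commute:
  assumes "i < n" "j < n" "h \<in> H"
  shows "(ad i ^^ r) (ad j h) = ad j ((ad i ^^ r) h)"
  by (induct r) (simp_all add: assms ad_commute[of i j] ad_pow_closed)

lemma foldr_ad_closed: "set js \<subseteq> {..<n} \<Longrightarrow> h \<in> H \<Longrightarrow> foldr (\<lambda>j. ad j ^^ i j) js h \<in> H"
  by (induct js) (auto simp: ad_pow_closed)

lemma foldr_ad_commute:
  "set js \<subseteq> {..<n} \<Longrightarrow> j < n \<Longrightarrow> h \<in> H \<Longrightarrow>
    foldr (\<lambda>k. ad k ^^ i k) js (ad j h) = ad j (foldr (\<lambda>k. ad k ^^ i k) js h)"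
  by (induct js) (auto simp: ad_pow_commute foldr_ad_closed)

text \<open>The operators commute on \<open>H\<close>, so the additional factor can be moved from
  its place in the ordered product to the outside. Distinctness guarantees that just one place
  changes.\<close>

lemma foldr_ad_Suc:
  assumes "set js \<subseteq> {..<n}" "distinct js" "j \<in> set js" "h \<in> H"
  shows "foldr (\<lambda>k. ad k ^^ (i(j := Suc (i j))) k) js h = ad j (foldr (\<lambda>k. ad k ^^ i k) js h)"
  using assms
proof (induct js)
  case (Cons a js)
  show ?case
  proof (cases "a = j")
    case True
    then have "foldr (\<lambda>k. ad k ^^ (i(j := Suc (i j))) k) js h = foldr (\<lambda>k. ad k ^^ i k) js h"
      using Cons.prems by (intro foldr_cong) auto
    then show ?thesis
      using True by simp
  next
    case False
    have "j < n"
      using Cons.prems by auto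
    then show ?thesis
      using Cons False by (auto simp: ad_pow_commute foldr_ad_closed)
  qed
qed simp

lemma act_closed: "h \<in> H \<Longrightarrow> act e h \<in> H"
  unfolding monomial_action_def by (rule foldr_ad_closed) auto

lemma act_0: "act 0 h = h"
proof -
  have "foldr (\<lambda>j. ad j ^^ 0) js h = h" for js
    by (induct js) auto
  then show ?thesis
    by (simp add: monomial_action_def atLeast0LessThan)
qed

lemma act_ad: "j < n \<Longrightarrow> h \<in> H \<Longrightarrow> act e (ad j h) = ad j (act e h)"
  unfolding monomial_action_def by (rule foldr_ad_commute) auto

text \<open>The recursion behind every induction over exponents: the fixed order of the factors no
  longer matters after this.\<close>

lemma act_add_unit: "j < n \<Longrightarrow> h \<in> H \<Longrightarrow> act (e + unit_exp j) h = ad j (act e h)"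
proof -
  assume *: "j < n" "h \<in> H"
  have "Poly_Mapping.lookup (e + unit_exp j) = (Poly_Mapping.lookup e)(j := Suc (Poly_Mapping.lookup e j))"
    by (auto simp: lookup_add lookup_single when_def)
  then show ?thesis
    unfolding monomial_action_def using * foldr_ad_Suc[of "[0..<n]" j h "Poly_Mapping.lookup e"]
    by (auto simp: atLeast0LessThan)
qed

lemma act_add_single: "j < n \<Longrightarrow> h \<in> H \<Longrightarrow> act (e + Poly_Mapping.single j r) h = (ad j ^^ r) (act e h)"
proof (induct r)
  case (Suc r)
  have "e + Poly_Mapping.single j (Suc r) = e + Poly_Mapping.single j r + unit_exp j"
    using single_add[of j r 1] by (simp add: add.assoc)
  then show ?case
    using Suc by (simp only: act_add_unit) simp
qed simp

lemma act_add:
  assumes "h \<in> H" "h' \<in> H"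
  shows "act e (h \<oplus> h') = act e h \<oplus> act e h'"
proof -
  have pow: "(ad j ^^ r) (g \<oplus> g') = (ad j ^^ r) g \<oplus> (ad j ^^ r) g'"
    if "j < n" "g \<in> H" "g' \<in> H" for j r g g'
    by (induct r) (simp_all add: that bracket_add_right y_closed ad_pow_closed H_subset)
  have "foldr (\<lambda>j. ad j ^^ i j) js (h \<oplus> h') = foldr (\<lambda>j. ad j ^^ i j) js h \<oplus> foldr (\<lambda>j. ad j ^^ i j) js h'"
    if "set js \<subseteq> {..<n}" for js i
    using that by (induct js) (auto simp: pow foldr_ad_closed assms)
  then show ?thesis
    by (simp add: monomial_action_def atLeast0LessThan)
qed

lemma act_smult:
  assumes "h \<in> H"
  shows "act e (c \<odot>\<^bsub>L\<^esub> h) = c \<odot>\<^bsub>L\<^esub> act e h"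
proof -
  have pow: "(ad j ^^ r) (c \<odot>\<^bsub>L\<^esub> g) = c \<odot>\<^bsub>L\<^esub> (ad j ^^ r) g" if "j < n" "g \<in> H" for j r g
    by (induct r) (simp_all add: that bracket_smult_right y_closed ad_pow_closed H_subset)
  have "foldr (\<lambda>j. ad j ^^ i j) js (c \<odot>\<^bsub>L\<^esub> h) = c \<odot>\<^bsub>L\<^esub> foldr (\<lambda>j. ad j ^^ i j) js h"
    if "set js \<subseteq> {..<n}" for js i
    using that by (induct js) (auto simp: pow foldr_ad_closed assms)
  then show ?thesis
    by (simp add: monomial_action_def atLeast0LessThan)
qed

end

section \<open>Induction over exponents, factorials and splittings\<close>

lemma exp_induct [consumes 1, case_names zero unit]:
  assumes "Poly_Mapping.keys e \<subseteq> {..<n}"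
    and "P 0"
    and step: "\<And>e j. Poly_Mapping.keys e \<subseteq> {..<n} \<Longrightarrow> j < n \<Longrightarrow> P e \<Longrightarrow> P (e + unit_exp j)"
  shows "P e"
  using assms(1)
\<comment> \<open>Induction on the total degree: some entry is nonzero, and one unit is taken away
  from it.\<close>
proof (induct "\<Sum>j<n. Poly_Mapping.lookup e j" arbitrary: e)
  case 0
  then have "e = 0"
    by (intro poly_mapping_eqI) (auto simp: in_keys_iff subset_iff)
  then show ?case
    using assms(2) by simp
next
  case (Suc s)
  obtain j where j: "j < n" "Poly_Mapping.lookup e j \<noteq> 0"
    using Suc(2) by (metis lessThan_iff nat.distinct(1) sum.neutral)
  let ?e = "e - unit_exp j"
  have e: "?e + unit_exp j = e"
    by (rule exp_minus_plus_unit) (fact j)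
  have k: "Poly_Mapping.keys ?e \<subseteq> {..<n}"
    using keys_exp_minus[of e "unit_exp j"] Suc(3) by auto
  have "(\<Sum>i<n. Poly_Mapping.lookup e i) = (\<Sum>i<n. Poly_Mapping.lookup ?e i + (if i = j then 1 else 0))"
    by (subst e[symmetric]) (auto simp: lookup_add lookup_single when_def intro!: sum.cong)
  then have "s = (\<Sum>i<n. Poly_Mapping.lookup ?e i)"
    using Suc(2) j by (simp add: sum.distrib)
  then show ?case
    using step[OF k j(1) Suc(1)[OF _ k]] e by simp
qed

text \<open>The scalar 1/e!. Since \<open>inverse 0 = 0\<close>, its value is 0 as soon as e!
  vanishes in the field.\<close>

definition inv_exp_fact :: "nat \<Rightarrow> (nat \<Rightarrow>\<^sub>0 nat) \<Rightarrow> 'k::field" where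
  "inv_exp_fact n e = inverse (of_nat (\<Prod>j<n. fact (Poly_Mapping.lookup e j)))"

lemma inv_exp_fact_0: "inv_exp_fact n 0 = 1"
  by (simp add: inv_exp_fact_def)

text \<open>In a field \<open>inverse\<close> is multiplicative even at 0, so this direction holds
  for all exponents. Cancelling the new factor, as in \<open>inv_exp_fact_add_unit'\<close>,
  requires it to be nonzero.\<close>

lemma inv_exp_fact_add_unit:
  assumes "j < n"
  shows "inv_exp_fact n (e + unit_exp j) =
    inverse (of_nat (Suc (Poly_Mapping.lookup e j))) * (inv_exp_fact n e :: 'k::field)"
proof -
  have "(\<Prod>i<n. fact (Poly_Mapping.lookup (e + unit_exp j) i)) =
      (\<Prod>i<n. (if i = j then Suc (Poly_Mapping.lookup e j) else 1) * fact (Poly_Mapping.lookup e i) :: nat)"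
    by (rule prod.cong) (auto simp: lookup_add lookup_single when_def)
  also have "\<dots> = Suc (Poly_Mapping.lookup e j) * (\<Prod>i<n. fact (Poly_Mapping.lookup e i))"
    using assms by (simp add: prod.distrib)
  finally show ?thesis
    by (simp only: inv_exp_fact_def of_nat_mult) (rule inverse_mult_distrib)
qed

lemma inv_exp_fact_add_unit':
  assumes "j < n" "of_nat (Suc (Poly_Mapping.lookup e j)) \<noteq> (0 :: 'k::field)"
  shows "of_nat (Suc (Poly_Mapping.lookup e j)) * inv_exp_fact n (e + unit_exp j) = (inv_exp_fact n e :: 'k)"
  unfolding inv_exp_fact_add_unit[OF assms(1)] mult.assoc[symmetric] right_inverse[OF assms(2)] by simp

definition exp_splits :: "(nat \<Rightarrow>\<^sub>0 nat) \<Rightarrow> ((nat \<Rightarrow>\<^sub>0 nat) \<times> (nat \<Rightarrow>\<^sub>0 nat)) set" where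
  "exp_splits c = {(a, b). a + b = c}"

lemma finite_exp_box:
  "finite {e :: nat \<Rightarrow>\<^sub>0 nat. Poly_Mapping.keys e \<subseteq> {..<n} \<and> (\<forall>j. Poly_Mapping.lookup e j < m)}"
proof -
  have "finite {f :: nat \<Rightarrow> nat. \<forall>x. (x \<in> {..<n} \<longrightarrow> f x \<in> {..<m}) \<and> (x \<notin> {..<n} \<longrightarrow> f x = 0)}"
    by (rule finite_set_of_finite_funs) auto
  then have "finite (Poly_Mapping.lookup ` {e :: nat \<Rightarrow>\<^sub>0 nat. Poly_Mapping.keys e \<subseteq> {..<n} \<and> (\<forall>j. Poly_Mapping.lookup e j < m)})"
    by (rule rev_finite_subset) (auto simp: in_keys_iff)
  then show ?thesis
    by (rule finite_imageD) (simp add: inj_on_def poly_mapping.lookup_inject)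
qed

lemma exp_bounded:
  obtains n m where "Poly_Mapping.keys (c :: nat \<Rightarrow>\<^sub>0 nat) \<subseteq> {..<n}" "\<And>j. Poly_Mapping.lookup c j < m"
proof -
  obtain n where "Poly_Mapping.keys c \<subseteq> {..<n}"
    using finite_nat_bounded[OF finite_keys] by blast
  moreover have "Poly_Mapping.lookup c j < Suc (\<Sum>j\<in>Poly_Mapping.keys c. Poly_Mapping.lookup c j)" for j
    by (cases "j \<in> Poly_Mapping.keys c") (auto simp: in_keys_iff less_Suc_eq_le intro!: member_le_sum)
  ultimately show ?thesis
    using that by blast
qed

text \<open>Any box that contains \<open>c\<close> contains both parts of each splitting of
  \<open>c\<close>.\<close>

lemma finite_exp_splits: "finite (exp_splits c)"
proof -
  obtain n m where c: "Poly_Mapping.keys c \<subseteq> {..<n}" "\<And>j. Poly_Mapping.lookup c j < m"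
    using exp_bounded by blast
  let ?E = "{e :: nat \<Rightarrow>\<^sub>0 nat. Poly_Mapping.keys e \<subseteq> {..<n} \<and> (\<forall>j. Poly_Mapping.lookup e j < m)}"
  have "exp_splits c \<subseteq> ?E \<times> ?E"
    using c by (auto simp: exp_splits_def keys_exp_add lookup_add) (metis add_lessD1 add.commute)+
  then show ?thesis
    by (rule finite_subset) (intro finite_SigmaI finite_exp_box)
qed

text \<open>Weighting the splittings \<open>a + b\<close> by \<open>a\<^sub>j + b\<^sub>j\<close> turns the Leibniz rule for divided powers into a sum
  over splittings of the smaller exponent, without binomial coefficients.\<close>

lemma sum_exp_splits_add_unit:
  fixes G :: "(nat \<Rightarrow>\<^sub>0 nat) \<Rightarrow> (nat \<Rightarrow>\<^sub>0 nat) \<Rightarrow> 'k::field"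
  assumes j: "j < n" and nz: "of_nat (fact (Suc (Poly_Mapping.lookup c j)) :: nat) \<noteq> (0 :: 'k)"
  shows "of_nat (Suc (Poly_Mapping.lookup c j)) *
      (\<Sum>(a, b)\<in>exp_splits (c + unit_exp j). inv_exp_fact n a * inv_exp_fact n b * G a b) =
    (\<Sum>(a, b)\<in>exp_splits c. inv_exp_fact n a * inv_exp_fact n b * (G (a + unit_exp j) b + G a (b + unit_exp j)))"
proof -
  let ?q = "inv_exp_fact n :: _ \<Rightarrow> 'k" and ?d = "unit_exp j" and ?S = "exp_splits (c + unit_exp j)"
  \<comment> \<open>All factors that have to be cancelled below divide (c_j + 1)!, which is nonzero
    by assumption.\<close>
  have ne: "of_nat (Suc r) \<noteq> (0 :: 'k)" if "r \<le> Poly_Mapping.lookup c j" for r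
  proof
    assume "of_nat (Suc r) = (0 :: 'k)"
    moreover have "Suc r dvd fact (Suc (Poly_Mapping.lookup c j))"
      using that by (intro dvd_fact) auto
    then obtain k where "(fact (Suc (Poly_Mapping.lookup c j)) :: nat) = Suc r * k"
      by (rule dvdE)
    ultimately show False
      using nz by (simp only: of_nat_mult) simp
  qed
  have lookup_le: "Poly_Mapping.lookup a j \<le> Poly_Mapping.lookup c j" "Poly_Mapping.lookup b j \<le> Poly_Mapping.lookup c j" if "(a, b) \<in> exp_splits c" for a b
    using that by (auto simp: exp_splits_def lookup_add)
  \<comment> \<open>The weight a_j removes the pairs with a_j = 0. All others arise from a splitting
    of \<open>c\<close> by raising a_j, and the weight cancels the factor by which a! has
    grown.\<close>
  have left: "(\<Sum>(a, b)\<in>?S. of_nat (Poly_Mapping.lookup a j) * (?q a * ?q b * G a b)) =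
      (\<Sum>(a, b)\<in>exp_splits c. ?q a * ?q b * G (a + ?d) b)"
  proof -
    have "(\<Sum>(a, b)\<in>?S. of_nat (Poly_Mapping.lookup a j) * (?q a * ?q b * G a b)) =
        (\<Sum>(a, b)\<in>(\<lambda>(a, b). (a + ?d, b)) ` exp_splits c. of_nat (Poly_Mapping.lookup a j) * (?q a * ?q b * G a b))"
    proof (rule sum.mono_neutral_right[OF finite_exp_splits], goal_cases)
      case 1
      show ?case
        by (auto simp: exp_splits_def ac_simps)
    next
      case 2
      have *: "(a, b) \<in> (\<lambda>(a, b). (a + ?d, b)) ` exp_splits c" if "a + b = c + ?d" "Poly_Mapping.lookup a j \<noteq> 0" for a b
      proof -
        have "a - ?d + b + ?d = c + ?d"
          using exp_minus_plus_unit[OF that(2)] that(1) by (metis add.assoc add.commute)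
        then show ?thesis
          using exp_minus_plus_unit[OF that(2)]
          by (intro image_eqI[of _ _ "(a - ?d, b)"]) (auto simp: exp_splits_def)
      qed
      show ?case
      proof clarify
        fix a b
        assume "(a, b) \<in> ?S" "(a, b) \<notin> (\<lambda>(a, b). (a + ?d, b)) ` exp_splits c"
        then have "Poly_Mapping.lookup a j = 0"
          using *[of a b] by (auto simp: exp_splits_def)
        then show "of_nat (Poly_Mapping.lookup a j) * (?q a * ?q b * G a b) = 0"
          by simp
      qed
    qed
    also have "\<dots> = (\<Sum>(a, b)\<in>exp_splits c. of_nat (Suc (Poly_Mapping.lookup a j)) * (?q (a + ?d) * ?q b * G (a + ?d) b))"
      by (subst sum.reindex) (auto simp: inj_on_def lookup_add intro!: sum.cong)
    also have "\<dots> = (\<Sum>(a, b)\<in>exp_splits c. ?q a * ?q b * G (a + ?d) b)"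
    proof (intro sum.cong refl, clarify)
      fix a b
      assume ab: "(a, b) \<in> exp_splits c"
      show "of_nat (Suc (Poly_Mapping.lookup a j)) * (?q (a + ?d) * ?q b * G (a + ?d) b) = ?q a * ?q b * G (a + ?d) b"
        by (simp only: mult.assoc[symmetric] inv_exp_fact_add_unit'[OF j ne[OF lookup_le(1)[OF ab]]])
    qed
    finally show ?thesis .
  qed
  have right: "(\<Sum>(a, b)\<in>?S. of_nat (Poly_Mapping.lookup b j) * (?q a * ?q b * G a b)) =
      (\<Sum>(a, b)\<in>exp_splits c. ?q a * ?q b * G a (b + ?d))"
  proof -
    have "(\<Sum>(a, b)\<in>?S. of_nat (Poly_Mapping.lookup b j) * (?q a * ?q b * G a b)) =
        (\<Sum>(a, b)\<in>(\<lambda>(a, b). (a, b + ?d)) ` exp_splits c. of_nat (Poly_Mapping.lookup b j) * (?q a * ?q b * G a b))"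
    proof (rule sum.mono_neutral_right[OF finite_exp_splits], goal_cases)
      case 1
      show ?case
        by (auto simp: exp_splits_def ac_simps)
    next
      case 2
      have *: "(a, b) \<in> (\<lambda>(a, b). (a, b + ?d)) ` exp_splits c" if "a + b = c + ?d" "Poly_Mapping.lookup b j \<noteq> 0" for a b
      proof -
        have "a + (b - ?d) + ?d = c + ?d"
          using exp_minus_plus_unit[OF that(2)] that(1) by (metis add.assoc)
        then show ?thesis
          using exp_minus_plus_unit[OF that(2)]
          by (intro image_eqI[of _ _ "(a, b - ?d)"]) (auto simp: exp_splits_def)
      qed
      show ?case
      proof clarify
        fix a b
        assume "(a, b) \<in> ?S" "(a, b) \<notin> (\<lambda>(a, b). (a, b + ?d)) ` exp_splits c"
        then have "Poly_Mapping.lookup b j = 0"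
          using *[of a b] by (auto simp: exp_splits_def)
        then show "of_nat (Poly_Mapping.lookup b j) * (?q a * ?q b * G a b) = 0"
          by simp
      qed
    qed
    also have "\<dots> = (\<Sum>(a, b)\<in>exp_splits c. of_nat (Suc (Poly_Mapping.lookup b j)) * (?q a * ?q (b + ?d) * G a (b + ?d)))"
      by (subst sum.reindex) (auto simp: inj_on_def lookup_add intro!: sum.cong)
    also have "\<dots> = (\<Sum>(a, b)\<in>exp_splits c. ?q a * ?q b * G a (b + ?d))"
    proof (intro sum.cong refl, clarify)
      fix a b
      assume ab: "(a, b) \<in> exp_splits c"
      have "of_nat (Suc (Poly_Mapping.lookup b j)) * (?q a * ?q (b + ?d) * G a (b + ?d)) =
          ?q a * (of_nat (Suc (Poly_Mapping.lookup b j)) * ?q (b + ?d)) * G a (b + ?d)"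
        by (simp only: ac_simps)
      then show "of_nat (Suc (Poly_Mapping.lookup b j)) * (?q a * ?q (b + ?d) * G a (b + ?d)) = ?q a * ?q b * G a (b + ?d)"
        by (simp only: inv_exp_fact_add_unit'[OF j ne[OF lookup_le(2)[OF ab]]])
    qed
    finally show ?thesis .
  qed
  have "of_nat (Suc (Poly_Mapping.lookup c j)) * (\<Sum>(a, b)\<in>?S. ?q a * ?q b * G a b) =
      (\<Sum>(a, b)\<in>?S. of_nat (Poly_Mapping.lookup a j) * (?q a * ?q b * G a b)) +
      (\<Sum>(a, b)\<in>?S. of_nat (Poly_Mapping.lookup b j) * (?q a * ?q b * G a b))"
    unfolding sum_distrib_left sum.distrib[symmetric]
  proof (intro sum.cong refl, clarify)
    fix a b
    assume "(a, b) \<in> ?S"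
    then have "Poly_Mapping.lookup (a + b) j = Poly_Mapping.lookup (c + ?d) j"
      by (simp add: exp_splits_def)
    \<comment> \<open>The two weights add up to c_j + 1 on every splitting, so the common factor on
      the left is split between the two sums.\<close>
    then have s: "Suc (Poly_Mapping.lookup c j) = Poly_Mapping.lookup a j + Poly_Mapping.lookup b j"
      by (simp add: lookup_add)
    show "of_nat (Suc (Poly_Mapping.lookup c j)) * (?q a * ?q b * G a b) =
      of_nat (Poly_Mapping.lookup a j) * (?q a * ?q b * G a b) + of_nat (Poly_Mapping.lookup b j) * (?q a * ?q b * G a b)"
      unfolding s by (simp add: distrib_right)
  qed
  also have "\<dots> = (\<Sum>(a, b)\<in>exp_splits c. ?q a * ?q b * (G (a + ?d) b + G a (b + ?d)))"
    unfolding left right sum.distrib[symmetric] by (intro sum.cong refl) (auto simp: distrib_left)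
  finally show ?thesis .
qed

context abelian_action
begin

text \<open>Induction on \<open>c\<close>, with \<phi> arbitrary: a new factor \<open>ad j\<close>
  is absorbed into \<phi> and then distributed over the bracket. Values in the field keep the
  division by c_j + 1 elementary; \<open>nz\<close> says that c! is invertible.\<close>

lemma leibniz:
  fixes \<phi> :: "'l \<Rightarrow> 'k"
  assumes c: "Poly_Mapping.keys c \<subseteq> {..<n}"
    and nz: "\<And>j. of_nat (fact (Poly_Mapping.lookup c j) :: nat) \<noteq> (0 :: 'k)"
    and h: "h \<in> H" "h' \<in> H"
    and add: "\<And>u v. u \<in> H \<Longrightarrow> v \<in> H \<Longrightarrow> \<phi> (u \<oplus> v) = \<phi> u + \<phi> v"
  shows "inv_exp_fact n c * \<phi> (act c (lie_bracket L h h')) =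
    (\<Sum>(a, b)\<in>exp_splits c. inv_exp_fact n a * inv_exp_fact n b * \<phi> (lie_bracket L (act a h) (act b h')))"
  using c nz add
proof (induct c arbitrary: \<phi> rule: exp_induct)
  case zero
  have "exp_splits 0 = {(0, 0)}"
    by (auto simp: exp_splits_def exp_add_eq_zero_iff)
  then show ?case
    by (simp add: act_0 inv_exp_fact_0 del: lookup_zero)
next
  case (unit c j)
  let ?d = "unit_exp j"
  have lc: "Poly_Mapping.lookup (c + ?d) i = (if i = j then Suc (Poly_Mapping.lookup c j) else Poly_Mapping.lookup c i)" for i
    by (auto simp: lookup_add lookup_single when_def)
  have nzj: "of_nat (fact (Suc (Poly_Mapping.lookup c j)) :: nat) \<noteq> (0 :: 'k)"
    using unit(4)[of j] by (simp only: lc if_True simp_thms)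
  have f: "(fact (Suc (Poly_Mapping.lookup c j)) :: nat) = Suc (Poly_Mapping.lookup c j) * fact (Poly_Mapping.lookup c j)"
    by simp
  have s: "of_nat (Suc (Poly_Mapping.lookup c j)) \<noteq> (0 :: 'k)" and fj: "of_nat (fact (Poly_Mapping.lookup c j) :: nat) \<noteq> (0 :: 'k)"
    using nzj unfolding f of_nat_mult by auto
  have nz': "of_nat (fact (Poly_Mapping.lookup c i) :: nat) \<noteq> (0 :: 'k)" for i
    using unit(4)[of i, unfolded lc] fj by (cases "i = j") simp_all
  have add': "\<phi> (ad j (u \<oplus> v)) = \<phi> (ad j u) + \<phi> (ad j v)" if "u \<in> H" "v \<in> H" for u v
    using that unit by (simp add: bracket_add_right y_closed H_subset ad_closed)
  have ad_bracket: "\<phi> (ad j (lie_bracket L (act a h) (act b h'))) =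
      \<phi> (lie_bracket L (act (a + ?d) h) (act b h')) + \<phi> (lie_bracket L (act a h) (act (b + ?d) h'))" for a b
  proof -
    have "ad j (lie_bracket L (act a h) (act b h')) =
        lie_bracket L (ad j (act a h)) (act b h') \<oplus> lie_bracket L (act a h) (ad j (act b h'))"
      using unit(2) h by (intro jacobi_derivation) (auto simp: y_closed H_subset act_closed)
    then show ?thesis
      unfolding act_add_unit[OF unit(2) h(1)] act_add_unit[OF unit(2) h(2)]
      using unit(2) h by (simp add: H_subset act_closed unit(5) H_bracket ad_closed)
  qed
  have "of_nat (Suc (Poly_Mapping.lookup c j)) * (inv_exp_fact n (c + ?d) * \<phi> (act (c + ?d) (lie_bracket L h h'))) =
      inv_exp_fact n c * \<phi> (ad j (act c (lie_bracket L h h')))"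
    unfolding inv_exp_fact_add_unit[OF unit(2)] act_add_unit[OF unit(2) H_bracket[OF H_subset[OF h(1)] h(2)]]
    using s by (simp del: of_nat_Suc)
  also have "\<dots> = (\<Sum>(a, b)\<in>exp_splits c. inv_exp_fact n a * inv_exp_fact n b *
      \<phi> (ad j (lie_bracket L (act a h) (act b h'))))"
    \<comment> \<open>The induction hypothesis is used for the additive map sending u to \<phi> (ad
      j u).\<close>
    by (rule unit(3)[OF nz' add'])
  also have "\<dots> = of_nat (Suc (Poly_Mapping.lookup c j)) * (\<Sum>(a, b)\<in>exp_splits (c + ?d).
      inv_exp_fact n a * inv_exp_fact n b * \<phi> (lie_bracket L (act a h) (act b h')))"
    unfolding sum_exp_splits_add_unit[OF unit(2) nzj] ad_bracket ..
  finally show ?case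
    using s by (simp del: of_nat_Suc)
qed

end

section \<open>The divided power expansion\<close>

lemma bilinear_mapD:
  assumes "bilinear_map V W U \<beta>"
  shows "v \<in> carrier V \<Longrightarrow> w \<in> carrier W \<Longrightarrow> \<beta> v w \<in> carrier U"
    and "v \<in> carrier V \<Longrightarrow> v' \<in> carrier V \<Longrightarrow> w \<in> carrier W \<Longrightarrow> \<beta> (v \<oplus>\<^bsub>V\<^esub> v') w = \<beta> v w \<oplus>\<^bsub>U\<^esub> \<beta> v' w"
    and "v \<in> carrier V \<Longrightarrow> w \<in> carrier W \<Longrightarrow> w' \<in> carrier W \<Longrightarrow> \<beta> v (w \<oplus>\<^bsub>W\<^esub> w') = \<beta> v w \<oplus>\<^bsub>U\<^esub> \<beta> v w'"
    and "v \<in> carrier V \<Longrightarrow> w \<in> carrier W \<Longrightarrow> \<beta> (c \<odot>\<^bsub>V\<^esub> v) w = c \<odot>\<^bsub>U\<^esub> \<beta> v w"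
    and "v \<in> carrier V \<Longrightarrow> w \<in> carrier W \<Longrightarrow> \<beta> v (c \<odot>\<^bsub>W\<^esub> w) = c \<odot>\<^bsub>U\<^esub> \<beta> v w"
  using assms by (auto simp: bilinear_map_def)

lemma bilinear_map_comp:
  assumes "bilinear_map V W U \<beta>"
    and "f \<in> LinearCombinations.module_hom class_ring V' V"
    and "g \<in> LinearCombinations.module_hom class_ring W' W"
  shows "bilinear_map V' W' U (\<lambda>v w. \<beta> (f v) (g w))"
  using assms by (auto simp: bilinear_map_def LinearCombinations.module_hom_def Pi_iff)

text \<open>Bilinearity constrains values on the carriers only. This allows the inner lift of
  \<open>tensor_bracket\<close> to be replaced by an explicit sum, with which it is known to agree
  there.\<close>

lemma bilinear_map_cong:
  assumes "vectorspace class_ring V" "vectorspace class_ring W"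
    and "\<And>v w. v \<in> carrier V \<Longrightarrow> w \<in> carrier W \<Longrightarrow> \<beta> v w = \<beta>' v w"
  shows "bilinear_map V W U \<beta> \<longleftrightarrow> bilinear_map V W U \<beta>'"
proof -
  interpret V: vectorspace class_ring V by (rule assms)
  interpret W: vectorspace class_ring W by (rule assms)
  show ?thesis
    using V.smult_closed W.smult_closed by (simp add: bilinear_map_def assms(3))
qed

lemma bilinear_map_finsum:
  assumes U: "vectorspace class_ring U" and "\<And>i. i \<in> A \<Longrightarrow> bilinear_map V W U (\<beta> i)"
  shows "bilinear_map V W U (\<lambda>v w. \<Oplus>\<^bsub>U\<^esub>i\<in>A. \<beta> i v w)"
proof -
  interpret U: vectorspace class_ring U by (rule U)
  have [simp]: "c \<odot>\<^bsub>U\<^esub> (\<Oplus>\<^bsub>U\<^esub>i\<in>A. f i) = (\<Oplus>\<^bsub>U\<^esub>i\<in>A. c \<odot>\<^bsub>U\<^esub> f i)" if "f \<in> A \<rightarrow> carrier U" for f c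
    using U.finsum_smult[of c f A] that by simp
  note D = bilinear_mapD[OF assms(2)]
  have "(\<Oplus>\<^bsub>U\<^esub>i\<in>A. \<beta> i (v \<oplus>\<^bsub>V\<^esub> v') w) = (\<Oplus>\<^bsub>U\<^esub>i\<in>A. \<beta> i v w) \<oplus>\<^bsub>U\<^esub> (\<Oplus>\<^bsub>U\<^esub>i\<in>A. \<beta> i v' w)"
    if "v \<in> carrier V" "v' \<in> carrier V" "w \<in> carrier W" for v v' w
  proof -
    have "(\<Oplus>\<^bsub>U\<^esub>i\<in>A. \<beta> i (v \<oplus>\<^bsub>V\<^esub> v') w) = (\<Oplus>\<^bsub>U\<^esub>i\<in>A. \<beta> i v w \<oplus>\<^bsub>U\<^esub> \<beta> i v' w)"
      using that by (intro U.finsum_cong') (simp_all add: D)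
    then show ?thesis
      using that by (simp add: D)
  qed
  moreover have "(\<Oplus>\<^bsub>U\<^esub>i\<in>A. \<beta> i v (w \<oplus>\<^bsub>W\<^esub> w')) = (\<Oplus>\<^bsub>U\<^esub>i\<in>A. \<beta> i v w) \<oplus>\<^bsub>U\<^esub> (\<Oplus>\<^bsub>U\<^esub>i\<in>A. \<beta> i v w')"
    if "v \<in> carrier V" "w \<in> carrier W" "w' \<in> carrier W" for v w w'
  proof -
    have "(\<Oplus>\<^bsub>U\<^esub>i\<in>A. \<beta> i v (w \<oplus>\<^bsub>W\<^esub> w')) = (\<Oplus>\<^bsub>U\<^esub>i\<in>A. \<beta> i v w \<oplus>\<^bsub>U\<^esub> \<beta> i v w')"
      using that by (intro U.finsum_cong') (simp_all add: D)
    then show ?thesis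
      using that by (simp add: D)
  qed
  moreover have "(\<Oplus>\<^bsub>U\<^esub>i\<in>A. \<beta> i (c \<odot>\<^bsub>V\<^esub> v) w) = c \<odot>\<^bsub>U\<^esub> (\<Oplus>\<^bsub>U\<^esub>i\<in>A. \<beta> i v w)"
    and "(\<Oplus>\<^bsub>U\<^esub>i\<in>A. \<beta> i v (c \<odot>\<^bsub>W\<^esub> w)) = c \<odot>\<^bsub>U\<^esub> (\<Oplus>\<^bsub>U\<^esub>i\<in>A. \<beta> i v w)"
    if "v \<in> carrier V" "w \<in> carrier W" for c v w
    using that by (auto simp: D Pi_def U.smult_closed intro!: U.finsum_cong')
  ultimately show ?thesis
    unfolding bilinear_map_def by (auto simp: D intro!: U.finsum_closed)
qed

context two_vectorspaces
begin

lemma pure_tensor_closed [simp]: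
  "v \<in> carrier V \<Longrightarrow> w \<in> carrier W \<Longrightarrow> pure_tensor V W v w \<in> carrier (tensor V W)"
  by (simp add: pure_tensor_coset)

lemma pure_tensor_bilinear: "bilinear_map V W (tensor V W) (pure_tensor V W)"
  unfolding bilinear_map_def pure_tensor_coset
  by (auto simp: tensor_add tensor_smult tcoset_eq_iff V.smult_closed W.smult_closed
      linear_ext_add[OF scalars_vectorspace] linear_ext_single[OF scalars_vectorspace] bilinear_mapD)

text \<open>The evaluation rule for the concrete sums of the proof. Indices may repeat a pair
  \<open>(v, w)\<close>; the sum of symbols then accumulates the coefficients, so no injectivity has
  to be shown.\<close>

lemma tensor_lift_sum_pure:
  assumes U: "vectorspace class_ring U" and \<beta>: "bilinear_map V W U \<beta>"
    and "\<And>i. i \<in> A \<Longrightarrow> v i \<in> carrier V" "\<And>i. i \<in> A \<Longrightarrow> w i \<in> carrier W"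
  shows "tensor_lift U \<beta> (tcoset (\<Sum>i\<in>A. Poly_Mapping.single (v i, w i) 1)) = (\<Oplus>\<^bsub>U\<^esub>i\<in>A. \<beta> (v i) (w i))"
proof -
  interpret U: vectorspace class_ring U by (rule U)
  have one: "1 \<odot>\<^bsub>U\<^esub> u = u" if "u \<in> carrier U" for u
    using U.smult_one[OF that] by simp
  show ?thesis
    using assms(3,4) bilinear_mapD(1)[OF \<beta>]
    by (simp add: tensor_lift_coset[OF U \<beta>] linear_ext_sum[OF U \<beta>] linear_ext_single[OF U \<beta>] one
        cong: U.finsum_cong)
qed

end

section \<open>The tensor product of a commutative algebra and a Lie algebra\<close>

locale algebra_lie = X: algebra class_ring X + L: lie_algebra L
  for X :: "('k::field, 'x, 'e) module_scheme" and L :: "('k, 'l, 'c) lie_scheme"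
begin

lemma X_vectorspace: "vectorspace class_ring X"
  by (simp add: vectorspace_def class_field X.module)

lemma L_vectorspace: "vectorspace class_ring L"
  by (rule L.vectorspace_axioms)

sublocale XL: two_vectorspaces X L
  by (intro two_vectorspaces.intro X_vectorspace L_vectorspace)

lemma mult_hom_left: "x \<in> carrier X \<Longrightarrow> (\<lambda>z. x \<otimes>\<^bsub>X\<^esub> z) \<in> LinearCombinations.module_hom class_ring X X"
  using X.smult_assoc2 by (auto simp: LinearCombinations.module_hom_def X.r_distr X.m_comm X.smult_closed)

lemma mult_hom_right: "x \<in> carrier X \<Longrightarrow> (\<lambda>z. z \<otimes>\<^bsub>X\<^esub> x) \<in> LinearCombinations.module_hom class_ring X X"
  using X.smult_assoc2 by (auto simp: LinearCombinations.module_hom_def X.l_distr)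

lemma bracket_hom_left: "a \<in> carrier L \<Longrightarrow> (\<lambda>b. lie_bracket L a b) \<in> LinearCombinations.module_hom class_ring L L"
  by (auto simp: LinearCombinations.module_hom_def L.bracket_closed L.bracket_add_right L.bracket_smult_right)

lemma bracket_hom_right: "a \<in> carrier L \<Longrightarrow> (\<lambda>b. lie_bracket L b a) \<in> LinearCombinations.module_hom class_ring L L"
  by (auto simp: LinearCombinations.module_hom_def L.bracket_closed L.bracket_add_left L.bracket_smult_left)

lemma id_hom_L: "(\<lambda>a. a) \<in> LinearCombinations.module_hom class_ring L L"
  by (simp add: LinearCombinations.module_hom_def)

lemma derivation_action_sum_pure:
  assumes "\<delta> \<in> derivations X"
    and x: "\<And>i. i \<in> A \<Longrightarrow> x i \<in> carrier X" and a: "\<And>i. i \<in> A \<Longrightarrow> a i \<in> carrier L"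
  shows "derivation_action X L \<delta> (XL.tcoset (\<Sum>i\<in>A. Poly_Mapping.single (x i, a i) 1)) =
    XL.tcoset (\<Sum>i\<in>A. Poly_Mapping.single (\<delta> (x i), a i) 1)"
proof -
  have \<delta>: "\<delta> \<in> LinearCombinations.module_hom class_ring X X"
    using assms(1) by (simp add: derivations_def)
  then have "\<delta> z \<in> carrier X" if "z \<in> carrier X" for z
    using that by (auto simp: LinearCombinations.module_hom_def)
  then show ?thesis
    unfolding derivation_action_def using x a
    by (subst XL.tensor_lift_sum_pure[OF XL.tensor_vectorspace bilinear_map_comp[OF XL.pure_tensor_bilinear \<delta> id_hom_L]])
      (simp_all add: XL.pure_tensor_coset XL.tensor_finsum)
qed

text \<open>The bracket is a lift nested in a lift, so the outer one can be evaluated only after the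
  inner one is known to be bilinear in its parameters.\<close>

lemma tensor_bracket_sum_pure:
  assumes x: "\<And>i. i \<in> A \<Longrightarrow> x i \<in> carrier X" and a: "\<And>i. i \<in> A \<Longrightarrow> a i \<in> carrier L"
    and x': "\<And>j. j \<in> B \<Longrightarrow> x' j \<in> carrier X" and a': "\<And>j. j \<in> B \<Longrightarrow> a' j \<in> carrier L"
  shows "tensor_bracket X L (XL.tcoset (\<Sum>i\<in>A. Poly_Mapping.single (x i, a i) 1)) (XL.tcoset (\<Sum>j\<in>B. Poly_Mapping.single (x' j, a' j) 1)) =
    XL.tcoset (\<Sum>i\<in>A. \<Sum>j\<in>B. Poly_Mapping.single (x i \<otimes>\<^bsub>X\<^esub> x' j, lie_bracket L (a i) (a' j)) 1)"
proof -
  let ?T = "tensor X L"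
  let ?t = "XL.tcoset (\<Sum>j\<in>B. Poly_Mapping.single (x' j, a' j) 1)"
  let ?\<beta> = "\<lambda>x\<^sub>1 a\<^sub>1. tensor_lift ?T (\<lambda>x\<^sub>2 a\<^sub>2. pure_tensor X L (x\<^sub>1 \<otimes>\<^bsub>X\<^esub> x\<^sub>2) (lie_bracket L a\<^sub>1 a\<^sub>2)) ?t"
  have inner: "?\<beta> x\<^sub>1 a\<^sub>1 = (\<Oplus>\<^bsub>?T\<^esub>j\<in>B. pure_tensor X L (x\<^sub>1 \<otimes>\<^bsub>X\<^esub> x' j) (lie_bracket L a\<^sub>1 (a' j)))"
    if "x\<^sub>1 \<in> carrier X" "a\<^sub>1 \<in> carrier L" for x\<^sub>1 a\<^sub>1
    by (rule XL.tensor_lift_sum_pure[OF XL.tensor_vectorspace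
          bilinear_map_comp[OF XL.pure_tensor_bilinear mult_hom_left bracket_hom_left]])
      (use that x' a' in auto)
  \<comment> \<open>By \<open>inner\<close> it is a finite sum of pure tensors, each one linear in
    the first and in the second parameter.\<close>
  have "bilinear_map X L ?T ?\<beta>"
    by (subst bilinear_map_cong[OF X_vectorspace L_vectorspace inner])
      (auto intro!: bilinear_map_finsum XL.tensor_vectorspace
        bilinear_map_comp[OF XL.pure_tensor_bilinear mult_hom_right bracket_hom_right] x' a')
  then have "tensor_bracket X L (XL.tcoset (\<Sum>i\<in>A. Poly_Mapping.single (x i, a i) 1)) ?t = (\<Oplus>\<^bsub>?T\<^esub>i\<in>A. ?\<beta> (x i) (a i))"
    unfolding tensor_bracket_def by (rule XL.tensor_lift_sum_pure[OF XL.tensor_vectorspace _ x a])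
  also have "\<dots> = (\<Oplus>\<^bsub>?T\<^esub>i\<in>A. XL.tcoset (\<Sum>j\<in>B. Poly_Mapping.single (x i \<otimes>\<^bsub>X\<^esub> x' j, lie_bracket L (a i) (a' j)) 1))"
  proof (rule XL.T.finsum_cong'[OF refl])
    show "?\<beta> (x i) (a i) = XL.tcoset (\<Sum>j\<in>B. Poly_Mapping.single (x i \<otimes>\<^bsub>X\<^esub> x' j, lie_bracket L (a i) (a' j)) 1)"
      if "i \<in> A" for i
    proof (rule trans[OF inner[OF x[OF that] a[OF that]]])
      show "(\<Oplus>\<^bsub>?T\<^esub>j\<in>B. pure_tensor X L (x i \<otimes>\<^bsub>X\<^esub> x' j) (lie_bracket L (a i) (a' j))) =
          XL.tcoset (\<Sum>j\<in>B. Poly_Mapping.single (x i \<otimes>\<^bsub>X\<^esub> x' j, lie_bracket L (a i) (a' j)) 1)"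
        unfolding XL.pure_tensor_coset
        by (rule XL.tensor_finsum) (use that x a x' a' in \<open>auto simp: L.bracket_closed\<close>)
    qed
  qed (use x a x' a' in \<open>auto simp: L.bracket_closed\<close>)
  also have "\<dots> = XL.tcoset (\<Sum>i\<in>A. \<Sum>j\<in>B. Poly_Mapping.single (x i \<otimes>\<^bsub>X\<^esub> x' j, lie_bracket L (a i) (a' j)) 1)"
    using x a x' a' by (intro XL.tensor_finsum) (auto simp: L.bracket_closed)
  finally show ?thesis .
qed

lemma tensor_lift_character:
  assumes \<epsilon>: "\<epsilon> \<in> algebra_characters X"
    and x: "\<And>i. i \<in> A \<Longrightarrow> x i \<in> carrier X" and a: "\<And>i. i \<in> A \<Longrightarrow> a i \<in> carrier L"
  shows "tensor_lift L (\<lambda>x a. \<epsilon> x \<odot>\<^bsub>L\<^esub> a) (XL.tcoset (\<Sum>i\<in>A. Poly_Mapping.single (x i, a i) 1)) =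
    (\<Oplus>\<^bsub>L\<^esub>i\<in>A. \<epsilon> (x i) \<odot>\<^bsub>L\<^esub> a i)"
proof (rule XL.tensor_lift_sum_pure[OF L_vectorspace])
  have add: "\<epsilon> (v \<oplus>\<^bsub>X\<^esub> w) = \<epsilon> v + \<epsilon> w" if "v \<in> carrier X" "w \<in> carrier X" for v w
    using \<epsilon> ring_hom_add[of \<epsilon> X class_ring v w] that by (simp add: algebra_characters_def)
  have smult: "\<epsilon> (c \<odot>\<^bsub>X\<^esub> v) = c * \<epsilon> v" if "v \<in> carrier X" for c v
    using \<epsilon> that by (simp add: algebra_characters_def)
  have assoc: "(c * d) \<odot>\<^bsub>L\<^esub> u = c \<odot>\<^bsub>L\<^esub> (d \<odot>\<^bsub>L\<^esub> u)" if "u \<in> carrier L" for c d u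
    using L.smult_assoc1[of c d u] that by simp
  have comm: "\<epsilon> v \<odot>\<^bsub>L\<^esub> (c \<odot>\<^bsub>L\<^esub> u) = c \<odot>\<^bsub>L\<^esub> (\<epsilon> v \<odot>\<^bsub>L\<^esub> u)" if "u \<in> carrier L" for c v u
    using that by (simp add: assoc[symmetric] mult.commute)
  show "bilinear_map X L L (\<lambda>x a. \<epsilon> x \<odot>\<^bsub>L\<^esub> a)"
    unfolding bilinear_map_def
    by (auto simp: add smult assoc L.smult_closed L.smult_l_distr[simplified] L.smult_r_distr[simplified]
        intro: comm)
qed (use x a in auto)

end

text \<open>The characteristic divides none of the factors 1, ..., r.\<close>

lemma of_nat_fact_nonzero:
  assumes "CHAR('k::field) = 0 \<or> r < CHAR('k)"
  shows "of_nat (fact r :: nat) \<noteq> (0 :: 'k)"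
  using assms
proof (induct r)
  case (Suc r)
  have "\<not> CHAR('k) dvd Suc r"
    using Suc(2) by (auto dest: dvd_imp_le)
  then have "of_nat (Suc r) \<noteq> (0 :: 'k)"
    by (simp only: of_nat_eq_0_iff_char_dvd) simp
  then show ?case
    using Suc by (simp only: fact_Suc of_nat_mult) auto
qed simp

lemma bilinear_form_sum_right:
  assumes W: "vectorspace class_ring W" and B: "bilinear_form V W B" and v: "v \<in> carrier V"
    and f: "\<And>i. i \<in> A \<Longrightarrow> f i \<in> carrier W"
  shows "B v (\<Oplus>\<^bsub>W\<^esub>i\<in>A. f i) = (\<Sum>i\<in>A. B v (f i))"
proof -
  interpret W: vectorspace class_ring W by (rule W)
  have "B v \<zero>\<^bsub>W\<^esub> = 0"
    using bilinear_mapD(5)[OF B v W.zero_closed, of 0] W.smult_r_null[of 0] by simp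
  then show ?thesis
    using f by (induct A rule: infinite_finite_induct) (auto simp: bilinear_mapD(3)[OF B v] Pi_def)
qed

text \<open>In positive characteristic \<open>char\<close> serves two purposes: the factorials below
  m! are invertible, and x_j^m = 0 in \<open>X\<close>.\<close>

locale divided_power_map = abelian_action L H n y
  for L :: "('k::field, 'l, 'c) lie_scheme" (structure) and H :: "'l set" and n :: nat and y :: "nat \<Rightarrow> 'l" +
  fixes \<theta> :: "'l \<Rightarrow> 'l" and m :: nat
  assumes \<theta>_hom: "\<theta> \<in> lie_hom (L\<lparr>carrier := H\<rparr>) L"
    and m_pos: "m > 0"
    and nilpotent: "j < n \<Longrightarrow> h \<in> H \<Longrightarrow> \<theta> ((ad j ^^ m) h) = \<zero>"
    and char: "CHAR('k) > 0 \<Longrightarrow> m = CHAR('k)"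
begin

abbreviation X :: "('k, 'k mpoly set) module" where
  "X \<equiv> trunc_algebra n"

sublocale A: algebra_lie X L
  by (intro algebra_lie.intro trunc_algebra_algebra lie_algebra_axioms)

lemma \<theta>_closed: "h \<in> H \<Longrightarrow> \<theta> h \<in> carrier L"
  using \<theta>_hom by (auto simp: lie_hom_def LinearCombinations.module_hom_def)

lemma \<theta>_add: "h \<in> H \<Longrightarrow> h' \<in> H \<Longrightarrow> \<theta> (h \<oplus> h') = \<theta> h \<oplus> \<theta> h'"
  using \<theta>_hom by (auto simp: lie_hom_def LinearCombinations.module_hom_def)

lemma \<theta>_smult: "h \<in> H \<Longrightarrow> \<theta> (c \<odot>\<^bsub>L\<^esub> h) = c \<odot>\<^bsub>L\<^esub> \<theta> h"
  using \<theta>_hom by (auto simp: lie_hom_def LinearCombinations.module_hom_def)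

lemma \<theta>_bracket: "h \<in> H \<Longrightarrow> h' \<in> H \<Longrightarrow> \<theta> (lie_bracket L h h') = lie_bracket L (\<theta> h) (\<theta> h')"
  using \<theta>_hom by (auto simp: lie_hom_def)

lemma \<theta>_act_closed: "h \<in> H \<Longrightarrow> \<theta> (act e h) \<in> carrier L"
  by (simp add: \<theta>_closed act_closed)

text \<open>By commutativity, m factors \<open>ad j\<close> can be made the outermost ones; they act
  on an element of \<open>H\<close>, where \<open>nilpotent\<close> applies.\<close>

lemma \<theta>_act_vanish:
  assumes "Poly_Mapping.keys e \<subseteq> {..<n}" "m \<le> Poly_Mapping.lookup e j" "h \<in> H"
  shows "\<theta> (act e h) = \<zero>"
proof -
  have j: "j < n"
    using assms m_pos by (auto simp: in_keys_iff subset_iff)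
  have "e = (e - Poly_Mapping.single j m) + Poly_Mapping.single j m"
    using assms(2) by (auto intro!: poly_mapping_eqI simp: lookup_add lookup_minus lookup_single when_def)
  then have "act e h = (ad j ^^ m) (act (e - Poly_Mapping.single j m) h)"
    using act_add_single[OF j assms(3)] by metis
  then show ?thesis
    using nilpotent[OF j] act_closed[OF assms(3)] by simp
qed

text \<open>The bound is a parameter because the bracket computation in characteristic 0 also runs
  over the box of size 2m.\<close>

definition box :: "nat \<Rightarrow> (nat \<Rightarrow>\<^sub>0 nat) set" where
  "box r = {e. Poly_Mapping.keys e \<subseteq> {..<n} \<and> (\<forall>j. Poly_Mapping.lookup e j < r)}"

lemma finite_box: "finite (box r)"
  unfolding box_def by (rule finite_exp_box)

lemma box_keys: "e \<in> box r \<Longrightarrow> Poly_Mapping.keys e \<subseteq> {..<n}"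
  by (simp add: box_def)

lemma \<theta>_act_vanish_box: "Poly_Mapping.keys e \<subseteq> {..<n} \<Longrightarrow> e \<notin> box m \<Longrightarrow> h \<in> H \<Longrightarrow> \<theta> (act e h) = \<zero>"
  using \<theta>_act_vanish by (force simp: box_def not_less)

text \<open>The divided power monomial x^e / e!.\<close>

definition weight :: "(nat \<Rightarrow>\<^sub>0 nat) \<Rightarrow> 'k mpoly set" where
  "weight e = inv_exp_fact n e \<odot>\<^bsub>X\<^esub> trunc_mono n e"

lemma weight_closed: "Poly_Mapping.keys e \<subseteq> {..<n} \<Longrightarrow> weight e \<in> carrier X"
  by (simp add: weight_def A.X.smult_closed)

text \<open>A fixed representative of F h in the free space, on which bilinear forms can be
  evaluated directly. It respects sums and scalar multiples in \<open>h\<close> only up to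
  relations, so the laws below are stated for cosets.\<close>

definition expansion :: "'l \<Rightarrow> ('k mpoly set \<times> 'l) \<Rightarrow>\<^sub>0 'k" where
  "expansion h = (\<Sum>e\<in>box m. Poly_Mapping.single (weight e, \<theta> (act e h)) 1)"

lemma expansion_closed: "h \<in> H \<Longrightarrow> expansion h \<in> A.XL.Fr"
  by (simp add: expansion_def weight_closed box_keys \<theta>_act_closed)

lemma eval_sum_single:
  assumes "bilinear_form X L B" "\<And>i. i \<in> S \<Longrightarrow> x i \<in> carrier X" "\<And>i. i \<in> S \<Longrightarrow> a i \<in> carrier L"
  shows "linear_ext scalars B (\<Sum>i\<in>S. Poly_Mapping.single (x i, a i) 1) = (\<Sum>i\<in>S. B (x i) (a i))"
  using assms(2,3)
  by (simp add: A.XL.linear_ext_sum[OF scalars_vectorspace assms(1)]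
      A.XL.linear_ext_single[OF scalars_vectorspace assms(1)])

lemma eval_expansion:
  assumes B: "bilinear_form X L B" and h: "h \<in> H"
  shows "linear_ext scalars B (expansion h) =
    (\<Sum>e\<in>box m. inv_exp_fact n e * B (trunc_mono n e) (\<theta> (act e h)))"
  unfolding expansion_def
  by (subst eval_sum_single[OF B])
    (auto simp: weight_closed box_keys \<theta>_act_closed h weight_def bilinear_mapD(4)[OF B])

lemma form_zero_right:
  assumes B: "bilinear_form X L B" and x: "x \<in> carrier X"
  shows "B x \<zero> = 0"
  using bilinear_form_sum_right[OF A.L_vectorspace B x, of "{}"] by simp

lemma form_zero_left:
  assumes B: "bilinear_form X L B" and a: "a \<in> carrier L"
  shows "B \<zero>\<^bsub>X\<^esub> a = 0"
  using bilinear_mapD(4)[OF B A.X.zero_closed a, of 0] A.X.smult_r_null[of 0] by simp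

lemma expansion_add:
  assumes h: "h \<in> H" "h' \<in> H"
  shows "A.XL.tcoset (expansion (h \<oplus> h')) = A.XL.tcoset (expansion h + expansion h')"
proof -
  have "linear_ext scalars B (expansion (h \<oplus> h')) = linear_ext scalars B (expansion h + expansion h')"
    if B: "bilinear_form X L B" for B
  proof -
    have "linear_ext scalars B (expansion h + expansion h') =
        linear_ext scalars B (expansion h) + linear_ext scalars B (expansion h')"
      using h by (simp add: A.XL.linear_ext_add[OF scalars_vectorspace B] expansion_closed)
    also have "\<dots> = linear_ext scalars B (expansion (h \<oplus> h'))"
      unfolding eval_expansion[OF B h(1)] eval_expansion[OF B h(2)] eval_expansion[OF B H_add[OF h]]
        sum.distrib[symmetric]
      using h by (intro sum.cong refl)
        (simp add: act_add \<theta>_add act_closed \<theta>_closed bilinear_mapD(3)[OF B] box_keys distrib_left)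
    finally show ?thesis ..
  qed
  then show ?thesis
    using h by (simp add: A.XL.tcoset_eq_iff expansion_closed H_add)
qed

lemma expansion_smult:
  assumes h: "h \<in> H"
  shows "A.XL.tcoset (expansion (c \<odot>\<^bsub>L\<^esub> h)) = A.XL.tcoset (Poly_Mapping.map ((*) c) (expansion h))"
proof -
  have "linear_ext scalars B (expansion (c \<odot>\<^bsub>L\<^esub> h)) = linear_ext scalars B (Poly_Mapping.map ((*) c) (expansion h))"
    if B: "bilinear_form X L B" for B
  proof -
    have "linear_ext scalars B (Poly_Mapping.map ((*) c) (expansion h)) = c * linear_ext scalars B (expansion h)"
      using h by (simp add: A.XL.linear_ext_scale[OF scalars_vectorspace B] expansion_closed)
    also have "\<dots> = linear_ext scalars B (expansion (c \<odot>\<^bsub>L\<^esub> h))"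
      unfolding eval_expansion[OF B h] eval_expansion[OF B H_smult[OF h]] sum_distrib_left
      using h by (intro sum.cong refl)
        (simp add: act_smult \<theta>_smult act_closed \<theta>_closed bilinear_mapD(5)[OF B] box_keys)
    finally show ?thesis ..
  qed
  then show ?thesis
    using h by (simp add: A.XL.tcoset_eq_iff expansion_closed H_smult)
qed

lemma tensor_bracket_expansion:
  assumes h: "h \<in> H" "h' \<in> H"
  shows "tensor_bracket X L (A.XL.tcoset (expansion h)) (A.XL.tcoset (expansion h')) =
    A.XL.tcoset (expansion (lie_bracket L h h'))"
proof -
  let ?q = "inv_exp_fact n :: _ \<Rightarrow> 'k"
  let ?s = "\<Sum>a\<in>box m. \<Sum>b\<in>box m. Poly_Mapping.single (weight a \<otimes>\<^bsub>X\<^esub> weight b, lie_bracket L (\<theta> (act a h)) (\<theta> (act b h'))) (1 :: 'k)"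
  note cl = weight_closed box_keys \<theta>_act_closed h act_closed \<theta>_closed bracket_closed
  have hh: "lie_bracket L h h' \<in> H"
    using h by (simp add: H_bracket H_subset)
  have bracket_act: "lie_bracket L (\<theta> (act a h)) (\<theta> (act b h')) = \<theta> (lie_bracket L (act a h) (act b h'))"
    and bracket_act_H: "lie_bracket L (act a h) (act b h') \<in> H" for a b
    using h by (simp_all add: \<theta>_bracket act_closed H_bracket H_subset)
  \<comment> \<open>A range for \<open>a + b\<close> in which c! stays invertible: in characteristic
    0 it is wide enough for all sums of two elements of \<open>box m\<close>; in characteristic p it
    cannot exceed p.\<close>
  define M where "M = (if CHAR('k) = 0 then 2 * m else m)"
  have nz: "of_nat (fact (Poly_Mapping.lookup c j) :: nat) \<noteq> (0 :: 'k)" if "c \<in> box M" for c j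
  proof -
    have "Poly_Mapping.lookup c j < M"
      using that by (simp add: box_def)
    then show ?thesis
      using char by (intro of_nat_fact_nonzero) (auto simp: M_def split: if_splits)
  qed
  have "linear_ext scalars B ?s = linear_ext scalars B (expansion (lie_bracket L h h'))"
    if B: "bilinear_form X L B" for B
  proof -
    define g where "g a b = ?q a * ?q b * B (trunc_mono n (a + b)) (\<theta> (lie_bracket L (act a h) (act b h')))" for a b
    have weight_mult: "B (weight a \<otimes>\<^bsub>X\<^esub> weight b) l = ?q a * ?q b * B (trunc_mono n (a + b)) l"
      if "Poly_Mapping.keys a \<subseteq> {..<n}" "Poly_Mapping.keys b \<subseteq> {..<n}" "l \<in> carrier L" for a b l
    proof -
      have "weight a \<otimes>\<^bsub>X\<^esub> weight b = ?q a \<odot>\<^bsub>X\<^esub> (?q b \<odot>\<^bsub>X\<^esub> trunc_mono n (a + b))"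
        using that A.X.smult_assoc2[of "?q a" "trunc_mono n a" "weight b"]
          A.X.smult_assoc2[of "?q b" "trunc_mono n b" "trunc_mono n a"]
        by (simp add: weight_def A.X.smult_closed A.X.m_comm[of "trunc_mono n a"] trunc_mono_mult add.commute)
      then show ?thesis
        using that by (simp add: bilinear_mapD(4)[OF B] A.X.smult_closed keys_exp_add)
    qed
    have "linear_ext scalars B ?s = (\<Sum>a\<in>box m. \<Sum>b\<in>box m. g a b)"
      using cl by (simp add: A.XL.linear_ext_sum[OF scalars_vectorspace B]
          A.XL.linear_ext_single[OF scalars_vectorspace B] weight_mult g_def bracket_act[symmetric])
    also have "\<dots> = (\<Sum>(a, b)\<in>box m \<times> box m. g a b)"
      by (rule sum.cartesian_product)
    \<comment> \<open>Neither index set contains the other in general; the terms in each difference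
      vanish, for different reasons.\<close>
    also have "\<dots> = (\<Sum>(a, b)\<in>{(a, b). a + b \<in> box M}. g a b)"
    proof (rule sum.mono_neutral_cong)
      show "finite {(a, b). a + b \<in> box M}"
      proof (rule finite_subset)
        show "{(a, b). a + b \<in> box M} \<subseteq> (\<Union>c\<in>box M. exp_splits c)"
          by (auto simp: exp_splits_def)
      qed (simp add: finite_box finite_exp_splits)
      show "(case x of (a, b) \<Rightarrow> g a b) = 0" if x: "x \<in> box m \<times> box m - {(a, b). a + b \<in> box M}" for x
      proof -
        obtain a b where ab: "x = (a, b)" "a \<in> box m" "b \<in> box m" "a + b \<notin> box M"
          using x by auto
        have k: "Poly_Mapping.keys (a + b) \<subseteq> {..<n}"
          using ab by (simp add: box_def keys_exp_add)
        then obtain j where j: "M \<le> Poly_Mapping.lookup a j + Poly_Mapping.lookup b j"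
          using ab(4) by (auto simp: box_def lookup_add not_less)
        moreover have "Poly_Mapping.lookup a j < m" "Poly_Mapping.lookup b j < m"
          using ab by (auto simp: box_def)
        ultimately have "CHAR('k) > 0"
          \<comment> \<open>With M = 2m, two entries below m could not reach M; so the
            characteristic is positive and x_j^p is a factor of the monomial.\<close>
          by (auto simp: M_def split: if_splits)
        then have "(trunc_mono n (a + b) :: 'k mpoly set) = \<zero>\<^bsub>X\<^esub>"
          using j char k by (intro trunc_mono_vanish[of _ _ j]) (auto simp: M_def lookup_add)
        then show ?thesis
          by (simp add: ab(1) g_def form_zero_left[OF B] \<theta>_closed bracket_act_H)
      qed
      show "(case x of (a, b) \<Rightarrow> g a b) = 0" if x: "x \<in> {(a, b). a + b \<in> box M} - box m \<times> box m" for x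
      proof -
        obtain a b where ab: "x = (a, b)" "a + b \<in> box M" "a \<notin> box m \<or> b \<notin> box m"
          using x by auto
        then have k: "Poly_Mapping.keys a \<subseteq> {..<n}" "Poly_Mapping.keys b \<subseteq> {..<n}"
          by (auto simp: box_def keys_exp_add)
        \<comment> \<open>One of the two exponents lies outside \<open>box m\<close>, and \<theta>
          turns the bracket into a bracket with this zero factor.\<close>
        have "\<theta> (act a h) = \<zero> \<or> \<theta> (act b h') = \<zero>"
          using ab(3) k h \<theta>_act_vanish_box by blast
        then have "\<theta> (lie_bracket L (act a h) (act b h')) = \<zero>"
          using h by (auto simp: bracket_act[symmetric] \<theta>_act_closed)
        then show ?thesis
          using k by (simp add: ab(1) g_def form_zero_right[OF B] keys_exp_add)
      qed
    qed (auto simp: finite_box)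
    also have "\<dots> = (\<Sum>(a, b)\<in>(\<Union>c\<in>box M. exp_splits c). g a b)"
      by (rule sum.cong) (auto simp: exp_splits_def)
    also have "\<dots> = (\<Sum>c\<in>box M. \<Sum>(a, b)\<in>exp_splits c. g a b)"
      by (rule sum.UNION_disjoint) (use finite_box finite_exp_splits in \<open>auto simp: exp_splits_def\<close>)
    also have "\<dots> = (\<Sum>c\<in>box M. ?q c * B (trunc_mono n c) (\<theta> (act c (lie_bracket L h h'))))"
    proof (rule sum.cong[OF refl])
      fix c
      assume c: "c \<in> box M"
      have "?q c * B (trunc_mono n c) (\<theta> (act c (lie_bracket L h h'))) =
          (\<Sum>(a, b)\<in>exp_splits c. ?q a * ?q b * B (trunc_mono n c) (\<theta> (lie_bracket L (act a h) (act b h'))))"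
        \<comment> \<open>Here \<phi> u is B applied to x^c and \<theta> u. The monomial is held
          fixed while \<open>a\<close> and \<open>b\<close> vary, which is legitimate since a + b =
          c.\<close>
        by (rule leibniz[OF box_keys[OF c] nz[OF c] h])
          (simp add: \<theta>_add \<theta>_closed bilinear_mapD(3)[OF B] box_keys[OF c])
      also have "\<dots> = (\<Sum>(a, b)\<in>exp_splits c. g a b)"
        by (rule sum.cong) (auto simp: g_def exp_splits_def)
      finally show "(\<Sum>(a, b)\<in>exp_splits c. g a b) =
          ?q c * B (trunc_mono n c) (\<theta> (act c (lie_bracket L h h')))" ..
    qed
    \<comment> \<open>Back to the range of the expansion: outside \<open>box m\<close> the value
      \<theta> (y^c [h, h']) is 0.\<close>
    also have "\<dots> = (\<Sum>c\<in>box m. ?q c * B (trunc_mono n c) (\<theta> (act c (lie_bracket L h h'))))"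
    proof (rule sum.mono_neutral_right[OF finite_box])
      show "box m \<subseteq> box M"
        by (auto simp: box_def M_def) (metis add_lessD1 mult_2 trans_less_add1)
    qed (auto simp: \<theta>_act_vanish_box hh box_keys form_zero_right[OF B])
    also have "\<dots> = linear_ext scalars B (expansion (lie_bracket L h h'))"
      by (rule eval_expansion[OF B hh, symmetric])
    finally show ?thesis .
  qed
  moreover have "?s \<in> A.XL.Fr"
    using cl by simp
  ultimately have "A.XL.tcoset ?s = A.XL.tcoset (expansion (lie_bracket L h h'))"
    using expansion_closed[OF hh] by (simp add: A.XL.tcoset_eq_iff)
  moreover have "tensor_bracket X L (A.XL.tcoset (expansion h)) (A.XL.tcoset (expansion h')) = A.XL.tcoset ?s"
    unfolding expansion_def by (rule A.tensor_bracket_sum_pure) (auto simp: cl)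
  ultimately show ?thesis
    by simp
qed

end

section \<open>Linear combinations of the basis and their derivations\<close>

context abelian_action
begin

definition comb :: "(nat \<Rightarrow> 'k) \<Rightarrow> 'l" where
  "comb c = (\<Oplus>\<^bsub>L\<^esub>j\<in>{..<n}. c j \<odot>\<^bsub>L\<^esub> y j)"

lemma smult_y_closed: "j < n \<Longrightarrow> c \<odot>\<^bsub>L\<^esub> y j \<in> carrier L"
  using smult_closed y_closed by simp

lemma comb_closed: "comb c \<in> carrier L"
  unfolding comb_def by (rule M.finsum_closed) (auto simp: smult_y_closed)

lemma comb_bracket:
  assumes h: "h \<in> H"
  shows "lie_bracket L (comb c) h = (\<Oplus>\<^bsub>L\<^esub>j\<in>{..<n}. c j \<odot>\<^bsub>L\<^esub> ad j h)"
proof -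
  have "lie_bracket L (\<Oplus>\<^bsub>L\<^esub>j\<in>A. c j \<odot>\<^bsub>L\<^esub> y j) h = (\<Oplus>\<^bsub>L\<^esub>j\<in>A. c j \<odot>\<^bsub>L\<^esub> ad j h)"
    if "finite A" "A \<subseteq> {..<n}" for A
    using that
  proof (induct A)
    case (insert j A)
    have "(\<lambda>j. c j \<odot>\<^bsub>L\<^esub> y j) \<in> A \<rightarrow> carrier L" "(\<lambda>j. c j \<odot>\<^bsub>L\<^esub> ad j h) \<in> A \<rightarrow> carrier L"
      "c j \<odot>\<^bsub>L\<^esub> ad j h \<in> carrier L"
      using insert.prems h by (auto simp: smult_y_closed H_subset H_smult ad_closed)
    then show ?case
      using insert h by (simp add: bracket_add_left bracket_smult_left smult_y_closed H_subset y_closed M.finsum_closed)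
  qed (simp add: h H_subset)
  then show ?thesis
    by (simp add: comb_def)
qed

lemma additive_finsum:
  fixes \<phi> :: "'l \<Rightarrow> 'k"
  assumes add: "\<And>u v. u \<in> H \<Longrightarrow> v \<in> H \<Longrightarrow> \<phi> (u \<oplus> v) = \<phi> u + \<phi> v"
    and smult: "\<And>c u. u \<in> H \<Longrightarrow> \<phi> (c \<odot>\<^bsub>L\<^esub> u) = c * \<phi> u"
    and f: "\<And>j. j < n \<Longrightarrow> f j \<in> H"
  shows "\<phi> (\<Oplus>\<^bsub>L\<^esub>j\<in>{..<n}. c j \<odot>\<^bsub>L\<^esub> f j) = (\<Sum>j<n. c j * \<phi> (f j))"
proof -
  \<comment> \<open>Membership in \<open>H\<close> is carried through the induction because \<phi>
    is additive only there.\<close>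
  have "(\<Oplus>\<^bsub>L\<^esub>j\<in>A. c j \<odot>\<^bsub>L\<^esub> f j) \<in> H \<and> \<phi> (\<Oplus>\<^bsub>L\<^esub>j\<in>A. c j \<odot>\<^bsub>L\<^esub> f j) = (\<Sum>j\<in>A. c j * \<phi> (f j))"
    if "finite A" "A \<subseteq> {..<n}" for A
    using that
  proof (induct A)
    case empty
    then show ?case
      using smult[OF H_zero, of 0] smult_r_null[of 0] by (simp add: H_zero)
  next
    case (insert j A)
    have "(\<lambda>j. c j \<odot>\<^bsub>L\<^esub> f j) \<in> A \<rightarrow> carrier L" "c j \<odot>\<^bsub>L\<^esub> f j \<in> H"
      using insert.prems f by (auto simp: H_subset H_smult)
    then show ?case
      using insert f by (simp add: H_subset H_add add smult)
  qed
  then show ?thesis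
    by simp
qed

end

context divided_power_map
begin

text \<open>The identity between the j-th partial derivative of F h and F (y_j h), seen through B.
  Lowering e_j by one turns the factor e_j / e! into the inverse factorial of the lowered
  exponent.\<close>

lemma sum_box_shift:
  assumes j: "j < n" and B: "bilinear_form X L B" and h: "h \<in> H"
  shows "(\<Sum>e\<in>box m. inv_exp_fact n e * (of_nat (Poly_Mapping.lookup e j) * B (trunc_mono n (e - unit_exp j)) (\<theta> (act e h)))) =
    (\<Sum>e\<in>box m. inv_exp_fact n e * B (trunc_mono n e) (\<theta> (act (e + unit_exp j) h)))"
proof -
  \<comment> \<open>The exponents that stay in the box when entry j is raised. Left of the shift
    their images miss only terms with factor e_j = 0; right of it they miss only terms killed by
    \<theta>.\<close>
  let ?d = "unit_exp j" and ?S = "{e \<in> box m. e + unit_exp j \<in> box m}"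
  let ?f = "\<lambda>e. inv_exp_fact n e * (of_nat (Poly_Mapping.lookup e j) * B (trunc_mono n (e - ?d)) (\<theta> (act e h)))"
  have "sum ?f (box m) = sum ?f ((\<lambda>e. e + ?d) ` ?S)"
  proof (rule sum.mono_neutral_right[OF finite_box])
    show "\<forall>e\<in>box m - (\<lambda>e. e + ?d) ` ?S. ?f e = 0"
    proof
      fix e
      assume e: "e \<in> box m - (\<lambda>e. e + ?d) ` ?S"
      have "Poly_Mapping.lookup e j = 0"
      proof (rule ccontr)
        assume nz: "Poly_Mapping.lookup e j \<noteq> 0"
        note ed = exp_minus_plus_unit[OF nz]
        have "e - ?d \<in> box m"
          using e keys_exp_minus[of e ?d] by (auto simp: box_def lookup_minus intro: le_less_trans[OF diff_le_self])
        then have "e \<in> (\<lambda>e. e + ?d) ` ?S"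
          using e by (intro image_eqI[of _ _ "e - ?d"]) (simp_all only: ed mem_Collect_eq, auto)
        then show False
          using e by simp
      qed
      then show "?f e = 0"
        by simp
    qed
  qed auto
  also have "\<dots> = (\<Sum>e\<in>?S. inv_exp_fact n e * B (trunc_mono n e) (\<theta> (act (e + ?d) h)))"
  proof (subst sum.reindex)
    show "inj_on (\<lambda>e. e + ?d) ?S"
      by (simp add: inj_on_def)
    show "sum (?f \<circ> (\<lambda>e. e + ?d)) ?S = (\<Sum>e\<in>?S. inv_exp_fact n e * B (trunc_mono n e) (\<theta> (act (e + ?d) h)))"
    proof (rule sum.cong[OF refl])
      fix e
      assume e: "e \<in> ?S"
      have l: "Poly_Mapping.lookup (e + ?d) j = Suc (Poly_Mapping.lookup e j)"
        by (simp add: lookup_add)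
      \<comment> \<open>The strict bound matters: in characteristic p it keeps e_j + 1 below p,
        hence invertible.\<close>
      have "Suc (Poly_Mapping.lookup e j) < m"
        using e unfolding l[symmetric] by (simp add: box_def)
      then have "of_nat (fact (Suc (Poly_Mapping.lookup e j)) :: nat) \<noteq> (0 :: 'k)"
        using char by (intro of_nat_fact_nonzero) auto
      then have nz: "of_nat (Suc (Poly_Mapping.lookup e j)) \<noteq> (0 :: 'k)"
        by (simp only: fact_Suc of_nat_mult) auto
      have "(?f \<circ> (\<lambda>e. e + ?d)) e = of_nat (Suc (Poly_Mapping.lookup e j)) * inv_exp_fact n (e + ?d) *
          B (trunc_mono n e) (\<theta> (act (e + ?d) h))"
        unfolding comp_def l add_diff_cancel_right' by (simp only: ac_simps)
      then show "(?f \<circ> (\<lambda>e. e + ?d)) e = inv_exp_fact n e * B (trunc_mono n e) (\<theta> (act (e + ?d) h))"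
        unfolding inv_exp_fact_add_unit'[OF j nz] .
    qed
  qed
  also have "\<dots> = (\<Sum>e\<in>box m. inv_exp_fact n e * B (trunc_mono n e) (\<theta> (act (e + ?d) h)))"
  proof (rule sum.mono_neutral_left[OF finite_box])
    show "\<forall>e\<in>box m - ?S. inv_exp_fact n e * B (trunc_mono n e) (\<theta> (act (e + ?d) h)) = 0"
    proof
      fix e
      assume e: "e \<in> box m - ?S"
      then have k: "Poly_Mapping.keys (e + ?d) \<subseteq> {..<n}"
        using j by (auto simp: keys_exp_add dest!: box_keys)
      have "\<theta> (act (e + ?d) h) = \<zero>"
        by (rule \<theta>_act_vanish_box[OF k _ h]) (use e in auto)
      then show "inv_exp_fact n e * B (trunc_mono n e) (\<theta> (act (e + ?d) h)) = 0"
        using form_zero_right[OF B trunc_mono_closed[OF box_keys, of e m]] e by simp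
    qed
  qed auto
  finally show ?thesis .
qed

lemma derivation_action_expansion:
  assumes h: "h \<in> H"
  shows "derivation_action X L (trunc_deriv n c) (A.XL.tcoset (expansion h)) =
    A.XL.tcoset (expansion (lie_bracket L (comb c) h))"
proof -
  let ?D = "trunc_deriv n c"
  let ?s = "\<Sum>e\<in>box m. Poly_Mapping.single (?D (weight e), \<theta> (act e h)) (1 :: 'k)"
  let ?u = "lie_bracket L (comb c) h"
  have u: "?u \<in> H"
    by (simp add: H_bracket comb_closed h)
  have D_hom: "?D \<in> LinearCombinations.module_hom class_ring X X"
    using trunc_deriv_derivation[of n c] by (simp add: derivations_def)
  have "linear_ext scalars B ?s = linear_ext scalars B (expansion ?u)" if B: "bilinear_form X L B" for B
  proof -
    have "linear_ext scalars B ?s = (\<Sum>e\<in>box m. B (?D (weight e)) (\<theta> (act e h)))"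
      by (rule eval_sum_single[OF B]) (auto simp: trunc_deriv_closed weight_closed box_keys \<theta>_act_closed h)
    also have "\<dots> = (\<Sum>e\<in>box m. \<Sum>j<n. c j * (inv_exp_fact n e *
        (of_nat (Poly_Mapping.lookup e j) * B (trunc_mono n (e - unit_exp j)) (\<theta> (act e h)))))"
    proof (rule sum.cong[OF refl])
      fix e
      assume e: "e \<in> box m"
      have l: "\<theta> (act e h) \<in> carrier L"
        by (rule \<theta>_act_closed[OF h])
      have "?D (weight e) = inv_exp_fact n e \<odot>\<^bsub>X\<^esub> ?D (trunc_mono n e)"
        unfolding weight_def by (rule module_hom_smult[OF D_hom]) (simp_all add: box_keys[OF e])
      then have "B (?D (weight e)) (\<theta> (act e h)) = inv_exp_fact n e * B (?D (trunc_mono n e)) (\<theta> (act e h))"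
        using l by (simp add: bilinear_mapD(4)[OF B] trunc_deriv_closed box_keys[OF e])
      also have "B (?D (trunc_mono n e)) (\<theta> (act e h)) =
          (\<Sum>j<n. c j * (of_nat (Poly_Mapping.lookup e j) * B (trunc_mono n (e - unit_exp j)) (\<theta> (act e h))))"
        by (rule trunc_deriv_mono[OF box_keys[OF e]]) (simp_all add: bilinear_mapD(2,4)[OF B] l)
      finally show "B (?D (weight e)) (\<theta> (act e h)) = (\<Sum>j<n. c j * (inv_exp_fact n e *
          (of_nat (Poly_Mapping.lookup e j) * B (trunc_mono n (e - unit_exp j)) (\<theta> (act e h)))))"
        by (simp only: sum_distrib_left mult.left_commute)
    qed
    \<comment> \<open>The sums are interchanged so that the shift can be made for each variable
      separately, and interchanged back afterwards.\<close>
    also have "\<dots> = (\<Sum>j<n. c j * (\<Sum>e\<in>box m. inv_exp_fact n e *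
        (of_nat (Poly_Mapping.lookup e j) * B (trunc_mono n (e - unit_exp j)) (\<theta> (act e h)))))"
      unfolding sum_distrib_left by (rule sum.swap)
    also have "\<dots> = (\<Sum>j<n. c j * (\<Sum>e\<in>box m. inv_exp_fact n e * B (trunc_mono n e) (\<theta> (act (e + unit_exp j) h))))"
      by (intro sum.cong refl) (simp only: sum_box_shift[OF _ B h] lessThan_iff)
    also have "\<dots> = (\<Sum>e\<in>box m. \<Sum>j<n. c j * (inv_exp_fact n e * B (trunc_mono n e) (\<theta> (act (e + unit_exp j) h))))"
      unfolding sum_distrib_left by (rule sum.swap)
    also have "\<dots> = (\<Sum>e\<in>box m. inv_exp_fact n e * B (trunc_mono n e) (\<theta> (act e ?u)))"
    proof (rule sum.cong[OF refl])
      fix e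
      assume e: "e \<in> box m"
      have "B (trunc_mono n e) (\<theta> (act e ?u)) = (\<Sum>j<n. c j * B (trunc_mono n e) (\<theta> (act e (ad j h))))"
        unfolding comb_bracket[OF h]
        by (rule additive_finsum)
          (simp_all add: act_add \<theta>_add act_smult \<theta>_smult act_closed \<theta>_closed bilinear_mapD(3,5)[OF B]
            box_keys[OF e] ad_closed h)
      also have "\<dots> = (\<Sum>j<n. c j * B (trunc_mono n e) (\<theta> (act (e + unit_exp j) h)))"
        by (intro sum.cong refl) (simp only: act_ad[OF _ h] act_add_unit[OF _ h] lessThan_iff)
      finally show "(\<Sum>j<n. c j * (inv_exp_fact n e * B (trunc_mono n e) (\<theta> (act (e + unit_exp j) h)))) =
          inv_exp_fact n e * B (trunc_mono n e) (\<theta> (act e ?u))"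
        by (simp only: sum_distrib_left mult.left_commute)
    qed
    also have "\<dots> = linear_ext scalars B (expansion ?u)"
      by (rule eval_expansion[OF B u, symmetric])
    finally show ?thesis .
  qed
  moreover have "?s \<in> A.XL.Fr"
    by (simp add: trunc_deriv_closed weight_closed box_keys \<theta>_act_closed h)
  ultimately have "A.XL.tcoset ?s = A.XL.tcoset (expansion ?u)"
    using expansion_closed[OF u] by (simp add: A.XL.tcoset_eq_iff)
  moreover have "derivation_action X L ?D (A.XL.tcoset (expansion h)) = A.XL.tcoset ?s"
    unfolding expansion_def
    by (rule A.derivation_action_sum_pure)
      (auto simp: trunc_deriv_derivation weight_closed box_keys \<theta>_act_closed h)
  ultimately show ?thesis
    by simp
qed

text \<open>Evaluation at the origin kills every monomial except x^0, whose coefficient is \<theta>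
  h.\<close>

lemma evaluate_expansion:
  assumes h: "h \<in> H"
  shows "tensor_lift L (\<lambda>x a. trunc_eval n x \<odot>\<^bsub>L\<^esub> a) (A.XL.tcoset (expansion h)) = \<theta> h"
proof -
  have E: "trunc_eval n \<in> algebra_characters X"
    by (rule trunc_eval_character)
  have eps: "trunc_eval n (weight e) = (if e = 0 then 1 else 0)" if "e \<in> box m" for e
  proof -
    have "trunc_eval n (weight e) = inv_exp_fact n e * trunc_eval n (trunc_mono n e :: 'k mpoly set)"
      using E box_keys[OF that] by (simp add: algebra_characters_def weight_def)
    then show ?thesis
      using box_keys[OF that] by (simp add: trunc_eval_mono inv_exp_fact_0)
  qed
  have z: "0 \<in> box m"
    using m_pos by (simp add: box_def)
  have cl: "trunc_eval n (weight e) \<odot>\<^bsub>L\<^esub> \<theta> (act e h) \<in> carrier L" for e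
    using \<theta>_act_closed[OF h, of e] smult_closed by simp
  have one: "1 \<odot>\<^bsub>L\<^esub> \<theta> h = \<theta> h" and null: "0 \<odot>\<^bsub>L\<^esub> \<theta> (act e h) = \<zero>" for e
    using smult_one[OF \<theta>_closed[OF h]] lmult_0[OF \<theta>_act_closed[OF h]] by simp_all
  have "tensor_lift L (\<lambda>x a. trunc_eval n x \<odot>\<^bsub>L\<^esub> a) (A.XL.tcoset (expansion h)) =
      (\<Oplus>\<^bsub>L\<^esub>e\<in>box m. trunc_eval n (weight e) \<odot>\<^bsub>L\<^esub> \<theta> (act e h))"
    unfolding expansion_def
    by (rule A.tensor_lift_character[OF trunc_eval_character]) (auto simp: weight_closed box_keys \<theta>_act_closed h)
  also have "\<dots> = (\<Oplus>\<^bsub>L\<^esub>e\<in>insert 0 (box m - {0}). trunc_eval n (weight e) \<odot>\<^bsub>L\<^esub> \<theta> (act e h))"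
    using z by (simp add: insert_absorb)
  also have "\<dots> = trunc_eval n (weight 0) \<odot>\<^bsub>L\<^esub> \<theta> (act 0 h) \<oplus>
      (\<Oplus>\<^bsub>L\<^esub>e\<in>box m - {0}. trunc_eval n (weight e) \<odot>\<^bsub>L\<^esub> \<theta> (act e h))"
    using cl by (intro M.finsum_insert) (auto simp: finite_box)
  also have "(\<Oplus>\<^bsub>L\<^esub>e\<in>box m - {0}. trunc_eval n (weight e) \<odot>\<^bsub>L\<^esub> \<theta> (act e h)) = \<zero>"
    by (rule M.add.finprod_one_eqI) (simp add: eps null)
  also have "trunc_eval n (weight 0) \<odot>\<^bsub>L\<^esub> \<theta> (act 0 h) \<oplus> \<zero> = \<theta> h"
    using \<theta>_closed[OF h] by (simp add: eps[OF z] act_0 one del: lookup_zero)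
  finally show ?thesis .
qed

lemma expansion_formula:
  assumes h: "h \<in> H"
  shows "(\<Oplus>\<^bsub>tensor X L\<^esub>i\<in>{..<n} \<rightarrow>\<^sub>E {0..m - 1}.
      pure_tensor X L
        (inverse (of_nat (\<Prod>j<n. fact (i j))) \<odot>\<^bsub>X\<^esub>
          (\<Otimes>\<^bsub>X\<^esub>j\<in>{..<n}. trunc_var n j [^]\<^bsub>X\<^esub> i j))
        (\<theta> (monomial_action L n y i h))) = A.XL.tcoset (expansion h)"
proof -
  let ?E = "{..<n} \<rightarrow>\<^sub>E {0..m - 1}"
  let ?g = "\<lambda>e. Poly_Mapping.single (weight e, \<theta> (act e h)) (1 :: 'k)"
  have summand: "pure_tensor X L
        (inverse (of_nat (\<Prod>j<n. fact (i j))) \<odot>\<^bsub>X\<^esub>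
          (\<Otimes>\<^bsub>X\<^esub>j\<in>{..<n}. trunc_var n j [^]\<^bsub>X\<^esub> i j))
        (\<theta> (monomial_action L n y i h)) = A.XL.tcoset (?g (exp_vec n i))" for i
  proof -
    have "monomial_action L n y i h = act (exp_vec n i) h"
      unfolding monomial_action_def by (intro foldr_cong) (auto simp: lookup_exp_vec)
    moreover have "inv_exp_fact n (exp_vec n i) = inverse (of_nat (\<Prod>j<n. fact (i j)) :: 'k)"
      by (simp add: inv_exp_fact_def lookup_exp_vec)
    ultimately show ?thesis
      by (simp only: A.XL.pure_tensor_coset weight_def trunc_var_monomial)
  qed
  \<comment> \<open>Functions in \<open>?E\<close> are \<open>undefined\<close> off
    \<open>{..<n}\<close>, exponent vectors are 0 there; hence the restriction in the inverse. As m
    > 0, the bounds \<open>\<le> m - 1\<close> and \<open>< m\<close> agree.\<close>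
  have "bij_betw (exp_vec n) ?E (box m)"
  proof (rule bij_betwI[where g = "\<lambda>e. restrict (Poly_Mapping.lookup e) {..<n}"])
    show "exp_vec n \<in> ?E \<rightarrow> box m"
    proof
      fix i assume i: "i \<in> ?E"
      have "i j < m" if "j < n" for j
        using PiE_mem[OF i, of j] that m_pos by auto
      then show "exp_vec n i \<in> box m"
        using keys_exp_vec m_pos by (auto simp: box_def lookup_exp_vec)
    qed
    show "(\<lambda>e. restrict (Poly_Mapping.lookup e) {..<n}) \<in> box m \<rightarrow> ?E"
    proof
      fix e assume "e \<in> box m"
      then have "Poly_Mapping.lookup e j \<le> m - 1" for j
        unfolding box_def by (metis (mono_tags, lifting) One_nat_def Suc_pred less_Suc_eq_le m_pos mem_Collect_eq)
      then show "restrict (Poly_Mapping.lookup e) {..<n} \<in> ?E"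
        by (simp add: restrict_PiE_iff)
    qed
    show "restrict (Poly_Mapping.lookup (exp_vec n i)) {..<n} = i" if "i \<in> ?E" for i
      using that by (auto simp: fun_eq_iff lookup_exp_vec restrict_def PiE_def extensional_def)
    show "exp_vec n (restrict (Poly_Mapping.lookup e) {..<n}) = e" if "e \<in> box m" for e
      using box_keys[OF that] by (intro poly_mapping_eqI) (auto simp: lookup_exp_vec in_keys_iff subset_iff)
  qed
  then have "(\<Sum>i\<in>?E. ?g (exp_vec n i)) = expansion h"
    unfolding expansion_def by (rule sum.reindex_bij_betw)
  moreover have "(\<Oplus>\<^bsub>tensor X L\<^esub>i\<in>?E. A.XL.tcoset (?g (exp_vec n i))) = A.XL.tcoset (\<Sum>i\<in>?E. ?g (exp_vec n i))"
    by (rule A.XL.tensor_finsum) (auto simp: weight_closed keys_exp_vec \<theta>_act_closed h)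
  ultimately show ?thesis
    unfolding summand by simp
qed

end

section \<open>The homomorphism into the wreath product\<close>

context abelian_action
begin

lemma comb_add: "comb (\<lambda>j. c j + d j) = comb c \<oplus> comb d"
proof -
  have "comb (\<lambda>j. c j + d j) = (\<Oplus>\<^bsub>L\<^esub>j\<in>{..<n}. c j \<odot>\<^bsub>L\<^esub> y j \<oplus> d j \<odot>\<^bsub>L\<^esub> y j)"
    unfolding comb_def using y_closed
    by (intro M.finsum_cong') (auto simp: smult_l_distr[simplified] smult_y_closed)
  then show ?thesis
    by (simp add: comb_def smult_y_closed Pi_def)
qed

lemma comb_smult: "comb (\<lambda>j. a * c j) = a \<odot>\<^bsub>L\<^esub> comb c"
proof -
  have "comb (\<lambda>j. a * c j) = (\<Oplus>\<^bsub>L\<^esub>j\<in>{..<n}. a \<odot>\<^bsub>L\<^esub> (c j \<odot>\<^bsub>L\<^esub> y j))"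
    unfolding comb_def using y_closed smult_closed
    by (intro M.finsum_cong') (auto simp: smult_assoc1[simplified] smult_y_closed)
  also have "\<dots> = a \<odot>\<^bsub>L\<^esub> comb c"
    unfolding comb_def by (rule finsum_smult[symmetric]) (auto simp: smult_y_closed)
  finally show ?thesis .
qed

lemma comb_cong: "(\<And>j. j < n \<Longrightarrow> c j = d j) \<Longrightarrow> comb c = comb d"
  unfolding comb_def by (rule M.finsum_cong') (auto simp: smult_y_closed)

lemma comb_zero: "comb (\<lambda>j. 0) = \<zero>"
  unfolding comb_def using y_closed by (intro M.add.finprod_one_eqI) (simp add: lmult_0[simplified])

lemma comb_unit: "i < n \<Longrightarrow> comb (\<lambda>j. if j = i then 1 else 0) = y i"
proof -
  assume i: "i < n"
  have "comb (\<lambda>j. if j = i then 1 else 0) = (\<Oplus>\<^bsub>L\<^esub>j\<in>{..<n}. if i = j then y j else \<zero>)"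
    unfolding comb_def using y_closed
    by (intro M.finsum_cong') (auto simp: lmult_0[simplified] smult_one[simplified])
  then show ?thesis
    using i y_closed M.add.finprod_singleton[of i "{..<n}" y] by (simp add: Pi_def)
qed

end

text \<open>The decomposition of L into \<open>H\<close> and an abelian complement, expressed in
  coordinates. Coefficient functions are compared only below \<open>n\<close>, which is all that
  \<open>comb\<close> and \<open>trunc_deriv\<close> depend on.\<close>

locale split_action = divided_power_map L H n y \<theta> m
  for L :: "('k::field, 'l, 'c) lie_scheme" (structure) and H :: "'l set" and n :: nat and y :: "nat \<Rightarrow> 'l"
    and \<theta> :: "'l \<Rightarrow> 'l" and m :: nat +
  assumes decompose: "a \<in> carrier L \<Longrightarrow> \<exists>h\<in>H. \<exists>c. a = h \<oplus> comb c"
    and decompose_unique: "h \<in> H \<Longrightarrow> h' \<in> H \<Longrightarrow> h \<oplus> comb c = h' \<oplus> comb d \<Longrightarrow>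
      h = h' \<and> (\<forall>j<n. c j = d j)"
    and comb_commute: "lie_bracket L (comb c) (comb d) = \<zero>"
begin

text \<open>The choice is harmless: \<open>h\<close> is determined, and two admissible
  \<open>c\<close> agree below \<open>n\<close>, so they define the same derivation.\<close>

definition embedding :: "'l \<Rightarrow> (('k mpoly set \<times> 'l) \<Rightarrow>\<^sub>0 'k) set \<times> ('k mpoly set \<Rightarrow> 'k mpoly set)" where
  "embedding a = (let (h, c) = (SOME (h, c). h \<in> H \<and> a = h \<oplus> comb c) in
     (A.XL.tcoset (expansion h), trunc_deriv n c))"

lemma embedding_eq:
  assumes h: "h \<in> H"
  shows "embedding (h \<oplus> comb c) = (A.XL.tcoset (expansion h), trunc_deriv n c)"
proof -
  let ?p = "SOME (h', c'). h' \<in> H \<and> h \<oplus> comb c = h' \<oplus> comb c'"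
  have "case ?p of (h', c') \<Rightarrow> h' \<in> H \<and> h \<oplus> comb c = h' \<oplus> comb c'"
    by (rule someI[where x = "(h, c)"]) (simp add: h)
  then obtain h' c' where p: "?p = (h', c')" "h' \<in> H" "h \<oplus> comb c = h' \<oplus> comb c'"
    by (cases ?p) auto
  then have "h' = h" "trunc_deriv n c' = trunc_deriv n c"
    using decompose_unique[OF h p(2,3)] by (auto intro: trunc_deriv_cong)
  then show ?thesis
    by (simp add: embedding_def p(1))
qed

lemma embedding_H:
  assumes "h \<in> H"
  shows "embedding h = (A.XL.tcoset (expansion h), \<zero>\<^bsub>Der X\<^esub>)"
  using embedding_eq[OF assms, of "\<lambda>j. 0"] assms by (simp add: comb_zero H_subset trunc_deriv_zero)

text \<open>In the free space this representative is a sum of symbols with second component 0 and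
  not itself 0; homogeneity with scalar 0 shows that its coset is the zero tensor.\<close>

lemma expansion_zero: "A.XL.tcoset (expansion \<zero>) = \<zero>\<^bsub>tensor X L\<^esub>"
proof -
  have "Poly_Mapping.map ((*) 0) (expansion \<zero>) = 0"
    by (rule poly_mapping_eqI) (simp add: lookup_scale)
  then show ?thesis
    using expansion_smult[OF H_zero, of 0] smult_r_null[of 0] by (simp add: A.XL.tensor_zero)
qed

lemma embedding_y:
  assumes "i < n"
  shows "embedding (y i) = (\<zero>\<^bsub>tensor X L\<^esub>, trunc_partial n i)"
  using embedding_eq[OF H_zero, of "\<lambda>j. if j = i then 1 else 0"] assms
  by (simp add: comb_unit y_closed expansion_zero trunc_partial_eq)

lemma wreath_simps:
  "carrier (wreath L X) = carrier (tensor X L) \<times> carrier (Der X)"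
  "(s, \<delta>) \<oplus>\<^bsub>wreath L X\<^esub> (t, \<epsilon>) = (s \<oplus>\<^bsub>tensor X L\<^esub> t, \<delta> \<oplus>\<^bsub>Der X\<^esub> \<epsilon>)"
  "r \<odot>\<^bsub>wreath L X\<^esub> (s, \<delta>) = (r \<odot>\<^bsub>tensor X L\<^esub> s, r \<odot>\<^bsub>Der X\<^esub> \<delta>)"
  "lie_bracket (wreath L X) (s, \<delta>) (t, \<epsilon>) =
    ((tensor_bracket X L s t \<oplus>\<^bsub>tensor X L\<^esub> derivation_action X L \<delta> t) \<ominus>\<^bsub>tensor X L\<^esub> derivation_action X L \<epsilon> s,
     lie_bracket (Der X) \<delta> \<epsilon>)"
  by (simp_all add: wreath_def)

text \<open>Brackets: for u, v in the complement, [h + u, h' + v] = [h, h'] + [u, h'] - [v, h],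
  because [u, v] = 0. The three terms correspond to the three terms in the first component of the
  wreath bracket, while the derivations commute.\<close>

lemma embedding_lie_hom: "embedding \<in> lie_hom L (wreath L X)"
proof -
  have closed: "embedding a \<in> carrier (wreath L X)" if a: "a \<in> carrier L" for a
  proof -
    obtain h c where "h \<in> H" "a = h \<oplus> comb c"
      using decompose[OF a] by blast
    then show ?thesis
      by (simp add: embedding_eq wreath_simps expansion_closed Der_simps trunc_deriv_derivation)
  qed
  have add: "embedding (a \<oplus> b) = embedding a \<oplus>\<^bsub>wreath L X\<^esub> embedding b"
    if ab: "a \<in> carrier L" "b \<in> carrier L" for a b
  proof -
    obtain h c where h: "h \<in> H" "a = h \<oplus> comb c"
      using decompose[OF ab(1)] by blast
    obtain h' d where h': "h' \<in> H" "b = h' \<oplus> comb d"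
      using decompose[OF ab(2)] by blast
    have "a \<oplus> b = (h \<oplus> h') \<oplus> comb (\<lambda>j. c j + d j)"
      using h h' by (simp add: comb_add H_subset comb_closed M.a_ac)
    then show ?thesis
      using h h' by (simp add: embedding_eq H_add wreath_simps expansion_add A.XL.tensor_add trunc_deriv_add)
  qed
  have smult: "embedding (r \<odot>\<^bsub>L\<^esub> a) = r \<odot>\<^bsub>wreath L X\<^esub> embedding a" if a: "a \<in> carrier L" for r a
  proof -
    obtain h c where h: "h \<in> H" "a = h \<oplus> comb c"
      using decompose[OF a] by blast
    have "r \<odot>\<^bsub>L\<^esub> a = r \<odot>\<^bsub>L\<^esub> h \<oplus> comb (\<lambda>j. r * c j)"
      using h by (simp add: comb_smult smult_r_distr[simplified] H_subset comb_closed)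
    then show ?thesis
      using h by (simp add: embedding_eq H_smult wreath_simps expansion_smult A.XL.tensor_smult trunc_deriv_smult)
  qed
  have bracket: "embedding (lie_bracket L a b) = lie_bracket (wreath L X) (embedding a) (embedding b)"
    if ab: "a \<in> carrier L" "b \<in> carrier L" for a b
  proof -
    obtain h c where h: "h \<in> H" "a = h \<oplus> comb c"
      using decompose[OF ab(1)] by blast
    obtain h' d where h': "h' \<in> H" "b = h' \<oplus> comb d"
      using decompose[OF ab(2)] by blast
    let ?u = "lie_bracket L h h'" and ?v = "lie_bracket L (comb c) h'" and ?w = "lie_bracket L (comb d) h"
    have H: "?u \<in> H" "?v \<in> H" "?w \<in> H"
      using h h' by (simp_all add: H_bracket H_subset comb_closed)
    note cl = H_subset[OF H(1)] H_subset[OF H(2)] H_subset[OF H(3)] H_subset[OF h(1)] H_subset[OF h'(1)]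
    \<comment> \<open>The sign is written as a scalar so that \<open>expansion_smult\<close>
      applies.\<close>
    have neg: "\<ominus> ?w = (- 1) \<odot>\<^bsub>L\<^esub> ?w"
      using smult_minus_1[OF cl(3)] by (simp add: class_ring_simps)
    have "lie_bracket L a b = ?u \<oplus> ?v \<oplus> (\<ominus> ?w)"
    proof -
      have "lie_bracket L a b = ?u \<oplus> ?v \<oplus> lie_bracket L h (comb d)"
        using cl by (simp add: h(2) h'(2) bracket_add_left bracket_add_right comb_closed bracket_closed comb_commute)
      also have "lie_bracket L h (comb d) = \<ominus> ?w"
        using cl by (simp add: bracket_antisym[of h] comb_closed)
      finally show ?thesis .
    qed
    also have "\<dots> = (?u \<oplus> ?v \<oplus> (- 1) \<odot>\<^bsub>L\<^esub> ?w) \<oplus> comb (\<lambda>j. 0)"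
      using cl H_subset[OF H_smult[OF H(3)]] by (simp add: neg comb_zero)
    finally have "embedding (lie_bracket L a b) =
        (A.XL.tcoset (expansion (?u \<oplus> ?v \<oplus> (- 1) \<odot>\<^bsub>L\<^esub> ?w)), trunc_deriv n (\<lambda>j. 0))"
      using H by (simp add: embedding_eq H_add H_smult)
    also have "A.XL.tcoset (expansion (?u \<oplus> ?v \<oplus> (- 1) \<odot>\<^bsub>L\<^esub> ?w)) =
        (A.XL.tcoset (expansion ?u) \<oplus>\<^bsub>tensor X L\<^esub> A.XL.tcoset (expansion ?v))
          \<ominus>\<^bsub>tensor X L\<^esub> A.XL.tcoset (expansion ?w)"
    proof -
      have "(- 1) \<odot>\<^bsub>tensor X L\<^esub> t = \<ominus>\<^bsub>tensor X L\<^esub> t" if "t \<in> carrier (tensor X L)" for t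
        using A.XL.T.smult_minus_1[OF that] by (simp add: class_ring_simps)
      then show ?thesis
        using H by (simp add: expansion_add expansion_smult H_add H_smult A.XL.tensor_add[symmetric]
            A.XL.tensor_smult[symmetric] expansion_closed a_minus_def)
    qed
    finally show ?thesis
      using h h' by (simp add: embedding_eq wreath_simps tensor_bracket_expansion derivation_action_expansion
          trunc_deriv_bracket trunc_deriv_zero)
  qed
  show ?thesis
    using closed add smult bracket by (auto simp: lie_hom_def LinearCombinations.module_hom_def)
qed

lemma embedding_virtual_endomorphism: "virtual_endomorphism L X embedding (trunc_eval n) H \<theta>"
  unfolding virtual_endomorphism_def
proof (intro conjI ballI)
  show "H = {a \<in> carrier L. snd (embedding a) = \<zero>\<^bsub>Der X\<^esub>}"
  proof (intro equalityI subsetI)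
    fix a assume "a \<in> {a \<in> carrier L. snd (embedding a) = \<zero>\<^bsub>Der X\<^esub>}"
    then obtain h c where h: "h \<in> H" "a = h \<oplus> comb c" and z: "snd (embedding a) = \<zero>\<^bsub>Der X\<^esub>"
      using decompose by blast
    then have "trunc_deriv n c = \<zero>\<^bsub>Der X\<^esub>"
      by (simp add: embedding_eq)
    \<comment> \<open>The partial derivatives are independent, so the kernel of the projection is no
      larger than \<open>H\<close>.\<close>
    then have "comb c = comb (\<lambda>j. 0)"
      by (intro comb_cong trunc_deriv_eq_zeroD)
    then show "a \<in> H"
      using h by (simp add: comb_zero H_subset)
  qed (simp add: embedding_H H_subset)
  show "\<theta> h = tensor_lift L (\<lambda>x a. trunc_eval n x \<odot>\<^bsub>L\<^esub> a) (fst (embedding h))" if "h \<in> H" for h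
    using that by (simp add: embedding_H evaluate_expansion)
qed

end

text \<open>The basis lives in the record with restricted carrier, whereas all computations take
  place in L. The injective indexing turns a combination over a set of vectors into a sum over
  indices.\<close>

lemma lincomb_carrier_update:
  fixes y :: "nat \<Rightarrow> 'v"
  assumes "vectorspace class_ring V" "submodule class_ring W V" "inj_on y {..<n}" "y ` {..<n} \<subseteq> W"
  shows "module.lincomb (V\<lparr>carrier := W\<rparr>) a (y ` {..<n}) = (\<Oplus>\<^bsub>V\<^esub>j\<in>{..<n}. a (y j) \<odot>\<^bsub>V\<^esub> y j)"
proof -
  interpret V: vectorspace class_ring V by (rule assms)
  have W: "W \<subseteq> carrier V"
    using assms(2) by (simp add: submodule_def)
  have "module.lincomb (V\<lparr>carrier := W\<rparr>) a (y ` {..<n}) = V.lincomb a (y ` {..<n})"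
    using assms by (intro V.lincomb_not_depend[symmetric]) auto
  also have "\<dots> = (\<Oplus>\<^bsub>V\<^esub>j\<in>{..<n}. a (y j) \<odot>\<^bsub>V\<^esub> y j)"
    unfolding V.lincomb_def using assms(3,4) W
    by (intro V.finsum_reindex) (auto intro!: V.smult_closed)
  finally show ?thesis .
qed

theorem theoremB:
  fixes L :: "('k::field, 'l, 'c) lie_scheme"
    and H L\<^sub>0 :: "'l set"
    and \<theta> :: "'l \<Rightarrow> 'l"
    and n m :: nat
    and X :: "('k, 'k mpoly set) module"
  assumes "lie_algebra L"
    and "semidirect_decomposition L H L\<^sub>0"
    and "\<forall>a\<in>L\<^sub>0. \<forall>b\<in>L\<^sub>0. lie_bracket L a b = \<zero>\<^bsub>L\<^esub>"
    and "vectorspace.fin_dim class_ring (L\<lparr>carrier := L\<^sub>0\<rparr>)"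
    and "vectorspace.dim class_ring (L\<lparr>carrier := L\<^sub>0\<rparr>) = n"
    and "\<theta> \<in> lie_hom (L\<lparr>carrier := H\<rparr>) L"
    and "m > 0"
    and "\<forall>b\<in>L\<^sub>0. \<forall>h\<in>H. \<theta> ((lie_bracket L b ^^ m) h) = \<zero>\<^bsub>L\<^esub>"
    and "CHAR('k) > 0 \<longrightarrow> m = CHAR('k)"
    and "X = trunc_algebra n"
  shows "\<exists>\<psi>\<in>lie_hom L (wreath L X). \<exists>y::nat \<Rightarrow> 'l.
    inj_on y {..<n} \<and>
    vectorspace.basis class_ring (L\<lparr>carrier := L\<^sub>0\<rparr>) (y ` {..<n}) \<and>
    (\<forall>h\<in>H. \<psi> h =
      (\<Oplus>\<^bsub>tensor X L\<^esub>i\<in>{..<n} \<rightarrow>\<^sub>E {0..m - 1}.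
         pure_tensor X L
           (inverse (of_nat (\<Prod>j<n. fact (i j))) \<odot>\<^bsub>X\<^esub>
              (\<Otimes>\<^bsub>X\<^esub>j\<in>{..<n}. trunc_var n j [^]\<^bsub>X\<^esub> i j))
           (\<theta> (monomial_action L n y i h)),
       \<zero>\<^bsub>Der X\<^esub>)) \<and>
    (\<forall>i<n. \<psi> (y i) = (\<zero>\<^bsub>tensor X L\<^esub>, trunc_partial n i)) \<and>
    (\<exists>\<epsilon>\<in>algebra_characters X.
      (\<forall>i<n. \<epsilon> (trunc_var n i) = 0) \<and> virtual_endomorphism L X \<psi> \<epsilon> H \<theta>)"
proof -
  interpret L: lie_algebra L
    by (rule assms)
  have ideal: "lie_ideal H L" and L0: "VectorSpace.subspace class_ring L\<^sub>0 L"
    and sum: "H <+>\<^bsub>L\<^esub> L\<^sub>0 = carrier L" and int: "H \<inter> L\<^sub>0 = {\<zero>\<^bsub>L\<^esub>}"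
    using assms(2) by (auto simp: semidirect_decomposition_def lie_subalgebra_def)
  have L0_sub: "submodule class_ring L\<^sub>0 L"
    using L0 by (simp add: VectorSpace.subspace_def)
  have L0_subset: "L\<^sub>0 \<subseteq> carrier L"
    using L0_sub by (simp add: submodule_def)
  interpret L0: vectorspace class_ring "L\<lparr>carrier := L\<^sub>0\<rparr>"
    by (rule L.subspace_is_vs[OF L0])
  obtain S where S: "finite S" "L0.basis S"
    using L0.finite_basis_exists[OF assms(4)] by blast
  have "card S = n"
    using L0.dim_basis[OF S] assms(5) by simp
  then obtain y where "bij_betw y {0..<n} S"
    using ex_bij_betw_nat_finite[OF S(1)] by auto
  then have y: "inj_on y {..<n}" "y ` {..<n} = S"
    by (auto simp: bij_betw_def lessThan_atLeast0)
  have y_L0: "y j \<in> L\<^sub>0" if "j < n" for j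
    using that y(2) S(2) by (auto simp: L0.basis_def)
  interpret AA: abelian_action L H n y
    using ideal y_L0 L0_subset assms(3) by unfold_locales auto
  have comb: "L0.lincomb a S = AA.comb (\<lambda>j. a (y j))" for a
    unfolding y(2)[symmetric] AA.comb_def
    by (rule lincomb_carrier_update[OF L.vectorspace_axioms L0_sub y(1)]) (use y_L0 in auto)
  have comb_L0: "AA.comb c \<in> L\<^sub>0" for c
  proof -
    \<comment> \<open>Coefficients indexed by numbers are carried over to coefficients indexed by
      basis vectors along the inverse of \<open>y\<close>.\<close>
    have "L0.lincomb (\<lambda>v. c (the_inv_into {..<n} y v)) S \<in> L\<^sub>0"
      using L0.lincomb_closed[of S] S(2) by (simp add: L0.basis_def)
    moreover have "AA.comb (\<lambda>j. c (the_inv_into {..<n} y (y j))) = AA.comb c"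
      by (rule AA.comb_cong) (simp add: the_inv_into_f_f[OF y(1)])
    ultimately show ?thesis
      by (simp add: comb)
  qed
  have comb_eq_zeroD: "c j = 0" if c: "AA.comb c = \<zero>\<^bsub>L\<^esub>" and j: "j < n" for c j
  proof (rule ccontr)
    assume nz: "c j \<noteq> 0"
    let ?a = "\<lambda>v. c (the_inv_into {..<n} y v)"
    have "AA.comb (\<lambda>j. ?a (y j)) = AA.comb c"
      by (rule AA.comb_cong) (simp add: the_inv_into_f_f[OF y(1)])
    then have "L0.lincomb ?a S = \<zero>\<^bsub>L\<^esub>"
      by (simp add: comb c)
    then have "L0.lin_dep S"
      using nz j y by (intro L0.lin_dep_crit[of S S ?a "y j"])
        (auto simp: S(1) the_inv_into_f_f[OF y(1)])
    then show False
      using S(2) by (simp add: L0.basis_def)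
  qed
  interpret split_action L H n y \<theta> m
  proof unfold_locales
    show "\<exists>h\<in>H. \<exists>c. a = h \<oplus>\<^bsub>L\<^esub> AA.comb c" if a: "a \<in> carrier L" for a
    proof -
      obtain h u where h: "h \<in> H" "u \<in> L\<^sub>0" "a = h \<oplus>\<^bsub>L\<^esub> u"
        using a unfolding sum[symmetric] by (auto simp: set_add_def')
      then have "u \<in> L0.span S"
        using S(2) by (simp add: L0.basis_def)
      then obtain c where "u = L0.lincomb c S"
        using L0.finite_in_span[OF S(1)] S(2) by (auto simp: L0.basis_def)
      then show ?thesis
        using h comb by auto
    qed
    show "h = h' \<and> (\<forall>j<n. c j = d j)"
      if h: "h \<in> H" "h' \<in> H" and eq: "h \<oplus>\<^bsub>L\<^esub> AA.comb c = h' \<oplus>\<^bsub>L\<^esub> AA.comb d" for h h' c d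
    proof -
      \<comment> \<open>The coordinates of the difference: h - h' equals \<open>comb ?e\<close>,
        which lies in both \<open>H\<close> and the complement and is therefore 0.\<close>
      let ?e = "\<lambda>j. d j + (- 1) * c j"
      have cl: "h \<in> carrier L" "h' \<in> carrier L" "AA.comb c \<in> carrier L" "AA.comb d \<in> carrier L"
        using h by (simp_all add: AA.H_subset AA.comb_closed)
      have neg: "(- 1) \<odot>\<^bsub>L\<^esub> v = \<ominus>\<^bsub>L\<^esub> v" if "v \<in> carrier L" for v
        using L.smult_minus_1[OF that] by (simp add: class_ring_simps)
      have e: "AA.comb ?e = AA.comb d \<oplus>\<^bsub>L\<^esub> \<ominus>\<^bsub>L\<^esub> AA.comb c"
        using cl by (simp only: AA.comb_add AA.comb_smult neg)
      have "h \<oplus>\<^bsub>L\<^esub> \<ominus>\<^bsub>L\<^esub> h' = AA.comb ?e"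
      proof -
        have "h = (h \<oplus>\<^bsub>L\<^esub> AA.comb c) \<oplus>\<^bsub>L\<^esub> \<ominus>\<^bsub>L\<^esub> AA.comb c"
          using cl by (simp add: L.M.a_assoc L.M.r_neg)
        also have "\<dots> = h' \<oplus>\<^bsub>L\<^esub> AA.comb ?e"
          unfolding eq e using cl by (simp add: L.M.a_assoc)
        finally have "h = h' \<oplus>\<^bsub>L\<^esub> AA.comb ?e" .
        then show ?thesis
          using cl AA.comb_closed[of ?e] by (simp add: L.M.a_comm[of h'] L.M.a_assoc L.M.r_neg)
      qed
      moreover have "h \<oplus>\<^bsub>L\<^esub> \<ominus>\<^bsub>L\<^esub> h' \<in> H"
        using h AA.H_smult[of h' "- 1"] by (simp add: neg[OF cl(2), symmetric] AA.H_add)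
      ultimately have "h \<oplus>\<^bsub>L\<^esub> \<ominus>\<^bsub>L\<^esub> h' = \<zero>\<^bsub>L\<^esub>" "AA.comb ?e = \<zero>\<^bsub>L\<^esub>"
        using int comb_L0[of ?e] by auto
      moreover from this(1) have "h = h'"
        using cl by (simp add: L.M.minus_eq[symmetric])
      ultimately show ?thesis
        using comb_eq_zeroD[of ?e] by simp
    qed
    show "lie_bracket L (AA.comb c) (AA.comb d) = \<zero>\<^bsub>L\<^esub>" for c d
      using assms(3) comb_L0 by blast
  qed (use assms(6-9) y_L0 in auto)
  have "(\<forall>i<n. trunc_eval n (trunc_var n i :: 'k mpoly set) = 0)"
    \<comment> \<open>The exponent of x_i is not 0, so its constant term is.\<close>
    by (simp add: trunc_var_mono trunc_eval_mono flip: keys_eq_empty)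
  then have "\<exists>\<epsilon>\<in>algebra_characters (trunc_algebra n :: ('k, 'k mpoly set) module).
      (\<forall>i<n. \<epsilon> (trunc_var n i) = 0) \<and> virtual_endomorphism L (trunc_algebra n) embedding \<epsilon> H \<theta>"
    using trunc_eval_character embedding_virtual_endomorphism by blast
  moreover have "embedding h =
      (\<Oplus>\<^bsub>tensor (trunc_algebra n) L\<^esub>i\<in>{..<n} \<rightarrow>\<^sub>E {0..m - 1}.
         pure_tensor (trunc_algebra n) L
           (inverse (of_nat (\<Prod>j<n. fact (i j))) \<odot>\<^bsub>trunc_algebra n\<^esub>
              (\<Otimes>\<^bsub>trunc_algebra n\<^esub>j\<in>{..<n}. trunc_var n j [^]\<^bsub>trunc_algebra n\<^esub> i j))
           (\<theta> (monomial_action L n y i h)),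
       \<zero>\<^bsub>Der (trunc_algebra n)\<^esub>)" if "h \<in> H" for h
    using that by (simp only: expansion_formula embedding_H)
  ultimately show ?thesis
    unfolding assms(10) using S(2) y embedding_y
    by (intro bexI[OF _ embedding_lie_hom] exI[of _ y] conjI ballI allI impI) simp_all
qed

end
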